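(* Let $B_R\subset\mathbb{R}^n$ be a ball of radius $R$ (centered at zero) and let $W$ be a Bessel potential on $B_R$ such that $\frac{W_r(r)}{W(r)}=-\frac{\lambda}{r}+f(r)$, where $f(r)\ge0$ and $\lim_{r\to0}rf(r)=0$. Assume $m\in\mathbb{N}$, $1\le l\le m$, and $2k+4m\le n$. Then for all $u\in C_0^\infty(B_R)$ $$\int_{B_R}\frac{|\Delta^m u|^2}{|x|^{2k}}dx\ge\prod_{i=0}^{l-1}\beta_{n,k+2i}\int_{B_R}\frac{|\Delta^{m-l}u|^2}{|x|^{2k+4l}}dx+\sum_{i=0}^{l-1}\sigma_{n,k+2i}\prod_{j=1}^{l-1}\beta_{n,k+2j-2}\int_{B_R}\frac{W(x)|\Delta^{m-i-1}u|^2}{|x|^{2k+4i+2}}dx .$$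
   Context: A non-negative real-valued $C^1$ function $W$ is a Bessel potential on $(0,R)$ (equivalently, regarded as a radial function $W(x)=W(|x|)$, on the ball $B_R$) if there is $c>0$ such that $y''+\frac1r y'+cW(r)y=0$ has a positive solution on $(0,R)$; its weight $\beta(W;R)$ is the supremum of all such $c$. $W_r$ is the derivative of $W$ in $r$, and $\lambda$ is a real number. For $\mu\le\frac{n-4}{2}$, $$\beta_{n,\mu}=\inf_{u\in C_0^\infty(B_R)\setminus\{0\}}\frac{\int_{B_R}\frac{|\Delta u|^2}{|x|^{2\mu}}dx}{\int_{B_R}\frac{u^2}{|x|^{2\mu+4}}dx},\qquad \sigma_{n,\mu}=\beta(W;R)\Big(\frac{(n+2\mu)^2}{4}+\frac{(n-2\mu-\lambda-2)^2}{4}\Big).$$ Convention: $\prod_{i=1}^0a_i=1$.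
   Formalization: The inner product of β_{n,k+2j-2} runs over 1≤j≤i instead of 1≤j≤l-1; as printed the inequality fails, e.g. for n=10, k=0, m=l=2, R=1, W=1, λ=0, f=0 and u close to (1-|x|²)^6. *)

theory Defs
  imports "HOL-Analysis.Analysis"
begin

definition partial_deriv :: "'a \<Rightarrow> ('a::euclidean_space \<Rightarrow> real) \<Rightarrow> 'a \<Rightarrow> real" where
  "partial_deriv i u x = frechet_derivative u (at x) i"

definition laplacian :: "('a::euclidean_space \<Rightarrow> real) \<Rightarrow> 'a \<Rightarrow> real" where
  "laplacian u x = (\<Sum>i\<in>Basis. partial_deriv i (partial_deriv i u) x)"

primrec Ck :: "nat \<Rightarrow> ('a::euclidean_space \<Rightarrow> real) \<Rightarrow> bool" where
  "Ck 0 u \<longleftrightarrow> continuous_on UNIV u"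
| "Ck (Suc k) u \<longleftrightarrow> (\<forall>x. u differentiable (at x)) \<and> (\<forall>i\<in>Basis. Ck k (partial_deriv i u))"

text \<open>The space of smooth functions with compact support in the open ball of radius
  \<open>R\<close>; its elements are regarded as functions on the whole space that vanish outside the ball.\<close>

definition Cc_inf_ball :: "real \<Rightarrow> ('a::euclidean_space \<Rightarrow> real) set" where
  "Cc_inf_ball R = {u. (\<forall>k. Ck k u) \<and>
     compact (closure {x. u x \<noteq> 0}) \<and> closure {x. u x \<noteq> 0} \<subseteq> ball 0 R}"

definition bessel_positive_solution :: "(real \<Rightarrow> real) \<Rightarrow> real \<Rightarrow> real \<Rightarrow> bool" where
  "bessel_positive_solution W R c \<longleftrightarrow>
     (\<exists>y y' y''. \<forall>r\<in>{0<..<R}.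
        y r > 0 \<and>
        (y has_real_derivative y' r) (at r) \<and>
        (y' has_real_derivative y'' r) (at r) \<and>
        y'' r + 1 / r * y' r + c * W r * y r = 0)"

definition bessel_potential :: "(real \<Rightarrow> real) \<Rightarrow> real \<Rightarrow> bool" where
  "bessel_potential W R \<longleftrightarrow>
     W C1_differentiable_on {0<..<R} \<and>
     (\<forall>r\<in>{0<..<R}. W r \<ge> 0) \<and>
     (\<exists>c>0. bessel_positive_solution W R c)"

text \<open>Taken in \<^typ>\<open>ennreal\<close>, so that the supremum never degenerates.\<close>

definition bessel_weight :: "(real \<Rightarrow> real) \<Rightarrow> real \<Rightarrow> ennreal" where
  "bessel_weight W R = (SUP c\<in>{c. c > 0 \<and> bessel_positive_solution W R c}. ennreal c)"

text \<open>All integrals below are integrals of nonnegative functions and take values in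
  \<^typ>\<open>ennreal\<close>; a divergent integral has the value \<open>\<infinity>\<close>, not \<open>0\<close>.  The values of
  the integrands at the origin are irrelevant.

  In \<open>rellich_const\<close> the dimension \<open>n\<close> is \<open>DIM('a)\<close>.  For
  \<open>\<mu> \<le> (n - 4) / 2\<close>, the range in which the constant is used, the numerator is finite and
  the denominator is nonzero, so the quotient is never of the form \<open>0 / 0\<close> or
  \<open>\<infinity> / \<infinity>\<close>; if \<open>\<mu> = (n - 4) / 2\<close> the denominator may be \<open>\<infinity>\<close>, and the
  quotient is then \<open>0\<close>.\<close>

definition rellich_const :: "'a::euclidean_space itself \<Rightarrow> real \<Rightarrow> real \<Rightarrow> ennreal" where
  "rellich_const _ R \<mu> =
     (INF u \<in> (Cc_inf_ball R :: ('a \<Rightarrow> real) set) - {\<lambda>x. 0}.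
        (\<integral>\<^sup>+x\<in>ball 0 R. ennreal ((laplacian u x)\<^sup>2 / norm x powr (2 * \<mu>)) \<partial>lborel) /
        (\<integral>\<^sup>+x\<in>ball 0 R. ennreal ((u x)\<^sup>2 / norm x powr (2 * \<mu> + 4)) \<partial>lborel))"

definition sigma_const ::
    "'a::euclidean_space itself \<Rightarrow> (real \<Rightarrow> real) \<Rightarrow> real \<Rightarrow> real \<Rightarrow> real \<Rightarrow> ennreal" where
  "sigma_const _ W R lam \<mu> = bessel_weight W R *
     ennreal ((real DIM('a) + 2 * \<mu>)\<^sup>2 / 4 + (real DIM('a) - 2 * \<mu> - lam - 2)\<^sup>2 / 4)"

text \<open>The \<open>i\<close>-th remainder term of the iterated inequality carries the constant
  \<open>\<sigma>\<^bsub>n,k+2i\<^esub>\<close> times the product of \<open>\<beta>\<^bsub>n,k+2j-2\<^esub>\<close> over \<open>1 \<le> j \<le> i\<close>.  The upper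
  limit \<open>l - 1\<close> found in print in place of \<open>i\<close> is a misprint: with it the inequality fails
  for \<open>n = 10\<close>, \<open>k = 0\<close>, \<open>m = l = 2\<close>, \<open>R = 1\<close>, \<open>W = 1\<close> and \<open>u\<close> close to \<open>(1 - |x|\<^sup>2)\<^sup>6\<close>.\<close>

end

theory Submission
  imports Defs
begin

text \<open>
  Write \<open>u = |x|\<^sup>q w\<close> with \<open>q = (2\<mu> + 4 - n) / 2\<close> and use the coordinates \<open>s = ln |x|\<close>,
  \<open>\<omega> = x / |x|\<close>. Then \<open>\<integral> |\<Delta>u|\<^sup>2 / |x|\<^bsup>2\<mu>\<^esup>\<close> becomes the integral of
  \<open>(w\<^bsub>ss\<^esub> + b w\<^bsub>s\<^esub> + (\<Lambda> - e) w)\<^sup>2\<close> for the measure \<open>ds d\<omega>\<close>, where \<open>\<Lambda>\<close> is the Laplacian of the sphere,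
  and integration by parts bounds it below by the integrals of
  \<open>w\<^bsub>ss\<^esub>\<^sup>2\<close>, \<open>(b\<^sup>2 + 2e) w\<^bsub>s\<^esub>\<^sup>2\<close> and \<open>((\<Lambda> - e) w)\<^sup>2\<close>. Stretching test functions in \<open>s\<close> shows that the
  last one dominates \<open>\<beta>\<^bsub>n,\<mu>\<^esub> w\<^sup>2\<close>, while the equation of the Bessel potential and a weighted Hardy
  inequality extract \<open>\<sigma>\<^bsub>n,\<mu>\<^esub> |x|\<^sup>2 W w\<^sup>2\<close> from the radial derivatives. Logarithmic cutoffs remove
  the condition that \<open>u\<close> vanishes near the origin, and the inequality is then iterated along
  \<open>u, \<Delta>u, \<dots>, \<Delta>\<^bsup>m-1\<^esup>u\<close>.
\<close>

section \<open>Functions supported in an annulus\<close>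

text \<open>The obstacle is that \<open>rellich_const\<close> is only an infimum over test
  functions. Applied to u itself it would consume the whole energy and leave nothing for the term
  with W. Hence the constant is charged to the angular integral alone, and all radial derivatives
  remain available for sigma. They are just enough: with D = n - 2 mu - 4 one has b^2 + 2 e = (n + 2
  mu)^2 / 4 + D^2 / 4, one half for each summand of sigma. The Hardy step behind the second summand
  uses lam <= 2. This is not among the hypotheses of the theorem; it follows from the existence of a
  positive solution, because a potential with lam > 2 is too singular at the origin to admit one.
  Both \<open>rellich_const\<close> and \<open>bessel_weight\<close> are extended reals, so the
  inequality is first proved for a real B below the one and a real c admissible for the other. The
  passage to the suprema comes last.\<close>

definition annular :: "real \<Rightarrow> ('a::euclidean_space \<Rightarrow> real) \<Rightarrow> bool" where
  "annular R f \<longleftrightarrow> (\<exists>p>0. \<exists>q<R. \<forall>x. f x \<noteq> 0 \<longrightarrow> p \<le> norm x \<and> norm x \<le> q)"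

definition Ck_ann :: "nat \<Rightarrow> real \<Rightarrow> ('a::euclidean_space \<Rightarrow> real) \<Rightarrow> bool" where
  "Ck_ann k R f \<longleftrightarrow> Ck k f \<and> annular R f"

definition vderiv :: "('a \<Rightarrow> 'a) \<Rightarrow> ('a::euclidean_space \<Rightarrow> real) \<Rightarrow> 'a \<Rightarrow> real" where
  "vderiv A f x = frechet_derivative f (at x) (A x)"

section \<open>Closure properties of \<open>Ck\<close>\<close>

lemma has_derivative_frechet: "f differentiable (at x) \<Longrightarrow> (f has_derivative frechet_derivative f (at x)) (at x)"
  by (simp add: frechet_derivative_works)

lemma partial_deriv_eq: "(f has_derivative f') (at x) \<Longrightarrow> partial_deriv i f x = f' i"
  unfolding partial_deriv_def by (simp add: frechet_derivative_at[symmetric])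

lemma vderiv_eq: "(f has_derivative f') (at x) \<Longrightarrow> vderiv A f x = f' (A x)"
  unfolding vderiv_def by (simp add: frechet_derivative_at[symmetric])

lemma Ck_Suc_differentiable: "Ck (Suc k) f \<Longrightarrow> f differentiable (at x)"
  by simp

lemma Ck_SucD: "Ck (Suc k) f \<Longrightarrow> Ck k f"
proof (induction k arbitrary: f)
  case 0
  then show ?case
    by (auto intro!: continuous_at_imp_continuous_on differentiable_imp_continuous_within)
next
  case (Suc k)
  from Suc.prems have "\<forall>x. f differentiable (at x)" "\<forall>i\<in>Basis. Ck (Suc k) (partial_deriv i f)"
    unfolding Ck.simps(2)[of "Suc k"] by auto
  then show ?case using Suc.IH by auto
qed

lemma Ck_le: "j \<le> k \<Longrightarrow> Ck k f \<Longrightarrow> Ck j f"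
  by (induction rule: inc_induct) (auto dest: Ck_SucD simp del: Ck.simps)

lemma Ck_continuous_on: "Ck k f \<Longrightarrow> continuous_on S f"
  using Ck_le[of 0 k f] by (auto intro: continuous_on_subset)

lemma Ck_SucI:
  assumes "\<And>x. f differentiable (at x)" "\<And>i. i \<in> Basis \<Longrightarrow> Ck k (partial_deriv i f)"
  shows "Ck (Suc k) f"
  using assms by simp

lemma partial_deriv_add:
  assumes "f differentiable (at x)" "g differentiable (at x)"
  shows "partial_deriv i (\<lambda>x. f x + g x) x = partial_deriv i f x + partial_deriv i g x"
  using partial_deriv_eq[OF has_derivative_add[OF assms[THEN has_derivative_frechet]], of i]
  by (simp add: partial_deriv_def)

lemma partial_deriv_mult:
  assumes "f differentiable (at x)" "g differentiable (at x)"
  shows "partial_deriv i (\<lambda>x. f x * g x) x = f x * partial_deriv i g x + partial_deriv i f x * g x"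
  using partial_deriv_eq[OF has_derivative_mult[OF assms[THEN has_derivative_frechet]], of i]
  by (simp add: partial_deriv_def)

lemma Ck_add: "Ck k f \<Longrightarrow> Ck k g \<Longrightarrow> Ck k (\<lambda>x. f x + g x)"
proof (induction k arbitrary: f g)
  case (Suc k)
  have "partial_deriv i (\<lambda>x. f x + g x) = (\<lambda>x. partial_deriv i f x + partial_deriv i g x)" for i
    by (rule ext, rule partial_deriv_add) (use Suc.prems in auto)
  with Suc show ?case by (intro Ck_SucI) auto
qed (auto intro: continuous_on_add)

lemma Ck_mult: "Ck k f \<Longrightarrow> Ck k g \<Longrightarrow> Ck k (\<lambda>x. f x * g x)"
proof (induction k arbitrary: f g)
  case (Suc k)
  have *: "partial_deriv i (\<lambda>x. f x * g x) = (\<lambda>x. f x * partial_deriv i g x + partial_deriv i f x * g x)" for i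
    by (rule ext, rule partial_deriv_mult) (use Suc.prems in auto)
  have "Ck k f" "Ck k g" using Suc.prems by (auto dest: Ck_SucD simp del: Ck.simps)
  with Suc show ?case by (intro Ck_SucI) (auto simp: * intro!: Ck_add Suc.IH)
qed (auto intro: continuous_on_mult)

lemma Ck_const: "Ck k (\<lambda>x. c)"
proof (induction k arbitrary: c)
  case (Suc k)
  have "partial_deriv i (\<lambda>x::'a. c) = (\<lambda>x. 0)" for i
    by (rule ext, subst partial_deriv_eq[OF has_derivative_const]) simp
  with Suc show ?case by (intro Ck_SucI) auto
qed simp

lemma Ck_linear:
  assumes "bounded_linear f" shows "Ck k f"
proof (cases k)
  case 0
  then show ?thesis using assms by (simp add: linear_continuous_on)
next
  case (Suc k')
  have "partial_deriv i f = (\<lambda>x. f i)" for i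
    by (rule ext, rule partial_deriv_eq) (rule bounded_linear_imp_has_derivative[OF assms])
  with Suc show ?thesis using bounded_linear_imp_differentiable[OF assms]
    by (auto intro!: Ck_const)
qed

lemma Ck_sum: "(\<And>i. i \<in> I \<Longrightarrow> Ck k (f i)) \<Longrightarrow> Ck k (\<lambda>x. \<Sum>i\<in>I. f i x)"
  by (induction I rule: infinite_finite_induct) (auto intro: Ck_add Ck_const)

lemma Ck_partial_deriv: "Ck (Suc k) f \<Longrightarrow> i \<in> Basis \<Longrightarrow> Ck k (partial_deriv i f)"
  by simp

lemma frechet_derivative_Basis:
  assumes "f differentiable (at x)"
  shows "frechet_derivative f (at x) h = (\<Sum>i\<in>Basis. (h \<bullet> i) * partial_deriv i f x)"
proof -
  have l: "linear (frechet_derivative f (at x))"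
    using assms linear_frechet_derivative by blast
  have "frechet_derivative f (at x) h = frechet_derivative f (at x) (\<Sum>i\<in>Basis. (h \<bullet> i) *\<^sub>R i)"
    by (simp add: euclidean_representation)
  also have "\<dots> = (\<Sum>i\<in>Basis. (h \<bullet> i) * partial_deriv i f x)"
    by (simp add: linear_sum[OF l] linear_cmul[OF l] partial_deriv_def)
  finally show ?thesis .
qed

lemma vderiv_Basis: "f differentiable (at x) \<Longrightarrow> vderiv A f x = (\<Sum>i\<in>Basis. (A x \<bullet> i) * partial_deriv i f x)"
  unfolding vderiv_def by (rule frechet_derivative_Basis)

lemma Ck_inner_linear: "bounded_linear A \<Longrightarrow> Ck k (\<lambda>x. A x \<bullet> i)"
  by (rule Ck_linear) (rule bounded_linear_compose[OF bounded_linear_inner_left])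

lemma Ck_vderiv: assumes "bounded_linear A" "Ck (Suc k) f" shows "Ck k (vderiv A f)"
proof -
  have "vderiv A f = (\<lambda>x. \<Sum>i\<in>Basis. (A x \<bullet> i) * partial_deriv i f x)"
    by (rule ext, rule vderiv_Basis) (use assms in simp)
  then show ?thesis using assms by (auto intro!: Ck_sum Ck_mult Ck_inner_linear)
qed

text \<open>Regularity of an annular function is a question about the punctured ball only: every
  other point has a neighbourhood on which the function vanishes. Factors that are singular at the
  origin, or defined only for radii in (0,R), can therefore be multiplied in freely.\<close>

lemma annular_cases:
  assumes "annular R f"
  obtains "x \<noteq> 0" "norm x < R" | S where "open S" "x \<in> S" "\<And>y. y \<in> S \<Longrightarrow> f y = 0"
proof -
  from assms obtain p q where pq: "p > 0" "q < R" "\<And>x. f x \<noteq> 0 \<Longrightarrow> p \<le> norm x \<and> norm x \<le> q"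
    unfolding annular_def by blast
  consider "norm x < p" | "norm x > q" | "p \<le> norm x" "norm x \<le> q" by linarith
  then show ?thesis
  proof cases
    case 1
    show ?thesis using 1 pq by (intro that(2)[of "ball 0 p"]) force+
  next
    case 2
    have "open (- cball (0::'a) q)" by (simp add: open_Compl)
    then show ?thesis using 2 pq by (intro that(2)[of "- cball 0 q"]) force+
  next
    case 3
    then show ?thesis using pq by (intro that(1)) auto
  qed
qed

lemma annular_has_derivative_0:
  assumes "open S" "x \<in> S" "\<And>y. y \<in> S \<Longrightarrow> f y = 0"
  shows "(f has_derivative (\<lambda>h. 0)) (at x)"
  using has_derivative_transform_within_open[OF has_derivative_const[of "0::'b"] assms(1,2), of f] assms(3)
  by auto

lemma annular_differentiable:
  assumes "annular R f" "\<And>x. x \<noteq> 0 \<Longrightarrow> norm x < R \<Longrightarrow> f differentiable (at x)"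
  shows "f differentiable (at x)"
  using assms(1)
proof (cases rule: annular_cases[of R f x])
  case 2
  then show ?thesis using annular_has_derivative_0 differentiable_def by blast
qed (use assms in auto)

lemma annular_continuous:
  assumes "annular R f" "\<And>x. x \<noteq> 0 \<Longrightarrow> norm x < R \<Longrightarrow> isCont f x"
  shows "continuous_on S f"
proof (intro continuous_at_imp_continuous_on ballI)
  fix x
  show "isCont f x"
    using assms(1)
  proof (cases rule: annular_cases[of R f x])
    case 2
    then show ?thesis using has_derivative_continuous[OF annular_has_derivative_0[OF 2]] by simp
  qed (use assms in auto)
qed

lemma annular_zero: "annular R f \<Longrightarrow> f x = 0" if "x = 0 \<or> norm x \<ge> R"
  using that unfolding annular_def by force

lemma annular_mono: "annular R f \<Longrightarrow> (\<And>x. f x = 0 \<Longrightarrow> g x = 0) \<Longrightarrow> annular R g"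
  unfolding annular_def by metis

lemma annular_frechet:
  assumes "annular R f" shows "annular R (\<lambda>x. frechet_derivative f (at x) (A x))"
proof -
  from assms obtain p q where pq: "p > 0" "q < R" "\<And>x. f x \<noteq> 0 \<Longrightarrow> p \<le> norm x \<and> norm x \<le> q"
    unfolding annular_def by blast
  have "frechet_derivative f (at x) (A x) = 0" if "\<not> (p \<le> norm x \<and> norm x \<le> q)" for x
  proof -
    have "open (ball 0 p \<union> - cball (0::'a) q)" by (intro open_Un open_ball open_Compl closed_cball)
    moreover have "x \<in> ball 0 p \<union> - cball (0::'a) q" using that by auto
    moreover have "\<And>y. y \<in> ball 0 p \<union> - cball (0::'a) q \<Longrightarrow> f y = 0" using pq(3) by force
    ultimately have "(f has_derivative (\<lambda>h. 0)) (at x)" by (rule annular_has_derivative_0)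
    then show ?thesis by (simp add: frechet_derivative_at[symmetric])
  qed
  then show ?thesis unfolding annular_def using pq(1,2) by blast
qed

lemma annular_partial: "annular R f \<Longrightarrow> annular R (partial_deriv i f)"
  unfolding partial_deriv_def[abs_def] by (rule annular_frechet)

lemma annular_vderiv: "annular R f \<Longrightarrow> annular R (vderiv A f)"
  unfolding vderiv_def[abs_def] by (rule annular_frechet)

lemma annular_add: assumes "annular R f" "annular R g" shows "annular R (\<lambda>x. f x + g x)"
proof -
  from assms obtain p q p' q' where pq: "p > 0" "q < R" "\<And>x. f x \<noteq> 0 \<Longrightarrow> p \<le> norm x \<and> norm x \<le> q"
    "p' > 0" "q' < R" "\<And>x. g x \<noteq> 0 \<Longrightarrow> p' \<le> norm x \<and> norm x \<le> q'"
    unfolding annular_def by blast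
  have "f x + g x \<noteq> 0 \<longrightarrow> min p p' \<le> norm x \<and> norm x \<le> max q q'" for x
    using pq(3)[of x] pq(6)[of x] by fastforce
  then show ?thesis unfolding annular_def using pq
    by (intro exI[of _ "min p p'"] conjI exI[of _ "max q q'"]) auto
qed

lemma annular_0: "annular R (\<lambda>x. 0)"
  unfolding annular_def by (rule exI[of _ 1]) (simp add: lt_ex)

lemma annular_sum: "(\<And>i. i \<in> I \<Longrightarrow> annular R (f i)) \<Longrightarrow> annular R (\<lambda>x. \<Sum>i\<in>I. f i x)"
  by (induction I rule: infinite_finite_induct) (auto intro: annular_add annular_0)

lemma Ck_ann_add: "Ck_ann k R f \<Longrightarrow> Ck_ann k R g \<Longrightarrow> Ck_ann k R (\<lambda>x. f x + g x)"
  unfolding Ck_ann_def using Ck_add annular_add by blast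

lemma Ck_ann_sum: "(\<And>i. i \<in> I \<Longrightarrow> Ck_ann k R (f i)) \<Longrightarrow> Ck_ann k R (\<lambda>x. \<Sum>i\<in>I. f i x)"
  unfolding Ck_ann_def by (auto intro: Ck_sum annular_sum)

lemma Ck_ann_Ck_mult: "Ck_ann k R f \<Longrightarrow> Ck k g \<Longrightarrow> Ck_ann k R (\<lambda>x. f x * g x)"
  unfolding Ck_ann_def by (auto intro: Ck_mult elim!: annular_mono)

lemma Ck_ann_mult: "Ck_ann k R f \<Longrightarrow> Ck_ann k R g \<Longrightarrow> Ck_ann k R (\<lambda>x. f x * g x)"
  using Ck_ann_Ck_mult[of k R f g] by (simp add: Ck_ann_def)

lemma Ck_ann_cmult: "Ck_ann k R f \<Longrightarrow> Ck_ann k R (\<lambda>x. c * f x)"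
  using Ck_ann_Ck_mult[OF _ Ck_const] by (simp add: mult.commute)

lemma Ck_ann_power: "Ck_ann k R f \<Longrightarrow> Ck_ann k R (\<lambda>x. (f x)\<^sup>2)"
  using Ck_ann_mult[of k R f f] by (simp add: power2_eq_square)

lemma Ck_ann_diff: "Ck_ann k R f \<Longrightarrow> Ck_ann k R g \<Longrightarrow> Ck_ann k R (\<lambda>x. f x - g x)"
  using Ck_ann_add[OF _ Ck_ann_cmult[of k R g "-1"]] by simp

lemma Ck_ann_vderiv: "bounded_linear A \<Longrightarrow> Ck_ann (Suc k) R f \<Longrightarrow> Ck_ann k R (vderiv A f)"
  unfolding Ck_ann_def using annular_vderiv Ck_vderiv by blast

lemma Ck_ann_partial: "i \<in> Basis \<Longrightarrow> Ck_ann (Suc k) R f \<Longrightarrow> Ck_ann k R (partial_deriv i f)"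
  unfolding Ck_ann_def using annular_partial by auto

lemma Ck_ann_SucD: "Ck_ann (Suc k) R f \<Longrightarrow> Ck_ann k R f"
  unfolding Ck_ann_def using Ck_SucD by blast

lemma Ck_ann_zero: "Ck_ann k R f \<Longrightarrow> f 0 = 0"
  unfolding Ck_ann_def using annular_zero by blast

lemma Ck_ann_differentiable: "Ck_ann (Suc k) R f \<Longrightarrow> f differentiable (at x)"
  unfolding Ck_ann_def by simp

text \<open>Radial factors are written as functions of \<open>x \<bullet> x\<close>, whose gradient \<open>2x\<close> needs no
  division, so that products with them stay smooth by a direct induction.\<close>

coinductive smooth_pos :: "(real \<Rightarrow> real) \<Rightarrow> bool" where
  "(\<And>t. t > 0 \<Longrightarrow> (g has_real_derivative g' t) (at t)) \<Longrightarrow> smooth_pos g' \<Longrightarrow> smooth_pos g"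

lemma smooth_posE:
  assumes "smooth_pos g"
  obtains g' where "\<And>t. t > 0 \<Longrightarrow> (g has_real_derivative g' t) (at t)" "smooth_pos g'"
  using assms by (rule smooth_pos.cases) blast

lemma smooth_pos_coset:
  assumes "g \<in> S" "\<And>g. g \<in> S \<Longrightarrow> \<exists>g'\<in>S. \<forall>t>0. (g has_real_derivative g' t) (at t)"
  shows "smooth_pos g"
  using assms(1)
proof (coinduction arbitrary: g)
  case (smooth_pos g)
  from assms(2)[OF smooth_pos] obtain g' where "g' \<in> S" "\<forall>t>0. (g has_real_derivative g' t) (at t)" ..
  then show ?case by (intro exI[of _ g] exI[of _ g']) simp
qed

lemma smooth_pos_powr: "smooth_pos (\<lambda>t. t powr a)"
proof (rule smooth_pos_coset[of _ "{\<lambda>t. c * t powr b | c b. True}"])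
  show "(\<lambda>t. t powr a) \<in> {\<lambda>t. c * t powr b |c b. True}"
    by (intro CollectI exI[of _ 1] exI[of _ a]) simp
  fix g assume "g \<in> {\<lambda>t::real. c * t powr b |c b. True}"
  then obtain c b where g: "g = (\<lambda>t. c * t powr b)" by blast
  have "\<forall>t>0. (g has_real_derivative (\<lambda>t. (c * b) * t powr (b - 1)) t) (at t)"
    unfolding g by (auto intro!: derivative_eq_intros)
  then show "\<exists>g'\<in>{\<lambda>t. c * t powr b |c b. True}. \<forall>t>0. (g has_real_derivative g' t) (at t)"
    by (intro bexI[where x = "\<lambda>t. (c * b) * t powr (b - 1)"] CollectI exI[of _ "c * b"] exI[of _ "b - 1"] conjI TrueI refl)
qed

lemma has_derivative_dot_self: "((\<lambda>x::'a::euclidean_space. x \<bullet> x) has_derivative (\<lambda>h. 2 * (x \<bullet> h))) (at x)"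
  by (auto intro!: derivative_eq_intros simp: inner_commute)

lemma has_derivative_radial_sq:
  assumes "(g has_real_derivative g') (at (x \<bullet> x))"
  shows "((\<lambda>x::'a::euclidean_space. g (x \<bullet> x)) has_derivative (\<lambda>h. g' * (2 * (x \<bullet> h)))) (at x)"
  using has_derivative_compose[OF has_derivative_dot_self has_field_derivative_imp_has_derivative[OF assms]]
  by simp

lemma Ck_ann_radial_sq:
  assumes "Ck_ann k R f" "smooth_pos g"
  shows "Ck_ann k R (\<lambda>x. f x * g (x \<bullet> x))"
  using assms
proof (induction k arbitrary: f g)
  case 0
  from \<open>smooth_pos g\<close> obtain g' where g': "\<And>t. t > 0 \<Longrightarrow> (g has_real_derivative g' t) (at t)"
    using smooth_posE by blast
  have "annular R (\<lambda>x. f x * g (x \<bullet> x))" using 0 unfolding Ck_ann_def by (auto elim!: annular_mono)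
  moreover have "isCont (\<lambda>x. f x * g (x \<bullet> x)) x" if "x \<noteq> 0" for x
    using 0 has_derivative_continuous[OF has_derivative_radial_sq[OF g']] that
    by (intro continuous_mult) (auto simp: Ck_ann_def continuous_on_eq_continuous_at)
  ultimately show ?case unfolding Ck_ann_def by (auto intro!: annular_continuous)
next
  case (Suc k)
  from \<open>smooth_pos g\<close> obtain g' where g': "\<And>t. t > 0 \<Longrightarrow> (g has_real_derivative g' t) (at t)" "smooth_pos g'"
    using smooth_posE by blast
  have an: "annular R (\<lambda>x. f x * g (x \<bullet> x))" using Suc unfolding Ck_ann_def by (auto elim!: annular_mono)
  have fd: "f differentiable (at x)" for x using Suc.prems Ck_ann_differentiable by blast
  have gd: "(\<lambda>x. g (x \<bullet> x)) differentiable (at x)" if "x \<noteq> 0" for x::'a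
    using has_derivative_radial_sq[OF g'(1), of x] that unfolding differentiable_def by auto
  have d: "(\<lambda>x. f x * g (x \<bullet> x)) differentiable (at x)" for x
    by (rule annular_differentiable[OF an]) (use fd gd in auto)
  have eq: "partial_deriv i (\<lambda>x. f x * g (x \<bullet> x)) =
     (\<lambda>x. partial_deriv i f x * g (x \<bullet> x) + (2 * (f x * (x \<bullet> i))) * g' (x \<bullet> x))" (is "?l = ?r") for i
  proof
    fix x
    show "?l x = ?r x"
    \<comment> \<open>Nothing is known about \<open>g\<close> and \<open>g'\<close> at 0, but every
      term there carries an annular factor that vanishes.\<close>
    proof (cases "x = 0")
      case True
      then show ?thesis using Suc.prems(1)
        annular_zero[OF _ annular_partial[OF an]] annular_zero[of 0 R f] annular_zero[OF _ annular_partial[of R f]] unfolding Ck_ann_def by auto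
    next
      case False
      then show ?thesis
        using partial_deriv_mult[OF fd gd[OF False], of i]
          partial_deriv_eq[OF has_derivative_radial_sq[OF g'(1), of x], of i]
        by (simp add: algebra_simps)
    qed
  qed
  have "Ck_ann k R f" using Suc.prems Ck_ann_SucD by blast
  then have "Ck_ann k R (partial_deriv i (\<lambda>x. f x * g (x \<bullet> x)))" if "i \<in> Basis" for i
    unfolding eq using Suc.prems(2) g'(2)
    by (intro Ck_ann_add Suc.IH Ck_ann_cmult Ck_ann_Ck_mult Ck_ann_partial Suc.prems that Ck_linear bounded_linear_inner_left) auto
  then show ?case using d an unfolding Ck_ann_def by (auto intro!: Ck_SucI simp del: Ck.simps)
qed

section \<open>Commuting derivatives and integration by parts\<close>

lemma has_real_derivative_line:
  fixes f :: "'a::euclidean_space \<Rightarrow> real"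
  assumes "f differentiable (at (y + s *\<^sub>R v))"
  shows "((\<lambda>s. f (y + s *\<^sub>R v)) has_real_derivative partial_deriv v f (y + s *\<^sub>R v)) (at s)"
proof -
  let ?D = "frechet_derivative f (at (y + s *\<^sub>R v))"
  have "((\<lambda>s. y + s *\<^sub>R v) has_derivative (\<lambda>h. h *\<^sub>R v)) (at s)"
    by (auto intro!: derivative_eq_intros)
  from has_derivative_compose[OF this has_derivative_frechet[OF assms]]
  have d: "((\<lambda>s. f (y + s *\<^sub>R v)) has_derivative (\<lambda>h. ?D (h *\<^sub>R v))) (at s)" .
  have "linear ?D" using assms linear_frechet_derivative by blast
  then have "(\<lambda>h. ?D (h *\<^sub>R v)) = (*) (partial_deriv v f (y + s *\<^sub>R v))"
    by (auto simp: linear_cmul partial_deriv_def)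
  with d show ?thesis by (simp add: has_field_derivative_def)
qed

text \<open>The mean value theorem is used twice: first in direction i on the increment in direction
  j, then in direction j on the partial derivative so obtained. The left-hand side is symmetric in i
  and j while the right-hand side is not; letting h tend to 0 therefore makes the mixed derivatives
  agree.\<close>

lemma mixed_difference:
  fixes f :: "'a::euclidean_space \<Rightarrow> real"
  assumes "Ck 2 f" "i \<in> Basis" "j \<in> Basis" "h > 0"
  shows "\<exists>z. dist z x \<le> 2 * h \<and>
    f (x + h *\<^sub>R i + h *\<^sub>R j) - f (x + h *\<^sub>R i) - f (x + h *\<^sub>R j) + f x = h\<^sup>2 * partial_deriv j (partial_deriv i f) z"
proof -
  from assms have d: "f differentiable (at y)" "partial_deriv i f differentiable (at y)" for y
    by (auto simp: numeral_2_eq_2)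
  have "((\<lambda>s. f ((x + h *\<^sub>R j) + s *\<^sub>R i) - f (x + s *\<^sub>R i)) has_real_derivative
     (partial_deriv i f ((x + h *\<^sub>R j) + s *\<^sub>R i) - partial_deriv i f (x + s *\<^sub>R i))) (at s)" for s
    by (intro DERIV_diff has_real_derivative_line d)
  from MVT2[OF \<open>h > 0\<close> this]
  obtain s where s: "0 < s" "s < h" "f ((x + h *\<^sub>R j) + h *\<^sub>R i) - f (x + h *\<^sub>R i) - (f (x + h *\<^sub>R j) - f x)
     = h * (partial_deriv i f ((x + h *\<^sub>R j) + s *\<^sub>R i) - partial_deriv i f (x + s *\<^sub>R i))"
    by auto
  have "((\<lambda>t. partial_deriv i f ((x + s *\<^sub>R i) + t *\<^sub>R j)) has_real_derivative
     partial_deriv j (partial_deriv i f) ((x + s *\<^sub>R i) + t *\<^sub>R j)) (at t)" for t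
    by (intro has_real_derivative_line d)
  from MVT2[OF \<open>h > 0\<close> this]
  obtain t where t: "0 < t" "t < h" "partial_deriv i f ((x + s *\<^sub>R i) + h *\<^sub>R j) - partial_deriv i f (x + s *\<^sub>R i)
     = h * partial_deriv j (partial_deriv i f) ((x + s *\<^sub>R i) + t *\<^sub>R j)"
    by auto
  have "dist ((x + s *\<^sub>R i) + t *\<^sub>R j) x \<le> norm (s *\<^sub>R i) + norm (t *\<^sub>R j)"
    by (simp add: dist_norm norm_triangle_ineq add.assoc del: norm_scaleR)
  also have "\<dots> \<le> 2 * h" using s t assms by simp
  finally show ?thesis
    using s t by (intro exI[of _ "(x + s *\<^sub>R i) + t *\<^sub>R j"]) (simp add: algebra_simps power2_eq_square)
qed

lemma partial_deriv_commute:
  fixes f :: "'a::euclidean_space \<Rightarrow> real"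
  assumes f: "Ck 2 f" and ij: "i \<in> Basis" "j \<in> Basis"
  shows "partial_deriv i (partial_deriv j f) x = partial_deriv j (partial_deriv i f) x"
proof -
  have ex: "\<exists>z. \<forall>n. dist (z n) x \<le> 2 * inverse (real (Suc n)) \<and>
      f (x + inverse (real (Suc n)) *\<^sub>R i + inverse (real (Suc n)) *\<^sub>R j) - f (x + inverse (real (Suc n)) *\<^sub>R i)
       - f (x + inverse (real (Suc n)) *\<^sub>R j) + f x
       = (inverse (real (Suc n)))\<^sup>2 * partial_deriv j (partial_deriv i f) (z n)"
    if "i \<in> Basis" "j \<in> Basis" for i j
    by (rule choice, rule allI, rule mixed_difference[OF f that]) simp
  from ex[OF ij] obtain z where z: "\<And>n. dist (z n) x \<le> 2 * inverse (real (Suc n))"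
      "\<And>n. f (x + inverse (real (Suc n)) *\<^sub>R i + inverse (real (Suc n)) *\<^sub>R j) - f (x + inverse (real (Suc n)) *\<^sub>R i)
       - f (x + inverse (real (Suc n)) *\<^sub>R j) + f x
       = (inverse (real (Suc n)))\<^sup>2 * partial_deriv j (partial_deriv i f) (z n)" by blast
  from ex[OF ij(2,1)] obtain w where w: "\<And>n. dist (w n) x \<le> 2 * inverse (real (Suc n))"
      "\<And>n. f (x + inverse (real (Suc n)) *\<^sub>R j + inverse (real (Suc n)) *\<^sub>R i) - f (x + inverse (real (Suc n)) *\<^sub>R j)
       - f (x + inverse (real (Suc n)) *\<^sub>R i) + f x
       = (inverse (real (Suc n)))\<^sup>2 * partial_deriv i (partial_deriv j f) (w n)" by blast
  have sw: "x + h *\<^sub>R j + h *\<^sub>R i = x + h *\<^sub>R i + h *\<^sub>R j" for h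
    by (simp add: add_ac)
  have eq: "partial_deriv j (partial_deriv i f) (z n) = partial_deriv i (partial_deriv j f) (w n)" for n
  proof -
    have "(inverse (real (Suc n)))\<^sup>2 * partial_deriv j (partial_deriv i f) (z n)
        = (inverse (real (Suc n)))\<^sup>2 * partial_deriv i (partial_deriv j f) (w n)"
      using z(2)[of n] w(2)[of n, unfolded sw] by linarith
    then show ?thesis by simp
  qed
  have lim0: "(\<lambda>n. 2 * inverse (real (Suc n))) \<longlonglongrightarrow> 0"
    using tendsto_mult_left[OF LIMSEQ_inverse_real_of_nat, of 2] by simp
  have zx: "z \<longlonglongrightarrow> x" "w \<longlonglongrightarrow> x"
    unfolding tendsto_dist_iff[of z] tendsto_dist_iff[of w]
    by (rule tendsto_sandwich[OF _ _ tendsto_const lim0]; use z w in simp)+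
  have c: "isCont (partial_deriv i (partial_deriv j f)) x" "isCont (partial_deriv j (partial_deriv i f)) x"
    using f ij by (auto simp: numeral_2_eq_2 continuous_on_eq_continuous_at)
  show ?thesis
    using LIMSEQ_unique[OF isCont_tendsto_compose[OF c(1) zx(2)]] isCont_tendsto_compose[OF c(2) zx(1)]
    by (simp add: eq)
qed

lemma vderiv_add:
  assumes "f differentiable (at x)" "g differentiable (at x)"
  shows "vderiv A (\<lambda>x. f x + g x) x = vderiv A f x + vderiv A g x"
  using vderiv_eq[OF has_derivative_add[OF assms[THEN has_derivative_frechet]], of A]
  by (simp add: vderiv_def)

lemma vderiv_mult:
  assumes "f differentiable (at x)" "g differentiable (at x)"
  shows "vderiv A (\<lambda>x. f x * g x) x = f x * vderiv A g x + vderiv A f x * g x"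
  using vderiv_eq[OF has_derivative_mult[OF assms[THEN has_derivative_frechet]], of A]
  by (simp add: vderiv_def)

lemma vderiv_cmult:
  assumes "f differentiable (at x)"
  shows "vderiv A (\<lambda>x. c * f x) x = c * vderiv A f x"
  using vderiv_eq[OF has_derivative_mult_right[OF has_derivative_frechet[OF assms]], of A]
  by (simp add: vderiv_def)

lemma vderiv_sum:
  assumes "\<And>i. i \<in> I \<Longrightarrow> f i differentiable (at x)"
  shows "vderiv A (\<lambda>x. \<Sum>i\<in>I. f i x) x = (\<Sum>i\<in>I. vderiv A (f i) x)"
proof -
  have "((\<lambda>x. \<Sum>i\<in>I. f i x) has_derivative (\<lambda>h. \<Sum>i\<in>I. frechet_derivative (f i) (at x) h)) (at x)"
    by (intro has_derivative_sum has_derivative_frechet assms)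
  from vderiv_eq[OF this] show ?thesis by (simp add: vderiv_def)
qed

lemma vderiv_linear: "bounded_linear l \<Longrightarrow> vderiv A l x = l (A x)"
  by (rule vderiv_eq) (rule bounded_linear_imp_has_derivative)

lemma vderiv_inner:
  fixes A B :: "'a::euclidean_space \<Rightarrow> 'a"
  shows "bounded_linear B \<Longrightarrow> vderiv A (\<lambda>x. B x \<bullet> i) x = B (A x) \<bullet> i"
  by (rule vderiv_linear) (rule bounded_linear_compose[OF bounded_linear_inner_left])

lemma vderiv_vderiv:
  assumes f: "Ck 2 f" and AB: "bounded_linear A" "bounded_linear B"
  shows "vderiv A (vderiv B f) x = (\<Sum>i\<in>Basis. B (A x) \<bullet> i * partial_deriv i f x) +
    (\<Sum>i\<in>Basis. \<Sum>j\<in>Basis. (B x \<bullet> i) * (A x \<bullet> j) * partial_deriv j (partial_deriv i f) x)"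
proof -
  from f have d: "f differentiable (at y)" "i \<in> Basis \<Longrightarrow> partial_deriv i f differentiable (at y)" for y i
    by (auto simp: numeral_2_eq_2)
  have l: "bounded_linear (\<lambda>x. B x \<bullet> i)" for i
    by (rule bounded_linear_compose[OF bounded_linear_inner_left AB(2)])
  have ld: "(\<lambda>x. B x \<bullet> i) differentiable (at x)" for i
    using bounded_linear_imp_differentiable[OF l] .
  have "vderiv B f = (\<lambda>x. \<Sum>i\<in>Basis. (B x \<bullet> i) * partial_deriv i f x)"
    by (rule ext, rule vderiv_Basis, rule d)
  then have "vderiv A (vderiv B f) x = (\<Sum>i\<in>Basis. vderiv A (\<lambda>x. (B x \<bullet> i) * partial_deriv i f x) x)"
    using d(2) ld by (auto intro!: vderiv_sum differentiable_mult)
  also have "\<dots> = (\<Sum>i\<in>Basis. (B x \<bullet> i) * vderiv A (partial_deriv i f) x + (B (A x) \<bullet> i) * partial_deriv i f x)"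
    by (intro sum.cong refl, subst vderiv_mult[OF ld d(2)]) (simp_all add: vderiv_inner[OF AB(2)])
  also have "\<dots> = (\<Sum>i\<in>Basis. (B x \<bullet> i) * (\<Sum>j\<in>Basis. (A x \<bullet> j) * partial_deriv j (partial_deriv i f) x)
      + (B (A x) \<bullet> i) * partial_deriv i f x)"
    using d(2) by (intro sum.cong refl) (simp add: vderiv_Basis)
  finally show ?thesis by (simp add: sum.distrib sum_distrib_left mult.assoc)
qed

text \<open>In \<open>vderiv_vderiv\<close> the second-order parts agree by symmetry of the Hessian,
  so the commutator of the two fields is the first-order term with coefficients B (A x) - A (B x).
  This is how the Euler field is seen to commute with rotations.\<close>

lemma vderiv_commute:
  assumes f: "Ck 2 f" and AB: "bounded_linear A" "bounded_linear B" and c: "A (B x) = B (A x)"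
  shows "vderiv A (vderiv B f) x = vderiv B (vderiv A f) x"
proof -
  have "(\<Sum>i\<in>Basis. \<Sum>j\<in>Basis. (B x \<bullet> i) * (A x \<bullet> j) * partial_deriv j (partial_deriv i f) x)
     = (\<Sum>j\<in>Basis. \<Sum>i\<in>Basis. (B x \<bullet> i) * (A x \<bullet> j) * partial_deriv j (partial_deriv i f) x)"
    by (rule sum.swap)
  also have "\<dots> = (\<Sum>j\<in>Basis. \<Sum>i\<in>Basis. (A x \<bullet> j) * (B x \<bullet> i) * partial_deriv i (partial_deriv j f) x)"
    by (intro sum.cong refl) (simp add: partial_deriv_commute[OF f])
  finally show ?thesis unfolding vderiv_vderiv[OF f AB] vderiv_vderiv[OF f AB(2,1)] c by simp
qed

section \<open>Integrals of compactly supported functions\<close>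

lemma outside_cbox:
  fixes x :: "'a::euclidean_space"
  assumes "x \<notin> cbox (- r *\<^sub>R One) (r *\<^sub>R One)" shows "norm x \<ge> r"
proof -
  from assms obtain i where i: "i \<in> Basis" "\<not> (- r \<le> x \<bullet> i \<and> x \<bullet> i \<le> r)"
    by (auto simp: mem_box)
  have "\<bar>x \<bullet> i\<bar> \<le> norm x" using Basis_le_norm[OF i(1)] .
  with i show ?thesis by auto
qed

text \<open>Differentiation under the integral sign will be applied to an integral over a box,
  translation invariance to the Lebesgue integral on the whole space. This identifies the
  two.\<close>

lemma cont_supp_integral:
  fixes f :: "'a::euclidean_space \<Rightarrow> real"
  assumes c: "continuous_on UNIV f" and 0: "\<And>x. x \<notin> cbox a b \<Longrightarrow> f x = 0"
  shows "integrable lborel f" "integral\<^sup>L lborel f = integral (cbox a b) f"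
proof -
  have "integrable lborel (\<lambda>x. indicator (cbox a b) x *\<^sub>R f x)"
    by (rule borel_integrable_compact) (auto intro: continuous_on_subset[OF c])
  moreover have "(\<lambda>x. indicator (cbox a b) x *\<^sub>R f x) = f"
    using 0 by (auto simp: indicator_def fun_eq_iff)
  ultimately show i: "integrable lborel f" by simp
  have "integral UNIV (\<lambda>x. if x \<in> cbox a b then f x else 0) = integral (cbox a b) f"
    by (rule integral_restrict_UNIV)
  moreover have "(\<lambda>x. if x \<in> cbox a b then f x else 0) = f" using 0 by auto
  ultimately show "integral\<^sup>L lborel f = integral (cbox a b) f"
    using integral_lborel[OF i] by simp
qed

lemma lborel_integral_translate:
  fixes f :: "'a::euclidean_space \<Rightarrow> real"
  assumes "f \<in> borel_measurable borel"
  shows "integral\<^sup>L lborel (\<lambda>x. f (c + x)) = integral\<^sup>L lborel f"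
proof -
  have "integral\<^sup>L lborel f = integral\<^sup>L (distr lborel borel ((+) c)) f"
    by (simp add: lborel_distr_plus)
  also have "\<dots> = integral\<^sup>L lborel (\<lambda>x. f (c + x))"
    by (rule integral_distr) (use assms in auto)
  finally show ?thesis by simp
qed

text \<open>The integral of the translate x |-> f (x + t i) does not depend on t, and its derivative
  at t = 0 is the integral of the partial derivative. Iterated integrals are avoided.\<close>

lemma integral_partial_deriv_eq_0:
  fixes f :: "'a::euclidean_space \<Rightarrow> real"
  assumes f: "Ck 1 f" and i: "i \<in> Basis" and supp: "\<And>x. norm x \<ge> R \<Longrightarrow> f x = 0"
  shows "integral\<^sup>L lborel (partial_deriv i f) = 0"
proof -
  \<comment> \<open>The extra unit leaves room for translations with |t| <= 1: the translates still
    vanish outside the box.\<close>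
  let ?B = "cbox (- (R + 1) *\<^sub>R One) ((R + 1) *\<^sub>R One) :: 'a set"
  let ?U = "{-1..1::real}"
  have fc: "continuous_on S f" for S using f Ck_continuous_on by blast
  have pc: "continuous_on S (partial_deriv i f)" for S
    using f i by (auto intro: continuous_on_subset)
  have fd: "f differentiable (at x)" for x using f by simp
  have p0: "partial_deriv i f x = 0" if "x \<notin> ?B" for x
  proof -
    have n: "norm x > R" using outside_cbox[OF that] by simp
    have "open (- cball (0::'a) R)" by (simp add: open_Compl)
    then have "(f has_derivative (\<lambda>h. 0)) (at x)"
      by (rule annular_has_derivative_0) (use n supp in auto)
    then show ?thesis by (rule partial_deriv_eq)
  qed
  have sh: "integral ?B (\<lambda>x. f (x + t *\<^sub>R i)) = integral\<^sup>L lborel f" if "t \<in> ?U" for t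
  proof -
    have "integral\<^sup>L lborel (\<lambda>x. f (x + t *\<^sub>R i)) = integral ?B (\<lambda>x. f (x + t *\<^sub>R i))"
    proof (rule cont_supp_integral)
      show "continuous_on UNIV (\<lambda>x. f (x + t *\<^sub>R i))"
        by (intro continuous_on_compose2[OF fc[of UNIV]] continuous_intros) auto
      show "f (x + t *\<^sub>R i) = 0" if "x \<notin> ?B" for x
      proof (rule supp)
        have "norm x \<ge> R + 1" by (rule outside_cbox[OF that])
        moreover have "norm (t *\<^sub>R i) \<le> 1" using \<open>t \<in> ?U\<close> i by auto
        ultimately show "norm (x + t *\<^sub>R i) \<ge> R" using norm_diff_ineq[of x "t *\<^sub>R i"] by linarith
      qed
    qed
    moreover have "integral\<^sup>L lborel (\<lambda>x. f (t *\<^sub>R i + x)) = integral\<^sup>L lborel f"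
      by (rule lborel_integral_translate) (use fc[of UNIV] borel_measurable_continuous_onI in blast)
    ultimately show ?thesis by (simp add: add.commute)
  qed
  have "((\<lambda>t. integral ?B (\<lambda>x. f (x + t *\<^sub>R i))) has_field_derivative
      integral ?B (\<lambda>x. partial_deriv i f (x + 0 *\<^sub>R i))) (at 0 within ?U)"
  proof (rule leibniz_rule_field_derivative)
    fix t x assume "t \<in> ?U"
    show "((\<lambda>t. f (x + t *\<^sub>R i)) has_field_derivative partial_deriv i f (x + t *\<^sub>R i)) (at t within ?U)"
      using has_real_derivative_line[OF fd] by (rule has_field_derivative_at_within)
  next
    fix t show "(\<lambda>x. f (x + t *\<^sub>R i)) integrable_on ?B"
      by (intro integrable_continuous continuous_on_compose2[OF fc[of UNIV]] continuous_intros) auto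
  next
    show "continuous_on (?U \<times> ?B) (\<lambda>(t, x). partial_deriv i f (x + t *\<^sub>R i))"
      unfolding split_beta
      by (intro continuous_on_compose2[OF pc[of UNIV]] continuous_intros) auto
  qed auto
  then have "((\<lambda>t. integral\<^sup>L lborel f) has_field_derivative
      integral ?B (\<lambda>x. partial_deriv i f (x + 0 *\<^sub>R i))) (at 0 within ?U)"
    by (rule has_field_derivative_transform_within[where d = 1]) (use sh in auto)
  moreover have "at 0 within ?U = at (0::real)" by (rule at_within_interior) simp
  ultimately have "integral ?B (partial_deriv i f) = 0"
    using DERIV_unique[OF _ DERIV_const] by (simp add: eta_contract_eq)
  then show ?thesis using cont_supp_integral(2)[OF pc p0] by simp
qed

section \<open>The Euler field and the rotations\<close>

text \<open>In the coordinates \<open>s = ln |x|\<close>, \<open>\<omega> = x / |x|\<close> the measure \<open>|x|\<^sup>-\<^sup>n dx\<close> is \<open>ds d\<omega>\<close>, the operator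
  \<open>euler\<close> is \<open>\<partial>\<^sub>s\<close>, and \<open>sphere_lap\<close> is the Laplacian of the sphere.\<close>

definition cyl_int :: "('a::euclidean_space \<Rightarrow> real) \<Rightarrow> real" where
  "cyl_int f = (\<integral>x. f x * (x \<bullet> x) powr (- real DIM('a) / 2) \<partial>lborel)"

definition euler :: "('a::euclidean_space \<Rightarrow> real) \<Rightarrow> 'a \<Rightarrow> real" where
  "euler = vderiv (\<lambda>x. x)"

definition rot :: "'a \<Rightarrow> 'a \<Rightarrow> 'a::euclidean_space \<Rightarrow> 'a" where
  "rot i j x = (x \<bullet> i) *\<^sub>R j - (x \<bullet> j) *\<^sub>R i"

definition sphere_lap :: "('a::euclidean_space \<Rightarrow> real) \<Rightarrow> 'a \<Rightarrow> real" where
  "sphere_lap f x = 1 / 2 * (\<Sum>i\<in>Basis. \<Sum>j\<in>Basis. vderiv (rot i j) (vderiv (rot i j) f) x)"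

text \<open>Linear vector fields that are divergence free for the measure \<open>|x|\<^sup>-\<^sup>n dx\<close>.\<close>

definition divfree :: "('a::euclidean_space \<Rightarrow> 'a) \<Rightarrow> bool" where
  "divfree A \<longleftrightarrow> bounded_linear A \<and> (\<forall>x. real DIM('a) * (A x \<bullet> x) = (\<Sum>i\<in>Basis. A i \<bullet> i) * (x \<bullet> x))"

lemma euler_add: "f differentiable (at x) \<Longrightarrow> g differentiable (at x) \<Longrightarrow>
    euler (\<lambda>x. f x + g x) x = euler f x + euler g x"
  unfolding euler_def by (rule vderiv_add)

lemma euler_cmult: "f differentiable (at x) \<Longrightarrow> euler (\<lambda>x. c * f x) x = c * euler f x"
  unfolding euler_def by (rule vderiv_cmult)

lemma divfree_bounded_linear: "divfree A \<Longrightarrow> bounded_linear A"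
  by (simp add: divfree_def)

lemma bounded_linear_rot: "bounded_linear (rot i j)"
  unfolding rot_def[abs_def]
  by (intro bounded_linear_sub bounded_linear_scaleR_left[THEN bounded_linear_compose] bounded_linear_inner_left)

lemma rot_inner: "rot i j x \<bullet> x = 0"
  by (simp add: rot_def inner_diff_left inner_commute[of j x] inner_commute[of i x])

lemma divfree_rot: "divfree (rot i j)"
  by (simp add: divfree_def bounded_linear_rot rot_inner)

lemma divfree_id: "divfree (\<lambda>x. x)"
  by (simp add: divfree_def)

lemma Ck_ann_outside: "Ck_ann k R f \<Longrightarrow> norm x \<ge> R \<Longrightarrow> f x = 0"
  using annular_zero unfolding Ck_ann_def by blast

lemma Ck_ann_0_integrable:
  fixes f :: "'a::euclidean_space \<Rightarrow> real"
  assumes "Ck_ann 0 R f"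
  shows "integrable lborel (\<lambda>x. f x * (x \<bullet> x) powr p)"
proof -
  have "Ck_ann 0 R (\<lambda>x. f x * (x \<bullet> x) powr p)"
    by (rule Ck_ann_radial_sq[OF assms smooth_pos_powr])
  then have "continuous_on UNIV (\<lambda>x. f x * (x \<bullet> x) powr p)" "annular R (\<lambda>x. f x * (x \<bullet> x) powr p)"
    by (auto simp: Ck_ann_def)
  then show ?thesis
    using outside_cbox[of _ R] annular_zero
    by (intro cont_supp_integral(1)[of _ "- R *\<^sub>R One" "R *\<^sub>R One"]) blast+
qed

lemma cyl_int_add: "Ck_ann 0 R f \<Longrightarrow> Ck_ann 0 R g \<Longrightarrow> cyl_int (\<lambda>x. f x + g x) = cyl_int f + cyl_int g"
  unfolding cyl_int_def by (subst Bochner_Integration.integral_add[symmetric]) (auto intro: Ck_ann_0_integrable simp: algebra_simps)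

lemma cyl_int_diff: "Ck_ann 0 R f \<Longrightarrow> Ck_ann 0 R g \<Longrightarrow> cyl_int (\<lambda>x. f x - g x) = cyl_int f - cyl_int g"
  unfolding cyl_int_def by (subst Bochner_Integration.integral_diff[symmetric]) (auto intro: Ck_ann_0_integrable simp: algebra_simps)

lemma cyl_int_cmult: "cyl_int (\<lambda>x. c * f x) = c * cyl_int f"
  unfolding cyl_int_def by (simp add: mult.assoc)

lemma cyl_int_sum: "(\<And>i. i \<in> I \<Longrightarrow> Ck_ann 0 R (f i)) \<Longrightarrow> cyl_int (\<lambda>x. \<Sum>i\<in>I. f i x) = (\<Sum>i\<in>I. cyl_int (f i))"
  unfolding cyl_int_def sum_distrib_right
  by (rule Bochner_Integration.integral_sum) (auto intro: Ck_ann_0_integrable)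

lemma cyl_int_nonneg: "(\<And>x. f x \<ge> 0) \<Longrightarrow> cyl_int f \<ge> 0"
  unfolding cyl_int_def by (rule Bochner_Integration.integral_nonneg) simp

lemma vderiv_radial_sq:
  assumes "(g has_real_derivative g') (at (x \<bullet> x))"
  shows "vderiv A (\<lambda>x. g (x \<bullet> x)) x = 2 * g' * (x \<bullet> A x)"
  using vderiv_eq[OF has_derivative_radial_sq[OF assms], of A] by simp

lemma vderiv_zero_origin: "Ck_ann (Suc k) R f \<Longrightarrow> vderiv A f 0 = 0"
  using annular_vderiv annular_zero unfolding Ck_ann_def by blast

text \<open>With the density rho = |x|^(-n) the field rho A is divergence free by the trace
  condition in \<open>divfree\<close>. Hence rho times the derivative of f along A is the divergence
  of the compactly supported field f rho A, and each of its components integrates to 0.\<close>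

lemma cyl_int_vderiv:
  fixes f :: "'a::euclidean_space \<Rightarrow> real"
  assumes f: "Ck_ann 1 R f" and A: "divfree A"
  shows "cyl_int (vderiv A f) = 0"
proof -
  let ?n = "real DIM('a)"
  define \<rho> where "\<rho> = (\<lambda>x::'a. (x \<bullet> x) powr (- ?n / 2))"
  define g where "g = (\<lambda>x. f x * \<rho> x)"
  have Al: "bounded_linear A" using A divfree_bounded_linear by blast
  have g: "Ck_ann 1 R g" unfolding g_def \<rho>_def by (rule Ck_ann_radial_sq[OF f smooth_pos_powr])
  have gd: "g differentiable (at x)" and fd: "f differentiable (at x)" for x
    using Ck_ann_differentiable g f by (metis One_nat_def)+
  have ld: "(\<lambda>x. A x \<bullet> i) differentiable (at x)" for i x
    by (intro bounded_linear_imp_differentiable bounded_linear_compose[OF bounded_linear_inner_left Al])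
  have V: "Ck_ann 1 R (\<lambda>x. g x * (A x \<bullet> i))" for i
    by (rule Ck_ann_Ck_mult[OF g Ck_inner_linear[OF Al]])
  have pi: "integrable lborel (partial_deriv i (\<lambda>x. g x * (A x \<bullet> i)))" if "i \<in> Basis" for i
  proof -
    have "Ck_ann 0 R (partial_deriv i (\<lambda>x. g x * (A x \<bullet> i)))"
      using that V by (intro Ck_ann_partial) auto
    then show ?thesis using outside_cbox[of _ R] annular_zero
      by (intro cont_supp_integral(1)[of _ "- R *\<^sub>R One" "R *\<^sub>R One"]) (auto simp: Ck_ann_def)
  qed
  have p0: "integral\<^sup>L lborel (partial_deriv i (\<lambda>x. g x * (A x \<bullet> i))) = 0" if "i \<in> Basis" for i
    using V that Ck_ann_outside[OF V] by (intro integral_partial_deriv_eq_0[where R = R]) (auto simp: Ck_ann_def simp del: mult_eq_0_iff)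
  have "(\<Sum>i\<in>Basis. partial_deriv i (\<lambda>x. g x * (A x \<bullet> i)) x) = vderiv A f x * \<rho> x" for x
  proof (cases "x = 0")
    case True
    have "annular R (\<lambda>x. g x * (A x \<bullet> i))" for i using V[of i] by (simp add: Ck_ann_def)
    then have "partial_deriv i (\<lambda>x. g x * (A x \<bullet> i)) 0 = 0" for i
      using annular_zero[OF _ annular_partial] by blast
    then show ?thesis using True vderiv_zero_origin[of 0 R f A] f by simp
  next
    case False
    then have x: "x \<bullet> x > 0" by simp
    have tr: "?n * (A x \<bullet> x) = (\<Sum>i\<in>Basis. A i \<bullet> i) * (x \<bullet> x)" using A by (simp add: divfree_def)
    have d: "((\<lambda>t. t powr (- ?n / 2)) has_real_derivative (- ?n / 2) * (x \<bullet> x) powr (- ?n / 2 - 1)) (at (x \<bullet> x))"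
      using x by (auto intro!: derivative_eq_intros)
    have \<rho>d: "\<rho> differentiable (at x)"
      unfolding \<rho>_def using has_derivative_radial_sq[OF d] differentiable_def by blast
    have "vderiv A \<rho> x = - ?n * (x \<bullet> x) powr (- ?n / 2 - 1) * (x \<bullet> A x)"
      unfolding \<rho>_def vderiv_radial_sq[OF d] by simp
    also have "\<dots> = - (?n * (A x \<bullet> x) / (x \<bullet> x)) * \<rho> x"
      using x by (simp add: \<rho>_def powr_diff inner_commute)
    also have "\<dots> = - (\<Sum>i\<in>Basis. A i \<bullet> i) * \<rho> x"
      unfolding tr using x by simp
    finally have \<rho>': "vderiv A \<rho> x = - (\<Sum>i\<in>Basis. A i \<bullet> i) * \<rho> x" .
    have "partial_deriv i (\<lambda>x. A x \<bullet> i) x = A i \<bullet> i" for i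
      by (rule partial_deriv_eq)
        (intro bounded_linear_imp_has_derivative bounded_linear_compose[OF bounded_linear_inner_left Al])
    then have "(\<Sum>i\<in>Basis. partial_deriv i (\<lambda>x. g x * (A x \<bullet> i)) x)
        = (\<Sum>i\<in>Basis. g x * (A i \<bullet> i) + partial_deriv i g x * (A x \<bullet> i))"
      by (simp add: partial_deriv_mult[OF gd ld])
    also have "\<dots> = g x * (\<Sum>i\<in>Basis. A i \<bullet> i) + vderiv A g x"
      by (simp add: sum.distrib sum_distrib_left vderiv_Basis[OF gd] mult.commute)
    also have "vderiv A g x = f x * vderiv A \<rho> x + vderiv A f x * \<rho> x"
      unfolding g_def by (rule vderiv_mult[OF fd \<rho>d])
    finally show ?thesis by (simp add: \<rho>' g_def)
  qed
  then have "cyl_int (vderiv A f) = (\<integral>x. (\<Sum>i\<in>Basis. partial_deriv i (\<lambda>x. g x * (A x \<bullet> i)) x) \<partial>lborel)"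
    by (simp add: cyl_int_def \<rho>_def)
  also have "\<dots> = (\<Sum>i\<in>Basis. integral\<^sup>L lborel (partial_deriv i (\<lambda>x. g x * (A x \<bullet> i))))"
    by (rule Bochner_Integration.integral_sum) (use pi in auto)
  finally show ?thesis using p0 by simp
qed

lemma cyl_int_parts:
  assumes f: "Ck_ann 1 R f" and g: "Ck_ann 1 R g" and A: "divfree A"
  shows "cyl_int (\<lambda>x. vderiv A f x * g x) = - cyl_int (\<lambda>x. f x * vderiv A g x)"
proof -
  have fg: "Ck_ann 1 R (\<lambda>x. f x * g x)" by (rule Ck_ann_mult[OF f g])
  have d: "f differentiable (at x)" "g differentiable (at x)" for x
    using Ck_ann_differentiable f g by (metis One_nat_def)+
  have V: "Ck_ann 0 R (\<lambda>x. f x * vderiv A g x)" "Ck_ann 0 R (\<lambda>x. vderiv A f x * g x)"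
    using f g divfree_bounded_linear[OF A] by (auto intro!: Ck_ann_mult Ck_ann_vderiv dest: Ck_ann_SucD)
  have "vderiv A (\<lambda>x. f x * g x) = (\<lambda>x. f x * vderiv A g x + vderiv A f x * g x)"
    by (rule ext, rule vderiv_mult[OF d])
  with cyl_int_vderiv[OF fg A] cyl_int_add[OF V] show ?thesis by simp
qed

section \<open>Smooth annular functions and integration by parts\<close>

definition smooth_ann :: "real \<Rightarrow> ('a::euclidean_space \<Rightarrow> real) \<Rightarrow> bool" where
  "smooth_ann R f \<longleftrightarrow> (\<forall>k. Ck_ann k R f)"

lemma smooth_annD: "smooth_ann R f \<Longrightarrow> Ck_ann k R f"
  by (simp add: smooth_ann_def)

lemma smooth_ann_differentiable: "smooth_ann R f \<Longrightarrow> f differentiable (at x)"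
  using smooth_annD Ck_ann_differentiable by blast

lemma smooth_ann_add: "smooth_ann R f \<Longrightarrow> smooth_ann R g \<Longrightarrow> smooth_ann R (\<lambda>x. f x + g x)"
  and smooth_ann_diff: "smooth_ann R f \<Longrightarrow> smooth_ann R g \<Longrightarrow> smooth_ann R (\<lambda>x. f x - g x)"
  and smooth_ann_mult: "smooth_ann R f \<Longrightarrow> smooth_ann R g \<Longrightarrow> smooth_ann R (\<lambda>x. f x * g x)"
  and smooth_ann_cmult: "smooth_ann R f \<Longrightarrow> smooth_ann R (\<lambda>x. c * f x)"
  and smooth_ann_power: "smooth_ann R f \<Longrightarrow> smooth_ann R (\<lambda>x. (f x)\<^sup>2)"
  unfolding smooth_ann_def by (auto intro: Ck_ann_add Ck_ann_diff Ck_ann_mult Ck_ann_cmult Ck_ann_power)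

lemma smooth_ann_sum: "(\<And>i. i \<in> I \<Longrightarrow> smooth_ann R (f i)) \<Longrightarrow> smooth_ann R (\<lambda>x. \<Sum>i\<in>I. f i x)"
  unfolding smooth_ann_def by (auto intro: Ck_ann_sum)

lemma smooth_ann_vderiv: "bounded_linear A \<Longrightarrow> smooth_ann R f \<Longrightarrow> smooth_ann R (vderiv A f)"
  unfolding smooth_ann_def using Ck_ann_vderiv by blast

lemma smooth_ann_euler: "smooth_ann R f \<Longrightarrow> smooth_ann R (euler f)"
  unfolding euler_def by (rule smooth_ann_vderiv[OF bounded_linear_ident])

lemma smooth_ann_rot: "smooth_ann R f \<Longrightarrow> smooth_ann R (vderiv (rot i j) f)"
  by (rule smooth_ann_vderiv[OF bounded_linear_rot])

lemma smooth_ann_sphere_lap: "smooth_ann R f \<Longrightarrow> smooth_ann R (sphere_lap f)"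
  unfolding sphere_lap_def[abs_def] by (intro smooth_ann_cmult smooth_ann_sum smooth_ann_rot)

lemmas smooth_ann_intros = smooth_ann_add smooth_ann_diff smooth_ann_mult smooth_ann_cmult smooth_ann_power smooth_ann_sum smooth_ann_euler smooth_ann_rot smooth_ann_sphere_lap

lemma cyl_int_euler: "smooth_ann R f \<Longrightarrow> cyl_int (euler f) = 0"
  unfolding euler_def by (rule cyl_int_vderiv[OF smooth_annD divfree_id])

lemma euler_rot: "smooth_ann R f \<Longrightarrow> euler (vderiv (rot i j) f) = vderiv (rot i j) (euler f)"
  unfolding euler_def
  by (rule ext, rule vderiv_commute) (auto simp: smooth_ann_def Ck_ann_def bounded_linear_rot)

lemma euler_square: "smooth_ann R f \<Longrightarrow> euler (\<lambda>x. (f x)\<^sup>2) = (\<lambda>x. 2 * (f x * euler f x))"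
  unfolding euler_def power2_eq_square
  by (rule ext, subst vderiv_mult) (auto intro: smooth_ann_differentiable)

lemma cyl_int_mult_euler: assumes "smooth_ann R f" shows "cyl_int (\<lambda>x. f x * euler f x) = 0"
  using cyl_int_euler[OF smooth_ann_power[OF assms]] unfolding euler_square[OF assms] cyl_int_cmult by simp

lemma cyl_int_parts_euler: "smooth_ann R f \<Longrightarrow> smooth_ann R g \<Longrightarrow> cyl_int (\<lambda>x. euler f x * g x) = - cyl_int (\<lambda>x. f x * euler g x)"
  unfolding euler_def by (rule cyl_int_parts) (auto intro: smooth_annD divfree_id)

lemma cyl_int_parts_rot: "smooth_ann R f \<Longrightarrow> smooth_ann R g \<Longrightarrow>
   cyl_int (\<lambda>x. f x * vderiv (rot i j) g x) = - cyl_int (\<lambda>x. vderiv (rot i j) f x * g x)"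
  using cyl_int_parts[OF smooth_annD[of R f] smooth_annD[of R g] divfree_rot[of i j]] by simp

lemma cyl_int_mult_sphere_lap:
  assumes "smooth_ann R u" "smooth_ann R w"
  shows "cyl_int (\<lambda>x. u x * sphere_lap w x) =
    1 / 2 * (\<Sum>i\<in>Basis. \<Sum>j\<in>Basis. cyl_int (\<lambda>x. u x * vderiv (rot i j) (vderiv (rot i j) w) x))"
proof -
  let ?h = "\<lambda>i j x. u x * vderiv (rot i j) (vderiv (rot i j) w) x"
  have "cyl_int (\<lambda>x. u x * sphere_lap w x) = cyl_int (\<lambda>x. 1 / 2 * (\<Sum>i\<in>Basis. \<Sum>j\<in>Basis. ?h i j x))"
    by (simp add: sphere_lap_def sum_distrib_left mult_ac)
  also have "\<dots> = 1 / 2 * cyl_int (\<lambda>x. \<Sum>i\<in>Basis. \<Sum>j\<in>Basis. ?h i j x)"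
    by (rule cyl_int_cmult)
  also have "cyl_int (\<lambda>x. \<Sum>i\<in>Basis. \<Sum>j\<in>Basis. ?h i j x) = (\<Sum>i\<in>Basis. cyl_int (\<lambda>x. \<Sum>j\<in>Basis. ?h i j x))"
    by (rule cyl_int_sum[where R = R], rule smooth_annD) (intro smooth_ann_intros assms)
  also have "\<dots> = (\<Sum>i\<in>Basis. \<Sum>j\<in>Basis. cyl_int (?h i j))"
    by (intro sum.cong refl cyl_int_sum[where R = R], rule smooth_annD) (intro smooth_ann_intros assms)
  finally show ?thesis .
qed

text \<open>Moving one rotation to the other factor and commuting it with \<open>euler\<close> turns
  each term into - z euler z with z the rotated w, which is a total derivative up to a constant
  factor.\<close>

lemma cyl_int_euler_sphere_lap: assumes w: "smooth_ann R w" shows "cyl_int (\<lambda>x. euler w x * sphere_lap w x) = 0"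
proof -
  have *: "cyl_int (\<lambda>x. euler w x * vderiv (rot i j) (vderiv (rot i j) w) x) = 0" for i j :: 'a
    using cyl_int_parts_rot[of R "euler w" "vderiv (rot i j) w" i j] cyl_int_mult_euler[of R "vderiv (rot i j) w"] w
    by (simp add: smooth_ann_intros euler_rot[OF w] mult.commute)
  show ?thesis unfolding cyl_int_mult_sphere_lap[OF smooth_ann_euler[OF w] w] by (simp add: *)
qed

text \<open>Here one rotation and one Euler derivative change sides. The two signs cancel and
  squares of mixed derivatives remain. This is the only quantity discarded when the square of
  \<open>cyl_op\<close> is expanded.\<close>

lemma cyl_int_euler_euler_sphere_lap: assumes w: "smooth_ann R w" shows "cyl_int (\<lambda>x. euler (euler w) x * sphere_lap w x) \<ge> 0"
proof -
  have *: "cyl_int (\<lambda>x. euler (euler w) x * vderiv (rot i j) (vderiv (rot i j) w) x) \<ge> 0" for i j :: 'a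
  proof -
    let ?z = "vderiv (rot i j) w"
    have "cyl_int (\<lambda>x. euler (euler w) x * vderiv (rot i j) ?z x) = - cyl_int (\<lambda>x. vderiv (rot i j) (euler (euler w)) x * ?z x)"
      by (rule cyl_int_parts_rot[where R = R]) (intro smooth_ann_intros w)+
    also have "\<dots> = - cyl_int (\<lambda>x. euler (euler ?z) x * ?z x)"
      by (simp add: euler_rot[OF w] euler_rot[OF smooth_ann_euler[OF w]])
    also have "\<dots> = cyl_int (\<lambda>x. euler ?z x * euler ?z x)"
      by (subst cyl_int_parts_euler[of R]) (auto intro!: smooth_ann_intros w)
    also have "\<dots> \<ge> 0" by (rule cyl_int_nonneg) simp
    finally show ?thesis .
  qed
  show ?thesis unfolding cyl_int_mult_sphere_lap[OF smooth_ann_euler[OF smooth_ann_euler[OF w]] w] by (simp add: * sum_nonneg)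
qed

section \<open>Weighted one-dimensional inequalities\<close>

lemma DERIV_Ioo_continuous_on:
  fixes G :: "real \<Rightarrow> real"
  assumes "\<And>r. a < r \<Longrightarrow> r < b \<Longrightarrow> (G has_real_derivative G' r) (at r)"
  shows "continuous_on {a<..<b} G"
  using DERIV_isCont[OF assms] by (intro continuous_at_imp_continuous_on) auto

lemma has_derivative_radial:
  fixes x :: "'a::euclidean_space"
  assumes "(G has_real_derivative G') (at (norm x))" "x \<noteq> 0"
  shows "((\<lambda>x. G (norm x)) has_derivative (\<lambda>h. G' * ((x \<bullet> h) / norm x))) (at x)"
proof -
  have "(norm has_derivative (\<lambda>h. (x \<bullet> h) / norm x)) (at x)"
    using has_derivative_norm[OF assms(2)]
    by (simp add: sgn_div_norm inner_commute divide_inverse mult.commute)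
  from has_derivative_compose[OF this has_field_derivative_imp_has_derivative[OF assms(1)]]
  show ?thesis .
qed

lemma C0_ann_radial:
  assumes f: "Ck_ann 0 R f" and G: "continuous_on {0<..<R} G"
  shows "Ck_ann 0 R (\<lambda>x. f x * G (norm x))"
proof -
  have an: "annular R (\<lambda>x. f x * G (norm x))" using f unfolding Ck_ann_def by (auto elim!: annular_mono)
  have "isCont (\<lambda>x. f x * G (norm x)) x" if "x \<noteq> 0" "norm x < R" for x
  proof -
    have "isCont G (norm x)" using G that by (auto simp: continuous_on_eq_continuous_at)
    moreover have "isCont f x" using f by (simp add: Ck_ann_def continuous_on_eq_continuous_at)
    ultimately show ?thesis by (intro continuous_mult isCont_o2[of x norm G]) auto
  qed
  then show ?thesis using an unfolding Ck_ann_def by (auto intro!: annular_continuous)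
qed

text \<open>The counterpart of \<open>Ck_ann_radial_sq\<close> for radial factors of limited
  smoothness that exist only on (0,R), such as W itself and the logarithmic derivative of a Bessel
  solution. One derivative suffices, since these products are only ever integrated as total Euler
  derivatives.\<close>

lemma C1_ann_radial:
  fixes f :: "'a::euclidean_space \<Rightarrow> real"
  assumes f: "Ck_ann 1 R f" and G: "\<And>r. 0 < r \<Longrightarrow> r < R \<Longrightarrow> (G has_real_derivative G' r) (at r)"
    and G': "continuous_on {0<..<R} G'"
  shows "Ck_ann 1 R (\<lambda>x. f x * G (norm x))"
    and "euler (\<lambda>x. f x * G (norm x)) x = euler f x * G (norm x) + f x * (norm x * G' (norm x))"
proof -
  have an: "annular R (\<lambda>x. f x * G (norm x))" using f unfolding Ck_ann_def by (auto elim!: annular_mono)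
  have fd: "f differentiable (at x)" for x using Ck_ann_differentiable f by (metis One_nat_def)
  have Gd: "((\<lambda>x. G (norm x)) has_derivative (\<lambda>h. G' (norm x) * ((x \<bullet> h) / norm x))) (at x)"
    if "x \<noteq> 0" "norm x < R" for x :: 'a
    by (rule has_derivative_radial) (use that G in auto)
  then have Gd': "(\<lambda>x. G (norm x)) differentiable (at x)" if "x \<noteq> 0" "norm x < R" for x :: 'a
    using that differentiable_def by blast
  have pd: "partial_deriv i (\<lambda>x. f x * G (norm x)) x =
      partial_deriv i f x * G (norm x) + f x * (G' (norm x) * ((x \<bullet> i) / norm x))"
    if "x \<noteq> 0" "norm x < R" for x i
    using partial_deriv_mult[OF fd Gd'[OF that], of i] partial_deriv_eq[OF Gd[OF that], of i] by simp
  show "Ck_ann 1 R (\<lambda>x. f x * G (norm x))"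
    unfolding Ck_ann_def One_nat_def
  proof (intro conjI an Ck_SucI)
    show "(\<lambda>x. f x * G (norm x)) differentiable (at x)" for x
      by (rule annular_differentiable[OF an]) (use fd Gd' in auto)
    fix i :: 'a assume i: "i \<in> Basis"
    let ?S = "ball 0 R - {0::'a}"
    have op: "open ?S" by (simp add: open_Diff)
    have Gc: "continuous_on {0<..<R} G"
      using DERIV_Ioo_continuous_on[OF G] .
    have fc: "continuous_on ?S f" "continuous_on ?S (partial_deriv i f)"
      using f i by (auto simp: Ck_ann_def intro: continuous_on_subset Ck_continuous_on[of 1])
    have "continuous_on ?S (\<lambda>x. partial_deriv i f x * G (norm x) + f x * (G' (norm x) * ((x \<bullet> i) / norm x)))"
      by (intro continuous_intros fc continuous_on_compose2[OF Gc] continuous_on_compose2[OF G']) auto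
    then have "continuous_on ?S (partial_deriv i (\<lambda>x. f x * G (norm x)))"
      by (subst continuous_on_cong[OF refl pd]) auto
    then have "isCont (partial_deriv i (\<lambda>x. f x * G (norm x))) x" if "x \<in> ?S" for x
      using op that continuous_on_eq_continuous_at by blast
    then show "Ck 0 (partial_deriv i (\<lambda>x. f x * G (norm x)))"
      using annular_continuous[OF annular_partial[OF an]] by auto
  qed
  show "euler (\<lambda>x. f x * G (norm x)) x = euler f x * G (norm x) + f x * (norm x * G' (norm x))"
  proof (cases "x \<noteq> 0 \<and> norm x < R")
    case True
    then show ?thesis unfolding euler_def
      using vderiv_mult[OF fd Gd', of x "\<lambda>x. x"] vderiv_eq[OF Gd, of x "\<lambda>x. x"]
      by (simp add: dot_square_norm power2_eq_square)
  next
    case False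
    then have x: "x = 0 \<or> norm x \<ge> R" by auto
    have af: "annular R f" using f by (simp add: Ck_ann_def)
    show ?thesis unfolding euler_def
      by (simp add: annular_zero[OF x af] annular_zero[OF x annular_vderiv[OF af]] annular_zero[OF x annular_vderiv[OF an]])
  qed
qed

text \<open>The Riccati substitution \<open>g = r y' / y\<close> turns the equation for \<open>y\<close> into
  \<open>r g' = - c r\<^sup>2 W - g\<^sup>2\<close>; then expand \<open>(euler w - g w)\<^sup>2 \<ge> 0\<close>.\<close>

lemma cyl_int_bessel:
  assumes w: "smooth_ann R w" and sol: "bessel_positive_solution W R c" and W: "continuous_on {0<..<R} W"
  shows "c * cyl_int (\<lambda>x. (w x)\<^sup>2 * ((norm x)\<^sup>2 * W (norm x))) \<le> cyl_int (\<lambda>x. (euler w x)\<^sup>2)"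
proof -
  from sol obtain y y' y'' where all: "\<forall>r\<in>{0<..<R}. y r > 0 \<and> (y has_real_derivative y' r) (at r) \<and>
        (y' has_real_derivative y'' r) (at r) \<and> y'' r + 1 / r * y' r + c * W r * y r = 0"
    unfolding bessel_positive_solution_def by (elim exE)
  then have y: "y r > 0" and y': "(y has_real_derivative y' r) (at r)"
    and y'': "(y' has_real_derivative y'' r) (at r)" and eq: "y'' r + 1 / r * y' r + c * W r * y r = 0"
    if "0 < r" "r < R" for r
    using that by simp_all
  define g where "g = (\<lambda>r. r * y' r / y r)"
  define g' where "g' = (\<lambda>r. - (c * (r * W r)) - r * (y' r / y r)\<^sup>2)"
  have gd: "(g has_real_derivative g' r) (at r)" if "0 < r" "r < R" for r
  proof -
    have e: "y'' r = - (1 / r * y' r + c * W r * y r)" using eq[OF that] by simp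
    have "(g has_real_derivative ((y' r + r * y'' r) * y r - r * y' r * y' r) / (y r * y r)) (at r)"
      unfolding g_def using y[OF that] by (auto intro!: derivative_eq_intros y'[OF that] y''[OF that])
    also have "((y' r + r * y'' r) * y r - r * y' r * y' r) / (y r * y r) = g' r"
      unfolding e g'_def using y[OF that] that by (simp add: field_simps power2_eq_square)
    finally show ?thesis .
  qed
  have yc: "continuous_on {0<..<R} y" "continuous_on {0<..<R} y'"
    by (rule DERIV_Ioo_continuous_on[OF y'] DERIV_Ioo_continuous_on[OF y''], assumption+)+
  have g'c: "continuous_on {0<..<R} g'"
    unfolding g'_def using y by (intro continuous_intros W yc) force
  have g2c: "continuous_on {0<..<R} (\<lambda>r. (g r)\<^sup>2)" and gc: "continuous_on {0<..<R} g"
    using DERIV_Ioo_continuous_on[OF gd] by (auto intro!: continuous_intros)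
  have V: "Ck_ann 1 R (\<lambda>x. (w x)\<^sup>2 * g (norm x))"
    by (rule C1_ann_radial(1)[OF smooth_annD[OF smooth_ann_power[OF w]] gd g'c])
  have rg: "(norm x * g' (norm x)) = - c * ((norm x)\<^sup>2 * W (norm x)) - (g (norm x))\<^sup>2" for x :: 'a
    unfolding g_def g'_def by (simp add: algebra_simps power2_eq_square)
  have e: "euler (\<lambda>x. (w x)\<^sup>2 * g (norm x)) x = 2 * (w x * euler w x) * g (norm x)
      - c * ((w x)\<^sup>2 * ((norm x)\<^sup>2 * W (norm x))) - (w x)\<^sup>2 * (g (norm x))\<^sup>2" for x
    by (subst C1_ann_radial(2)[OF smooth_annD[OF smooth_ann_power[OF w]] gd g'c])
      (auto simp: rg euler_square[OF w] algebra_simps)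
  have VP: "Ck_ann 0 R (\<lambda>x. c * ((w x)\<^sup>2 * ((norm x)\<^sup>2 * W (norm x))))"
    by (intro Ck_ann_cmult C0_ann_radial[where G = "\<lambda>r. r\<^sup>2 * W r"] smooth_annD smooth_ann_power w continuous_intros W)
  have Ve: "Ck_ann 0 R (\<lambda>x. (euler w x)\<^sup>2)" by (intro smooth_annD smooth_ann_power smooth_ann_euler w)
  have V0: "Ck_ann 0 R (euler (\<lambda>x. (w x)\<^sup>2 * g (norm x)))"
    unfolding euler_def using V by (intro Ck_ann_vderiv bounded_linear_ident) simp
  have "0 \<le> cyl_int (\<lambda>x. (euler w x - w x * g (norm x))\<^sup>2)" by (rule cyl_int_nonneg) simp
  also have "(\<lambda>x. (euler w x - w x * g (norm x))\<^sup>2) = (\<lambda>x. (euler w x)\<^sup>2 - c * ((w x)\<^sup>2 * ((norm x)\<^sup>2 * W (norm x)))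
      - euler (\<lambda>x. (w x)\<^sup>2 * g (norm x)) x)"
    unfolding e by (simp add: fun_eq_iff power2_eq_square algebra_simps)
  also have "cyl_int \<dots> = cyl_int (\<lambda>x. (euler w x)\<^sup>2) - c * cyl_int (\<lambda>x. (w x)\<^sup>2 * ((norm x)\<^sup>2 * W (norm x)))"
    unfolding cyl_int_diff[OF Ck_ann_diff[OF Ve VP] V0] cyl_int_diff[OF Ve VP] cyl_int_cmult
    using cyl_int_vderiv[OF V divfree_id] by (simp add: euler_def)
  finally show ?thesis by simp
qed

text \<open>Adding the divergence \<open>euler (\<kappa> P w\<^sup>2)\<close> with \<open>P = r\<^sup>2 W\<close> and \<open>\<kappa> = (D + 2 - lam) / 2\<close> completes the
  square pointwise.\<close>

lemma cyl_int_hardy: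
  assumes w: "smooth_ann R w" and W: "\<And>r. 0 < r \<Longrightarrow> r < R \<Longrightarrow> (W has_real_derivative W' r) (at r)"
    and W': "continuous_on {0<..<R} W'"
    and pos: "\<And>r. 0 < r \<Longrightarrow> r < R \<Longrightarrow> W r \<ge> 0"
    and gr: "\<And>r. 0 < r \<Longrightarrow> r < R \<Longrightarrow> r * W' r \<ge> - lam * W r"
    and D: "D \<ge> 0" "lam \<le> 2"
  shows "(D + 2 - lam)\<^sup>2 / 4 * cyl_int (\<lambda>x. (w x)\<^sup>2 * ((norm x)\<^sup>2 * W (norm x)))
    \<le> cyl_int (\<lambda>x. (euler w x - D / 2 * w x)\<^sup>2 * ((norm x)\<^sup>2 * W (norm x)))"
proof -
  define \<kappa> where "\<kappa> = (D + 2 - lam) / 2"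
  have \<kappa>: "\<kappa> \<ge> 0" using D by (simp add: \<kappa>_def)
  define P where "P = (\<lambda>r. r\<^sup>2 * W r)"
  define P' where "P' = (\<lambda>r. 2 * r * W r + r\<^sup>2 * W' r)"
  have Wc: "continuous_on {0<..<R} W"
    by (rule DERIV_Ioo_continuous_on[OF W])
  have Pd: "(P has_real_derivative P' r) (at r)" if "0 < r" "r < R" for r
    unfolding P_def P'_def using W[OF that] by (auto intro!: derivative_eq_intros)
  have Pc: "continuous_on {0<..<R} P'" "continuous_on {0<..<R} P"
    unfolding P'_def P_def by (intro continuous_intros Wc W')+
  have P0: "P r \<ge> 0" if "0 < r" "r < R" for r using pos[OF that] by (simp add: P_def)
  \<comment> \<open>The assumption \<open>gr\<close> is where f >= 0 enters: it gives r W' >= - lam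
    W, and the factor r^2 in P adds 2 to the exponent.\<close>
  have P1: "r * P' r \<ge> (2 - lam) * P r" if "0 < r" "r < R" for r
    using mult_left_mono[OF gr[OF that], of "r\<^sup>2"] by (simp add: P_def P'_def algebra_simps power2_eq_square)
  let ?z = "\<lambda>x. euler w x - D / 2 * w x"
  let ?h = "\<lambda>x. (w x)\<^sup>2 * P (norm x)"
  have z: "smooth_ann R ?z" by (intro smooth_ann_intros w)
  have V: "Ck_ann 1 R ?h" by (rule C1_ann_radial(1)[OF smooth_annD[OF smooth_ann_power[OF w]] Pd Pc(1)])
  have Veh: "Ck_ann 0 R (euler ?h)" unfolding euler_def using V by (intro Ck_ann_vderiv bounded_linear_ident) simp
  have Vz: "Ck_ann 0 R (\<lambda>x. (?z x)\<^sup>2 * P (norm x))" by (intro C0_ann_radial smooth_annD smooth_ann_power z Pc)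
  have Vh: "Ck_ann 0 R ?h" using V by (auto dest: Ck_ann_SucD)
  have e: "euler ?h x = 2 * (w x * euler w x) * P (norm x) + (w x)\<^sup>2 * (norm x * P' (norm x))" for x
    by (subst C1_ann_radial(2)[OF smooth_annD[OF smooth_ann_power[OF w]] Pd Pc(1)]) (auto simp: euler_square[OF w])
  have key: "0 \<le> ((?z x)\<^sup>2 * P (norm x) - \<kappa>\<^sup>2 * ?h x) + \<kappa> * euler ?h x" for x
  proof (cases "x \<noteq> 0 \<and> norm x < R")
    case True
    have "((?z x)\<^sup>2 * P (norm x) - \<kappa>\<^sup>2 * ?h x) + \<kappa> * euler ?h x =
        P (norm x) * (euler w x + (2 - lam) / 2 * w x)\<^sup>2
        + \<kappa> * (w x)\<^sup>2 * (norm x * P' (norm x) - (2 - lam) * P (norm x))"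
      unfolding e \<kappa>_def by (simp add: field_simps power2_eq_square)
    moreover have "P (norm x) * (euler w x + (2 - lam) / 2 * w x)\<^sup>2 \<ge> 0" using P0 True by simp
    moreover have "\<kappa> * (w x)\<^sup>2 * (norm x * P' (norm x) - (2 - lam) * P (norm x)) \<ge> 0"
      using P1[of "norm x"] True \<kappa> by (intro mult_nonneg_nonneg) auto
    ultimately show ?thesis by simp
  next
    case False
    then have x: "x = 0 \<or> norm x \<ge> R" by auto
    have "annular R w" "annular R (euler w)" using smooth_annD[OF w, of 0] smooth_annD[OF smooth_ann_euler[OF w], of 0] by (auto simp: Ck_ann_def)
    then have "w x = 0" "euler w x = 0" using annular_zero[OF x] by blast+
    then show ?thesis by (simp add: e)
  qed
  have "0 \<le> cyl_int (\<lambda>x. ((?z x)\<^sup>2 * P (norm x) - \<kappa>\<^sup>2 * ?h x) + \<kappa> * euler ?h x)"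
    by (rule cyl_int_nonneg) (rule key)
  also have "\<dots> = cyl_int (\<lambda>x. (?z x)\<^sup>2 * P (norm x)) - \<kappa>\<^sup>2 * cyl_int ?h + \<kappa> * cyl_int (euler ?h)"
    unfolding cyl_int_add[OF Ck_ann_diff[OF Vz Ck_ann_cmult[OF Vh]] Ck_ann_cmult[OF Veh]]
      cyl_int_diff[OF Vz Ck_ann_cmult[OF Vh]] cyl_int_cmult ..
  also have "cyl_int (euler ?h) = 0" unfolding euler_def using cyl_int_vderiv[OF V divfree_id] .
  finally show ?thesis by (simp add: P_def \<kappa>_def power_divide)
qed

text \<open>For suitable \<open>b\<close>, \<open>e\<close> and \<open>q\<close> this is the operator \<open>w \<mapsto> |x|\<^sup>2\<^sup>-\<^sup>q \<Delta> (|x|\<^sup>q w)\<close>; see \<open>laplacian_cyl_op\<close>.\<close>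

definition cyl_op :: "real \<Rightarrow> real \<Rightarrow> ('a::euclidean_space \<Rightarrow> real) \<Rightarrow> 'a \<Rightarrow> real" where
  "cyl_op b e w x = euler (euler w) x + b * euler w x + (sphere_lap w x - e * w x)"

text \<open>Among the cross terms, those containing b integrate to 0. The remaining product of the
  second Euler derivative with \<open>sphere_lap w - e w\<close> has a nonnegative angular part and
  contributes e times the square of \<open>euler w\<close>. It enters the expanded square twice,
  whence b^2 + 2 e.\<close>

lemma cyl_int_cyl_op_ge:
  assumes w: "smooth_ann R w"
  shows "cyl_int (\<lambda>x. (cyl_op b e w x)\<^sup>2) \<ge> cyl_int (\<lambda>x. (sphere_lap w x - e * w x)\<^sup>2) + cyl_int (\<lambda>x. (euler (euler w) x)\<^sup>2)
     + (b\<^sup>2 + 2 * e) * cyl_int (\<lambda>x. (euler w x)\<^sup>2)"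
proof -
  let ?u = "euler w" and ?v = "euler (euler w)" and ?m = "\<lambda>x. sphere_lap w x - e * w x"
  have V: "smooth_ann R ?u" "smooth_ann R ?v" "smooth_ann R ?m" by (intro smooth_ann_intros w)+
  have m1: "cyl_int (\<lambda>x. ?u x * ?m x) = 0"
  proof -
    have "cyl_int (\<lambda>x. ?u x * ?m x) = cyl_int (\<lambda>x. ?u x * sphere_lap w x - e * (w x * ?u x))"
      by (rule arg_cong[where f = cyl_int]) (simp add: fun_eq_iff algebra_simps)
    also have "\<dots> = cyl_int (\<lambda>x. ?u x * sphere_lap w x) - e * cyl_int (\<lambda>x. w x * ?u x)"
      by (subst cyl_int_diff[where R = R]) (auto intro!: smooth_annD smooth_ann_intros w simp: cyl_int_cmult)
    finally show ?thesis by (simp add: cyl_int_euler_sphere_lap[OF w] cyl_int_mult_euler[OF w])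
  qed
  have m2: "cyl_int (\<lambda>x. ?v x * ?m x) \<ge> e * cyl_int (\<lambda>x. (?u x)\<^sup>2)"
  proof -
    have "cyl_int (\<lambda>x. ?v x * ?m x) = cyl_int (\<lambda>x. ?v x * sphere_lap w x - e * (?v x * w x))"
      by (rule arg_cong[where f = cyl_int]) (simp add: fun_eq_iff algebra_simps)
    also have "\<dots> = cyl_int (\<lambda>x. ?v x * sphere_lap w x) - e * cyl_int (\<lambda>x. ?v x * w x)"
      by (subst cyl_int_diff[where R = R]) (auto intro!: smooth_annD smooth_ann_intros w simp: cyl_int_cmult)
    also have "cyl_int (\<lambda>x. ?v x * w x) = - cyl_int (\<lambda>x. (?u x)\<^sup>2)"
      unfolding cyl_int_parts_euler[OF V(1) w] by (simp add: power2_eq_square)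
    finally show ?thesis using cyl_int_euler_euler_sphere_lap[OF w] by simp
  qed
  have "cyl_int (\<lambda>x. (cyl_op b e w x)\<^sup>2) = cyl_int (\<lambda>x. ((((?m x)\<^sup>2 + (?v x)\<^sup>2) + b\<^sup>2 * (?u x)\<^sup>2) +
      ((2 * b) * (?u x * ?v x) + (2 * b) * (?u x * ?m x))) + 2 * (?v x * ?m x))"
    unfolding cyl_op_def by (rule arg_cong[where f = cyl_int]) (simp add: fun_eq_iff power2_eq_square algebra_simps)
  also have "\<dots> = cyl_int (\<lambda>x. (?m x)\<^sup>2) + cyl_int (\<lambda>x. (?v x)\<^sup>2) + b\<^sup>2 * cyl_int (\<lambda>x. (?u x)\<^sup>2) +
      (2 * b * cyl_int (\<lambda>x. ?u x * ?v x) + 2 * b * cyl_int (\<lambda>x. ?u x * ?m x)) + 2 * cyl_int (\<lambda>x. ?v x * ?m x)"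
    by (subst cyl_int_add[where R = R], (intro smooth_annD smooth_ann_intros V w)+)+ (simp add: cyl_int_cmult)
  finally have "cyl_int (\<lambda>x. (cyl_op b e w x)\<^sup>2) = cyl_int (\<lambda>x. (?m x)\<^sup>2) + cyl_int (\<lambda>x. (?v x)\<^sup>2) + b\<^sup>2 * cyl_int (\<lambda>x. (?u x)\<^sup>2)
      + 2 * cyl_int (\<lambda>x. ?v x * ?m x)"
    unfolding m1 cyl_int_mult_euler[OF V(1)] by simp
  then show ?thesis using m2 unfolding distrib_right[of "b\<^sup>2"] by linarith
qed

text \<open>The angular integral pays for B by assumption. Of the coefficient b^2 + 2 e of the
  squared first derivative, the part (n + 2 mu)^2 / 4 yields the first summand of sigma by
  \<open>cyl_int_bessel\<close>. The part D^2 / 4 and the squared second derivative together form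
  the integral of (euler z)^2; \<open>cyl_int_bessel\<close> for z, followed by
  \<open>cyl_int_hardy\<close>, yields the second summand, because D + 2 - lam = n - 2 mu - lam -
  2.\<close>

lemma cyl_int_cyl_op_main:
  fixes w :: "'a::euclidean_space \<Rightarrow> real"
  assumes w: "smooth_ann R w" and sol: "bessel_positive_solution W R c" "c \<ge> 0"
    and W: "\<And>r. 0 < r \<Longrightarrow> r < R \<Longrightarrow> (W has_real_derivative W' r) (at r)"
    and W': "continuous_on {0<..<R} W'"
    and pos: "\<And>r. 0 < r \<Longrightarrow> r < R \<Longrightarrow> W r \<ge> 0"
    and gr: "\<And>r. 0 < r \<Longrightarrow> r < R \<Longrightarrow> r * W' r \<ge> - lam * W r"
    and lam: "lam \<le> 2" and mu: "2 * mu + 4 \<le> n"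
    and ang: "B * cyl_int (\<lambda>x. (w x)\<^sup>2) \<le> cyl_int (\<lambda>x. (sphere_lap w x - (n + 2 * mu) * (n - 4 - 2 * mu) / 4 * w x)\<^sup>2)"
  shows "B * cyl_int (\<lambda>x. (w x)\<^sup>2) +
    c * ((n + 2 * mu)\<^sup>2 / 4 + (n - 2 * mu - lam - 2)\<^sup>2 / 4) * cyl_int (\<lambda>x. (w x)\<^sup>2 * ((norm x)\<^sup>2 * W (norm x)))
    \<le> cyl_int (\<lambda>x. (cyl_op (2 * mu + 2) ((n + 2 * mu) * (n - 4 - 2 * mu) / 4) w x)\<^sup>2)"
proof -
  define D where "D = n - 2 * mu - 4"
  have D: "D \<ge> 0" using mu by (simp add: D_def)
  have Wc: "continuous_on {0<..<R} W"
    by (rule DERIV_Ioo_continuous_on[OF W])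
  let ?P = "cyl_int (\<lambda>x. (w x)\<^sup>2 * ((norm x)\<^sup>2 * W (norm x)))" and ?U = "cyl_int (\<lambda>x. (euler w x)\<^sup>2)"
    and ?V = "cyl_int (\<lambda>x. (euler (euler w) x)\<^sup>2)"
  \<comment> \<open>For u = |x|^(-D/2) w this is the radial derivative of u: euler u = |x|^(-D/2)
    z.\<close>
  let ?z = "\<lambda>x. euler w x - D / 2 * w x"
  have z: "smooth_ann R ?z" by (intro smooth_ann_intros w)
  have ez: "euler ?z x = euler (euler w) x - D / 2 * euler w x" for x
  proof -
    have "euler (\<lambda>x. euler w x + (- D / 2) * w x) x = euler (euler w) x + (- D / 2) * euler w x"
      by (subst euler_add, (rule smooth_ann_differentiable[where R = R], intro smooth_ann_intros w)+,
          subst euler_cmult, rule smooth_ann_differentiable[OF w], rule refl)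
    then show ?thesis by simp
  qed
  have "cyl_int (\<lambda>x. (euler ?z x)\<^sup>2) = cyl_int (\<lambda>x. ((euler (euler w) x)\<^sup>2 + D\<^sup>2 / 4 * (euler w x)\<^sup>2) + (- D) * (euler w x * euler (euler w) x))"
    unfolding ez by (rule arg_cong[where f = cyl_int]) (simp add: fun_eq_iff power2_eq_square algebra_simps)
  also have "\<dots> = ?V + D\<^sup>2 / 4 * ?U + (- D) * cyl_int (\<lambda>x. euler w x * euler (euler w) x)"
    by (subst cyl_int_add[where R = R], (intro smooth_annD smooth_ann_intros w)+)+ (simp only: cyl_int_cmult)
  finally have zz: "cyl_int (\<lambda>x. (euler ?z x)\<^sup>2) = ?V + D\<^sup>2 / 4 * ?U" by (simp add: cyl_int_mult_euler[OF smooth_ann_euler[OF w]])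
  have "c * ((D + 2 - lam)\<^sup>2 / 4 * ?P) \<le> c * cyl_int (\<lambda>x. (?z x)\<^sup>2 * ((norm x)\<^sup>2 * W (norm x)))"
    using sol(2) by (intro mult_left_mono cyl_int_hardy[OF w W W' pos gr D lam])
  also have "\<dots> \<le> ?V + D\<^sup>2 / 4 * ?U"
    using cyl_int_bessel[OF z sol(1) Wc] unfolding zz .
  finally have 1: "c * ((D + 2 - lam)\<^sup>2 / 4 * ?P) \<le> ?V + D\<^sup>2 / 4 * ?U" .
  have 2: "(n + 2 * mu)\<^sup>2 / 4 * (c * ?P) \<le> (n + 2 * mu)\<^sup>2 / 4 * ?U"
    by (intro mult_left_mono cyl_int_bessel[OF w sol(1) Wc]) auto
  have b: "(2 * mu + 2)\<^sup>2 + 2 * ((n + 2 * mu) * (n - 4 - 2 * mu) / 4) = (n + 2 * mu)\<^sup>2 / 4 + D\<^sup>2 / 4"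
    unfolding D_def by (simp add: power2_eq_square field_simps)
  have "c * ((n + 2 * mu)\<^sup>2 / 4 + (n - 2 * mu - lam - 2)\<^sup>2 / 4) * ?P =
     (n + 2 * mu)\<^sup>2 / 4 * (c * ?P) + c * ((D + 2 - lam)\<^sup>2 / 4 * ?P)"
    unfolding D_def by (simp add: algebra_simps)
  also have "\<dots> \<le> (n + 2 * mu)\<^sup>2 / 4 * ?U + (?V + D\<^sup>2 / 4 * ?U)" using 1 2 by linarith
  also have "\<dots> = ?V + ((2 * mu + 2)\<^sup>2 + 2 * ((n + 2 * mu) * (n - 4 - 2 * mu) / 4)) * ?U"
    unfolding b by (simp add: algebra_simps)
  finally show ?thesis using cyl_int_cyl_op_ge[OF w, of "(n + 2 * mu) * (n - 4 - 2 * mu) / 4" "2 * mu + 2"] ang by linarith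
qed

section \<open>Stretching the radial variable\<close>

text \<open>In the coordinate \<open>s = ln (|x| / R)\<close> \<open>stretch R s'\<close> is multiplication by \<open>1 + 2s'\<close>.\<close>

definition stretch :: "real \<Rightarrow> real \<Rightarrow> 'a::euclidean_space \<Rightarrow> 'a" where
  "stretch R s x = ((x \<bullet> x) / R\<^sup>2) powr s *\<^sub>R x"

lemma stretch_0 [simp]: "stretch R s 0 = 0"
  by (simp add: stretch_def)

lemma norm_stretch_square:
  assumes "R > 0" "x \<noteq> 0"
  shows "(norm (stretch R s x))\<^sup>2 = R\<^sup>2 * ((x \<bullet> x) / R\<^sup>2) powr (1 + 2 * s)"
proof -
  have u: "(x \<bullet> x) / R\<^sup>2 > 0" using assms by simp
  have "(norm (stretch R s x))\<^sup>2 = (((x \<bullet> x) / R\<^sup>2) powr s)\<^sup>2 * (x \<bullet> x)"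
    by (simp add: stretch_def power_mult_distrib dot_square_norm)
  also have "(((x \<bullet> x) / R\<^sup>2) powr s)\<^sup>2 = ((x \<bullet> x) / R\<^sup>2) powr (2 * s)"
    using u by (simp add: power2_eq_square powr_add[symmetric])
  also have "\<dots> * (x \<bullet> x) = R\<^sup>2 * ((x \<bullet> x) / R\<^sup>2) powr (1 + 2 * s)"
    using u assms by (simp add: powr_add)
  finally show ?thesis .
qed

text \<open>The relative radius |x| / R is raised to the power 1 + 2 s > 0, a map of (0,1) onto
  itself. This is the purpose of normalising by R: supports stay inside the ball. The radii bounding
  the support are pulled back by the inverse exponent.\<close>

lemma annular_stretch:
  fixes f :: "'a::euclidean_space \<Rightarrow> real"
  assumes R: "R > 0" and s: "1 + 2 * s > 0" and f: "annular R f"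
  shows "annular R (\<lambda>x. f (stretch R s x))"
proof -
  from f obtain p q' where pq': "p > 0" "q' < R" "\<And>x. f x \<noteq> 0 \<Longrightarrow> p \<le> norm x \<and> norm x \<le> q'"
    unfolding annular_def by blast
  \<comment> \<open>The outer bound q' may be negative when f vanishes identically; squaring it is
    monotone only after this correction.\<close>
  define q where "q = max q' 0"
  have q: "0 \<le> q" "q < R" "\<And>x. f x \<noteq> 0 \<Longrightarrow> norm x \<le> q" using pq' R by (auto simp: q_def le_max_iff_disj)
  define e where "e = 1 / (1 + 2 * s)"
  have e: "e > 0" "(1 + 2 * s) * e = 1" using s by (auto simp: e_def)
  let ?p = "R * sqrt ((p\<^sup>2 / R\<^sup>2) powr e)" and ?q = "R * sqrt ((q\<^sup>2 / R\<^sup>2) powr e)"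
  have "?p > 0" using R pq' by simp
  moreover have "q\<^sup>2 / R\<^sup>2 < 1" using q R by (simp add: power_strict_mono)
  then have "(q\<^sup>2 / R\<^sup>2) powr e < 1" using e powr_less_mono2[of e "q\<^sup>2 / R\<^sup>2" 1] by simp
  then have "?q < R" using R by simp
  moreover have "?p \<le> norm x \<and> norm x \<le> ?q" if "f (stretch R s x) \<noteq> 0" for x
  proof -
    have x: "x \<noteq> 0" using that annular_zero[OF _ f, of 0] by auto
    let ?u = "(x \<bullet> x) / R\<^sup>2"
    have u: "?u > 0" using x R by simp
    have ue: "?u = (?u powr (1 + 2 * s)) powr e" using u e by (simp add: powr_powr)
    have "p\<^sup>2 \<le> (norm (stretch R s x))\<^sup>2" "(norm (stretch R s x))\<^sup>2 \<le> q\<^sup>2"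
      using pq'(3)[OF that] q(3)[OF that] pq'(1) by (auto intro: power_mono)
    then have "p\<^sup>2 / R\<^sup>2 \<le> ?u powr (1 + 2 * s)" "?u powr (1 + 2 * s) \<le> q\<^sup>2 / R\<^sup>2"
      unfolding norm_stretch_square[OF R x] using R by (simp_all add: field_simps)
    then have "(p\<^sup>2 / R\<^sup>2) powr e \<le> (?u powr (1 + 2 * s)) powr e" "(?u powr (1 + 2 * s)) powr e \<le> (q\<^sup>2 / R\<^sup>2) powr e"
      using e by (auto intro!: powr_mono2)
    then have "(p\<^sup>2 / R\<^sup>2) powr e \<le> ?u" "?u \<le> (q\<^sup>2 / R\<^sup>2) powr e"
      unfolding ue[symmetric] .
    then have "sqrt ((p\<^sup>2 / R\<^sup>2) powr e) \<le> sqrt ?u" "sqrt ?u \<le> sqrt ((q\<^sup>2 / R\<^sup>2) powr e)"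
      by simp_all
    moreover have "sqrt ?u = norm x / R"
      using R by (simp add: real_sqrt_divide norm_eq_sqrt_inner)
    ultimately show ?thesis using R by (simp add: field_simps)
  qed
  ultimately show ?thesis unfolding annular_def by blast
qed

lemma has_derivative_stretch:
  fixes x :: "'a::euclidean_space"
  assumes "R > 0" "x \<noteq> 0"
  shows "(stretch R s has_derivative (\<lambda>h. ((x \<bullet> x) / R\<^sup>2) powr s *\<^sub>R h + (2 * s * (x \<bullet> h) / (x \<bullet> x)) *\<^sub>R stretch R s x)) (at x)"
proof -
  have u: "(x \<bullet> x) / R\<^sup>2 > 0" using assms by simp
  have xx: "x \<bullet> x \<noteq> 0" using assms by simp
  have "((\<lambda>t. (t / R\<^sup>2) powr s) has_real_derivative s * ((x \<bullet> x) / R\<^sup>2) powr (s - 1) * (1 / R\<^sup>2)) (at (x \<bullet> x))"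
    using DERIV_fun_powr[OF DERIV_cdivide[OF DERIV_ident] u, of s] by simp
  also have "s * ((x \<bullet> x) / R\<^sup>2) powr (s - 1) * (1 / R\<^sup>2) = s * ((x \<bullet> x) / R\<^sup>2) powr s / (x \<bullet> x)"
    using u assms by (simp add: powr_diff)
  finally have "((\<lambda>x. ((x \<bullet> x) / R\<^sup>2) powr s) has_derivative (\<lambda>h. s * ((x \<bullet> x) / R\<^sup>2) powr s / (x \<bullet> x) * (2 * (x \<bullet> h)))) (at x)"
    by (rule has_derivative_radial_sq)
  from has_derivative_scaleR[OF this has_derivative_ident]
  show ?thesis unfolding stretch_def[abs_def] by (rule has_derivative_eq_rhs) (simp add: fun_eq_iff)
qed

lemma has_derivative_stretch_comp:
  fixes f :: "'a::euclidean_space \<Rightarrow> real"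
  assumes R: "R > 0" "x \<noteq> 0" and f: "f differentiable (at (stretch R s x))"
  shows "((\<lambda>x. f (stretch R s x)) has_derivative (\<lambda>h. ((x \<bullet> x) / R\<^sup>2) powr s * frechet_derivative f (at (stretch R s x)) h
     + (2 * s * (x \<bullet> h) / (x \<bullet> x)) * euler f (stretch R s x))) (at x)"
proof -
  let ?D = "frechet_derivative f (at (stretch R s x))"
  have l: "linear ?D" using f linear_frechet_derivative by blast
  show ?thesis
    using has_derivative_compose[OF has_derivative_stretch[OF R] has_derivative_frechet[OF f]]
    by (simp add: linear_add[OF l] linear_cmul[OF l] euler_def vderiv_def)
qed

text \<open>By the chain rule a partial derivative of the composite combines the stretched functions
  \<open>partial_deriv i f\<close> and \<open>euler f\<close> with powers of x \<bullet> x, so the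
  induction has to vary f.\<close>

lemma Ck_ann_stretch:
  fixes f :: "'a::euclidean_space \<Rightarrow> real"
  assumes R: "R > 0" and s: "1 + 2 * s > 0" and f: "Ck_ann k R f"
  shows "Ck_ann k R (\<lambda>x. f (stretch R s x))"
  using f
proof (induction k arbitrary: f)
  case 0
  have an: "annular R (\<lambda>x. f (stretch R s x))" using 0 annular_stretch[OF R s, of f] by (simp add: Ck_ann_def)
  have "isCont (\<lambda>x. f (stretch R s x)) x" if "x \<noteq> 0" for x
  proof -
    have "isCont (stretch R s) x" using has_derivative_continuous[OF has_derivative_stretch[OF R that]] .
    moreover have "isCont f (stretch R s x)" using 0 by (simp add: Ck_ann_def continuous_on_eq_continuous_at)
    ultimately show ?thesis by (rule isCont_o2)
  qed
  with an show ?case by (auto simp: Ck_ann_def intro!: annular_continuous)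
next
  case (Suc k)
  have an: "annular R (\<lambda>x. f (stretch R s x))" using Suc.prems annular_stretch[OF R s, of f] by (simp add: Ck_ann_def)
  have fd: "f differentiable (at x)" for x using Suc.prems Ck_ann_differentiable by blast
  have d: "(\<lambda>x. f (stretch R s x)) differentiable (at x)" for x
    by (rule annular_differentiable[OF an]) (use has_derivative_stretch_comp[OF R _ fd] differentiable_def in blast)
  have eq: "partial_deriv i (\<lambda>x. f (stretch R s x)) =
     (\<lambda>x. (R\<^sup>2 powr (- s)) * (partial_deriv i f (stretch R s x) * (x \<bullet> x) powr s)
        + (2 * s) * ((euler f (stretch R s x) * (x \<bullet> i)) * (x \<bullet> x) powr (- 1)))" (is "?l = ?r") for i
  proof
    fix x
    show "?l x = ?r x"
    proof (cases "x = 0")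
      case True
      then show ?thesis
        using annular_zero[OF _ annular_partial[OF an]] by simp
    next
      case False
      then show ?thesis
        using partial_deriv_eq[OF has_derivative_stretch_comp[OF R False fd], of i s] R
        by (simp add: partial_deriv_def powr_minus powr_divide field_simps)
    qed
  qed
  have "Ck_ann k R (partial_deriv i (\<lambda>x. f (stretch R s x)))" if "i \<in> Basis" for i
    unfolding eq
    by (intro Ck_ann_add Ck_ann_cmult Ck_ann_radial_sq smooth_pos_powr Ck_ann_Ck_mult Suc.IH Ck_linear bounded_linear_inner_left)
       (use Suc.prems that in \<open>auto simp: euler_def intro!: Ck_ann_partial Ck_ann_vderiv bounded_linear_ident\<close>)
  then show ?case using d an unfolding Ck_ann_def by (auto intro!: Ck_SucI simp del: Ck.simps)
qed

lemma smooth_ann_stretch: "R > 0 \<Longrightarrow> 1 + 2 * s > 0 \<Longrightarrow> smooth_ann R f \<Longrightarrow> smooth_ann R (\<lambda>x. f (stretch R s x))"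
  unfolding smooth_ann_def by (auto intro: Ck_ann_stretch)

lemma euler_zero_origin: "smooth_ann R f \<Longrightarrow> euler f 0 = 0"
  using Ck_ann_zero[OF smooth_annD[OF smooth_ann_euler]] by blast

lemma euler_stretch:
  fixes f :: "'a::euclidean_space \<Rightarrow> real"
  assumes R: "R > 0" "1 + 2 * s > 0" and f: "smooth_ann R f"
  shows "euler (\<lambda>x. f (stretch R s x)) = (\<lambda>x. (1 + 2 * s) * euler f (stretch R s x))"
proof
  fix x :: 'a
  show "euler (\<lambda>x. f (stretch R s x)) x = (1 + 2 * s) * euler f (stretch R s x)"
  proof (cases "x = 0")
    case True
    then show ?thesis using euler_zero_origin[OF f] euler_zero_origin[OF smooth_ann_stretch[OF R f]] by simp
  next
    case False
    let ?D = "frechet_derivative f (at (stretch R s x))"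
    have l: "linear ?D" using smooth_ann_differentiable[OF f] linear_frechet_derivative by blast
    have "((x \<bullet> x) / R\<^sup>2) powr s * ?D x = ?D (stretch R s x)"
      using linear_cmul[OF l, of "((x \<bullet> x) / R\<^sup>2) powr s" x] by (simp add: stretch_def)
    then have "((x \<bullet> x) / R\<^sup>2) powr s * ?D x = euler f (stretch R s x)" by (simp add: euler_def vderiv_def)
    moreover have "euler (\<lambda>x. f (stretch R s x)) x = vderiv (\<lambda>x. x) (\<lambda>x. f (stretch R s x)) x"
      by (simp add: euler_def)
    ultimately show ?thesis
      using False vderiv_eq[OF has_derivative_stretch_comp[OF R(1) False smooth_ann_differentiable[OF f]], of "\<lambda>x. x"]
      by (simp add: algebra_simps)
  qed
qed

lemma rot_stretch:
  fixes f :: "'a::euclidean_space \<Rightarrow> real"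
  assumes R: "R > 0" "1 + 2 * s > 0" and f: "smooth_ann R f"
  shows "vderiv (rot i j) (\<lambda>x. f (stretch R s x)) = (\<lambda>x. vderiv (rot i j) f (stretch R s x))"
proof
  fix x :: 'a
  show "vderiv (rot i j) (\<lambda>x. f (stretch R s x)) x = vderiv (rot i j) f (stretch R s x)"
  proof (cases "x = 0")
    case True
    then show ?thesis
      using Ck_ann_zero[OF smooth_annD[OF smooth_ann_rot[OF f]]] Ck_ann_zero[OF smooth_annD[OF smooth_ann_rot[OF smooth_ann_stretch[OF R f]]]] by simp
  next
    case False
    let ?D = "frechet_derivative f (at (stretch R s x))"
    have l: "linear ?D" using smooth_ann_differentiable[OF f] linear_frechet_derivative by blast
    have "((x \<bullet> x) / R\<^sup>2) powr s * ?D (rot i j x) = ?D (rot i j (stretch R s x))"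
      using linear_cmul[OF l, of "((x \<bullet> x) / R\<^sup>2) powr s" "rot i j x"]
      by (simp add: stretch_def rot_def scaleR_diff_right)
    with False show ?thesis
      using vderiv_eq[OF has_derivative_stretch_comp[OF R(1) False smooth_ann_differentiable[OF f]], of "rot i j"]
      by (simp add: vderiv_def inner_commute[of x "rot i j x"] rot_inner)
  qed
qed

lemma sphere_lap_stretch:
  assumes R: "R > 0" "1 + 2 * s > 0" and f: "smooth_ann R f"
  shows "sphere_lap (\<lambda>x. f (stretch R s x)) x = sphere_lap f (stretch R s x)"
  unfolding sphere_lap_def by (simp add: rot_stretch[OF R] f smooth_ann_rot)

text \<open>This is the substitution rule for ds, obtained by differentiating in the parameter. If F
  t is the integral of f composed with \<open>stretch R t\<close>, then (1 + 2 t) F t has derivative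
  (1 + 2 t) G t + 2 F t, which is the integral of a total Euler derivative and hence 0. The claim
  compares t = s with t = 0.\<close>

lemma cyl_int_stretch:
  fixes f :: "'a::euclidean_space \<Rightarrow> real"
  assumes R: "R > 0" and s: "-1/2 < s" "s \<le> 0" and f: "smooth_ann R f"
  shows "(1 + 2 * s) * cyl_int (\<lambda>x. f (stretch R s x)) = cyl_int f"
proof -
  let ?U = "{s..0}"
  let ?n = "real DIM('a)"
  let ?B = "cbox (- R *\<^sub>R One) (R *\<^sub>R One) :: 'a set"
  have ef: "smooth_ann R (euler f)" by (rule smooth_ann_euler[OF f])
  have sU: "1 + 2 * t > 0" if "t \<in> ?U" for t using that s by auto
  have cf: "continuous_on S f" "continuous_on S (euler f)" for S
    using smooth_annD[OF f, of 0] smooth_annD[OF ef, of 0] by (auto simp: Ck_ann_def intro: continuous_on_subset)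
  obtain p where p: "p > 0" "p \<le> R" "\<And>x. f x \<noteq> 0 \<or> euler f x \<noteq> 0 \<Longrightarrow> p \<le> norm x"
  proof -
    from smooth_annD[OF f, of 0] obtain p1 where p1: "p1 > 0" "\<And>x. f x \<noteq> 0 \<Longrightarrow> p1 \<le> norm x"
      unfolding Ck_ann_def annular_def by blast
    from smooth_annD[OF ef, of 0] obtain p2 where p2: "p2 > 0" "\<And>x. euler f x \<noteq> 0 \<Longrightarrow> p2 \<le> norm x"
      unfolding Ck_ann_def annular_def by blast
    show ?thesis using p1 p2 R by (intro that[of "min R (min p1 p2)"]) (auto simp: min_le_iff_disj)
  qed
  \<comment> \<open>Points with (x \<bullet> x) / R^2 below v are mapped by
    \<open>stretch R s\<close> into norm x < p, where f and \<open>euler f\<close> vanish. As v <=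
    1, the same threshold works for every t in [s,0].\<close>
  define v where "v = (p\<^sup>2 / R\<^sup>2) powr (1 / (1 + 2 * s))"
  have v0: "v > 0" using p R by (simp add: v_def)
  have v1: "v \<le> 1"
  proof -
    have "p\<^sup>2 / R\<^sup>2 \<le> 1" using p R by (simp add: power_mono)
    then show ?thesis unfolding v_def using s p R powr_mono2[of "1 / (1 + 2 * s)" "p\<^sup>2 / R\<^sup>2" 1] by simp
  qed
  have vs: "v powr (1 + 2 * s) = p\<^sup>2 / R\<^sup>2" unfolding v_def using s p R by (simp add: powr_powr)
  have vt: "R\<^sup>2 * v powr (1 + 2 * t) \<le> p\<^sup>2" if "t \<in> ?U" for t
  proof -
    have "v powr (1 + 2 * t) \<le> v powr (1 + 2 * s)"
      using v0 v1 that by (intro powr_mono') auto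
    then show ?thesis unfolding vs using R by (simp add: field_simps)
  qed
  \<comment> \<open>The Leibniz rule needs joint continuity on a box containing the origin, where
    negative powers and the logarithm blow up. Truncating the relative squared radius from below at
    v removes the singularity, and \<open>cut\<close> shows that it does not change the
    integrands.\<close>
  define M where "M = (\<lambda>x::'a. max ((x \<bullet> x) / R\<^sup>2) v)"
  have M0: "M x > 0" for x using v0 by (simp add: M_def less_max_iff_disj)
  have Mne: "M x \<noteq> 0" for x using M0[of x] by simp
  have Mc: "continuous_on S M" for S unfolding M_def using R by (intro continuous_intros) auto
  define \<Phi> where "\<Phi> = (\<lambda>t x. M x powr t *\<^sub>R x)"
  have cut: "g (\<Phi> t x) * \<phi> (R\<^sup>2 * M x) = g (stretch R t x) * \<phi> (x \<bullet> x)"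
    if t: "t \<in> ?U" and g: "\<And>x. g x \<noteq> 0 \<Longrightarrow> p \<le> norm x" for t x and g :: "'a \<Rightarrow> real" and \<phi> :: "real \<Rightarrow> real"
  proof (cases "(x \<bullet> x) / R\<^sup>2 \<ge> v")
    case True
    then show ?thesis using R by (simp add: M_def \<Phi>_def stretch_def max_def)
  next
    case False
    then have u: "(x \<bullet> x) / R\<^sup>2 < v" and Mv: "M x = v" by (auto simp: M_def)
    have "(norm (\<Phi> t x))\<^sup>2 = v powr (2 * t) * (x \<bullet> x)"
      using v0 by (simp add: \<Phi>_def Mv power_mult_distrib dot_square_norm power2_eq_square powr_add[symmetric])
    also have "\<dots> < v powr (2 * t) * (R\<^sup>2 * v)"
      using u v0 R by (intro mult_strict_left_mono) (auto simp: field_simps)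
    also have "\<dots> = R\<^sup>2 * v powr (1 + 2 * t)" using v0 by (simp add: powr_add)
    also have "\<dots> \<le> p\<^sup>2" using vt[OF t] .
    finally have "norm (\<Phi> t x) < p" using p by (simp add: power_less_imp_less_base)
    then have 1: "g (\<Phi> t x) = 0" using g by force
    have "norm (stretch R t x) < p"
    proof (cases "x = 0")
      case False
      have "(norm (stretch R t x))\<^sup>2 = R\<^sup>2 * ((x \<bullet> x) / R\<^sup>2) powr (1 + 2 * t)"
        by (rule norm_stretch_square[OF R False])
      also have "\<dots> < R\<^sup>2 * v powr (1 + 2 * t)"
        using u R sU[OF t] by (intro mult_strict_left_mono powr_less_mono2) auto
      also have "\<dots> \<le> p\<^sup>2" using vt[OF t] .
      finally show ?thesis using p by (simp add: power_less_imp_less_base)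
    qed (use p in simp)
    then have "g (stretch R t x) = 0" using g by force
    with 1 show ?thesis by simp
  qed
  define F where "F = (\<lambda>t. cyl_int (\<lambda>x. f (stretch R t x)))"
  define G where "G = (\<lambda>t. cyl_int (\<lambda>x. ln ((x \<bullet> x) / R\<^sup>2) * euler f (stretch R t x)))"
  let ?w = "\<lambda>x. (R\<^sup>2 * M x) powr (- ?n / 2)"
  let ?h = "\<lambda>t x. f (\<Phi> t x) * ?w x"
  let ?h' = "\<lambda>t x. euler f (\<Phi> t x) * (ln (M x) * ?w x)"
  have h: "?h t x = f (stretch R t x) * (x \<bullet> x) powr (- ?n / 2)" if "t \<in> ?U" for t x
    using cut[where g = f and \<phi> = "\<lambda>t. t powr (- ?n / 2)" and x = x, OF that] p(3) by blast
  have h': "?h' t x = (ln ((x \<bullet> x) / R\<^sup>2) * euler f (stretch R t x)) * (x \<bullet> x) powr (- ?n / 2)" if "t \<in> ?U" for t x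
    using cut[where g = "euler f" and \<phi> = "\<lambda>t. ln (t / R\<^sup>2) * t powr (- ?n / 2)" and x = x, OF that] p(3) R by (simp add: mult_ac)
  have \<Phi>c: "continuous_on S (\<lambda>(t, x). \<Phi> t x)" for S
    unfolding \<Phi>_def split_beta using M0
    by (intro continuous_intros continuous_on_compose2[OF Mc[of UNIV]]) (auto simp: Mne)
  have wc: "continuous_on S ?w" for S using M0 R by (intro continuous_intros Mc) (auto simp: Mne)
  have lc: "continuous_on S (\<lambda>x. ln (M x))" for S using M0 by (intro continuous_intros Mc) (auto simp: Mne)
  have \<Phi>1: "continuous_on S (\<Phi> t)" for S t
    unfolding \<Phi>_def using M0 by (intro continuous_intros Mc) (auto simp: Mne)
  have hc: "continuous_on S (?h t)" "continuous_on S (?h' t)" for S t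
    by (intro continuous_intros wc lc continuous_on_compose2[OF cf(1)[of UNIV] \<Phi>1]
        continuous_on_compose2[OF cf(2)[of UNIV] \<Phi>1]; simp)+
  have h0: "?h t x = 0" "?h' t x = 0" if "t \<in> ?U" "x \<notin> ?B" for t x
    using Ck_ann_outside[OF smooth_annD[OF smooth_ann_stretch[OF R sU[OF that(1)] f]] outside_cbox[OF that(2)]]
      Ck_ann_outside[OF smooth_annD[OF smooth_ann_stretch[OF R sU[OF that(1)] ef]] outside_cbox[OF that(2)]]
      h[OF that(1)] h'[OF that(1)] by simp_all
  have Fh: "F t = integral ?B (?h t)" and Gh: "G t = integral ?B (?h' t)" if "t \<in> ?U" for t
    unfolding F_def G_def cyl_int_def h[OF that, symmetric] h'[OF that, symmetric]
    using cont_supp_integral(2)[OF hc(1) h0(1)[OF that]] cont_supp_integral(2)[OF hc(2) h0(2)[OF that]] by auto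
  have "((\<lambda>t. integral ?B (?h t)) has_field_derivative integral ?B (?h' t)) (at t within ?U)" if "t \<in> ?U" for t
  proof (rule leibniz_rule_field_derivative)
    fix t x
    let ?D = "frechet_derivative f (at (\<Phi> t x))"
    have l: "linear ?D" using smooth_ann_differentiable[OF f] linear_frechet_derivative by blast
    have "((\<lambda>t. \<Phi> t x) has_derivative (\<lambda>k. (k * (ln (M x))) *\<^sub>R \<Phi> t x)) (at t)"
      unfolding \<Phi>_def using M0[of x] by (auto intro!: derivative_eq_intros simp: fun_eq_iff)
    from has_derivative_compose[OF this has_derivative_frechet[OF smooth_ann_differentiable[OF f]]]
    have "((\<lambda>t. f (\<Phi> t x)) has_derivative (\<lambda>k. ?D ((k * ln (M x)) *\<^sub>R \<Phi> t x))) (at t)" .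
    also have "(\<lambda>k. ?D ((k * ln (M x)) *\<^sub>R \<Phi> t x)) = (*) (ln (M x) * euler f (\<Phi> t x))"
      by (simp add: fun_eq_iff linear_cmul[OF l] euler_def vderiv_def)
    finally have "((\<lambda>t. f (\<Phi> t x)) has_real_derivative ln (M x) * euler f (\<Phi> t x)) (at t)"
      by (simp add: has_field_derivative_def)
    from has_field_derivative_at_within[OF DERIV_cmult_right[OF this, of "?w x"], of ?U]
    show "((\<lambda>t. ?h t x) has_field_derivative ?h' t x) (at t within ?U)"
      by (simp only: mult.assoc mult.left_commute[of "euler f _"])
  next
    fix t show "?h t integrable_on ?B" by (intro integrable_continuous hc)
  next
    show "continuous_on (?U \<times> ?B) (\<lambda>(t, x). ?h' t x)"
      unfolding split_beta
      by (intro continuous_intros continuous_on_compose2[OF wc[of UNIV]] continuous_on_compose2[OF lc[of UNIV]]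
         continuous_on_compose2[OF cf(2)[of UNIV]] \<Phi>c[unfolded split_beta]) auto
  qed (use that in auto)
  then have Fd: "(F has_real_derivative G t) (at t within ?U)" if "t \<in> ?U" for t
    unfolding Gh[OF that]
    by (rule has_field_derivative_transform_within[where d = 1]) (use that Fh in auto)
  have GF: "(1 + 2 * t) * G t + 2 * F t = 0" if t: "t \<in> ?U" for t
  proof -
    \<comment> \<open>The Euler derivative of this logarithm is the constant 2, so the product rule
      for g times it produces exactly the two terms of the derivative of (1 + 2 t) F t.\<close>
    let ?l = "\<lambda>r. 2 * ln (r / R)"
    let ?g = "\<lambda>x. f (stretch R t x)"
    have g: "smooth_ann R ?g" by (rule smooth_ann_stretch[OF R sU[OF t] f])
    have ld: "(?l has_real_derivative 2 / r) (at r)" if "0 < r" "r < R" for r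
      using that R by (auto intro!: derivative_eq_intros)
    have lc: "continuous_on {0<..<R} (\<lambda>r. 2 / r)" by (intro continuous_intros) auto
    note V = C1_ann_radial[OF smooth_annD[OF g] ld lc]
    have lx: "ln ((x \<bullet> x) / R\<^sup>2) = ?l (norm x)" if "x \<noteq> 0" for x :: 'a
      using that R by (simp add: dot_square_norm ln_div ln_realpow)
    have "euler (\<lambda>x. ?g x * ?l (norm x)) x
       = (1 + 2 * t) * (ln ((x \<bullet> x) / R\<^sup>2) * euler f (stretch R t x)) + 2 * ?g x" for x
      using lx[of x] euler_zero_origin[OF f] Ck_ann_zero[OF smooth_annD[OF f]] R
      by (cases "x = 0") (simp_all add: V(2) euler_stretch[OF R sU[OF t] f])
    then have e: "euler (\<lambda>x. ?g x * ?l (norm x)) = (\<lambda>x. (1 + 2 * t) * (ln ((x \<bullet> x) / R\<^sup>2) * euler f (stretch R t x)) + 2 * ?g x)"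
      by blast
    have V1: "Ck_ann 0 R (\<lambda>x. ln ((x \<bullet> x) / R\<^sup>2) * euler f (stretch R t x))"
    proof -
      have "Ck_ann 0 R (\<lambda>x. euler f (stretch R t x) * ?l (norm x))"
        by (intro C0_ann_radial smooth_annD smooth_ann_stretch R sU t ef DERIV_Ioo_continuous_on[OF ld])
      moreover have "euler f (stretch R t x) * ?l (norm x) = ln ((x \<bullet> x) / R\<^sup>2) * euler f (stretch R t x)" for x
        using lx[of x] euler_zero_origin[OF f] by (cases "x = 0") simp_all
      ultimately show ?thesis by simp
    qed
    have "0 = cyl_int (euler (\<lambda>x. ?g x * ?l (norm x)))"
      unfolding euler_def by (rule cyl_int_vderiv[OF V(1) divfree_id, symmetric])
    also have "\<dots> = (1 + 2 * t) * G t + 2 * F t"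
      unfolding e G_def F_def cyl_int_add[OF Ck_ann_cmult[OF V1] Ck_ann_cmult[OF smooth_annD[OF g]]] cyl_int_cmult ..
    finally show ?thesis by simp
  qed
  have "((\<lambda>t. (1 + 2 * t) * F t) has_real_derivative 0) (at t within ?U)" if "t \<in> ?U" for t
    using GF[OF that] by (auto intro!: derivative_eq_intros Fd that simp: algebra_simps)
  then have "\<exists>c. \<forall>t\<in>?U. (1 + 2 * t) * F t = c"
    using has_field_derivative_zero_constant[of ?U "\<lambda>t. (1 + 2 * t) * F t"] by auto
  then obtain c where c: "\<forall>t\<in>?U. (1 + 2 * t) * F t = c" ..
  have "(1 + 2 * s) * F s = c" "(1 + 2 * 0) * F 0 = c"
    using bspec[OF c, of s] bspec[OF c, of 0] s by simp_all
  then have "(1 + 2 * s) * F s = (1 + 2 * 0) * F 0" by simp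
  moreover have "f (stretch R 0 x) = f x" for x
    using R by (cases "x = 0") (auto simp: stretch_def)
  ultimately show ?thesis by (simp add: F_def)
qed

text \<open>Stretching a test function in the variable \<open>ln |x|\<close> makes its radial derivatives negligible, so the
  Rellich constant bounds the purely angular part. No spherical harmonics are needed.\<close>

lemma cyl_int_angular:
  fixes w :: "'a::euclidean_space \<Rightarrow> real"
  assumes R: "R > 0" and test: "\<And>w :: 'a \<Rightarrow> real. smooth_ann R w \<Longrightarrow> B * cyl_int (\<lambda>x. (w x)\<^sup>2) \<le> cyl_int (\<lambda>x. (cyl_op b e w x)\<^sup>2)"
    and w: "smooth_ann R w"
  shows "B * cyl_int (\<lambda>x. (w x)\<^sup>2) \<le> cyl_int (\<lambda>x. (sphere_lap w x - e * w x)\<^sup>2)"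
proof -
  let ?u = "euler w" and ?v = "euler (euler w)" and ?m = "\<lambda>x. sphere_lap w x - e * w x"
  have V: "smooth_ann R ?u" "smooth_ann R ?v" "smooth_ann R ?m" by (intro smooth_ann_intros w)+
  \<comment> \<open>The integral of (t^2 w_ss + b t w_s + m)^2 expanded in t: stretching by t = 1 +
    2 s multiplies each Euler derivative by t, and the Jacobian t cancels from both sides. Only the
    angular integral survives as t tends to 0.\<close>
  define q where "q = (\<lambda>t. cyl_int (\<lambda>x. (?m x)\<^sup>2) + t * (2 * b * cyl_int (\<lambda>x. ?m x * ?u x))
     + t\<^sup>2 * (2 * cyl_int (\<lambda>x. ?m x * ?v x) + b\<^sup>2 * cyl_int (\<lambda>x. (?u x)\<^sup>2))
     + t^3 * (2 * b * cyl_int (\<lambda>x. ?u x * ?v x)) + t^4 * cyl_int (\<lambda>x. (?v x)\<^sup>2))"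
  have ineq: "B * cyl_int (\<lambda>x. (w x)\<^sup>2) \<le> q t" if t: "0 < t" "t < 1" for t
  proof -
    define s where "s = (t - 1) / 2"
    have s: "- 1 / 2 < s" "s \<le> 0" "1 + 2 * s > 0" "1 + 2 * s = t" using t by (simp_all add: s_def field_simps)
    let ?g = "\<lambda>x. (t\<^sup>2 * ?v x + b * (t * ?u x)) + ?m x"
    have g: "smooth_ann R ?g" by (intro smooth_ann_intros w)
    have ws: "smooth_ann R (\<lambda>x. w (stretch R s x))" by (rule smooth_ann_stretch[OF R s(3) w])
    have 2: "euler (\<lambda>x. c * f x) = (\<lambda>x. c * euler f x)" if "smooth_ann R f" for c and f :: "'a \<Rightarrow> real"
      using that by (intro ext euler_cmult smooth_ann_differentiable)
    have "cyl_op b e (\<lambda>x. w (stretch R s x)) x = ?g (stretch R s x)" for x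
      unfolding cyl_op_def euler_stretch[OF R s(3) w] s(4) 2[OF smooth_ann_stretch[OF R s(3) V(1)]] euler_stretch[OF R s(3) V(1)] sphere_lap_stretch[OF R s(3) w]
      by (simp add: power2_eq_square)
    then have "B * cyl_int (\<lambda>x. (w (stretch R s x))\<^sup>2) \<le> cyl_int (\<lambda>x. (?g (stretch R s x))\<^sup>2)"
      using test[OF ws] by simp
    then have "t * (B * cyl_int (\<lambda>x. (w (stretch R s x))\<^sup>2)) \<le> t * cyl_int (\<lambda>x. (?g (stretch R s x))\<^sup>2)"
      using t by simp
    then have "B * cyl_int (\<lambda>x. (w x)\<^sup>2) \<le> cyl_int (\<lambda>x. (?g x)\<^sup>2)"
      using cyl_int_stretch[OF R s(1,2) smooth_ann_power[OF w]] cyl_int_stretch[OF R s(1,2) smooth_ann_power[OF g]] unfolding s(4)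
      by (simp add: mult.left_commute)
    also have "cyl_int (\<lambda>x. (?g x)\<^sup>2) = cyl_int (\<lambda>x. ((((?m x)\<^sup>2 + (t * (2 * b)) * (?m x * ?u x))
     + (t\<^sup>2 * 2 * (?m x * ?v x) + t\<^sup>2 * b\<^sup>2 * (?u x)\<^sup>2))
     + (t^3 * (2 * b)) * (?u x * ?v x)) + t^4 * (?v x)\<^sup>2)"
      by (rule arg_cong[where f = cyl_int]) (simp add: fun_eq_iff power2_eq_square power3_eq_cube power4_eq_xxxx algebra_simps)
    also have "\<dots> = q t"
      by (simp only: cyl_int_add[where R = R] smooth_annD smooth_ann_add smooth_ann_mult smooth_ann_cmult smooth_ann_power V cyl_int_cmult q_def)
        (simp only: algebra_simps)
    finally show ?thesis .
  qed
  have "(q \<longlongrightarrow> q 0) (at_right 0)"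
    unfolding q_def by (intro tendsto_intros)
  moreover have "\<forall>\<^sub>F t in at_right 0. B * cyl_int (\<lambda>x. (w x)\<^sup>2) \<le> q t"
    unfolding eventually_at_right_field using ineq by (intro exI[of _ 1]) simp
  ultimately have "B * cyl_int (\<lambda>x. (w x)\<^sup>2) \<le> q 0"
    by (rule tendsto_lowerbound) simp
  then show ?thesis by (simp add: q_def)
qed

section \<open>The Laplacian in logarithmic coordinates\<close>

lemma sum_Basis_inner: "b \<in> Basis \<Longrightarrow> (\<Sum>i\<in>Basis. (b \<bullet> i) * g i) = (g b :: real)"
  by (subst sum.cong[OF refl, of _ _ "\<lambda>i. if i = b then g b else 0"]) (auto simp: inner_Basis)

lemma sum_Basis_diff:
  fixes a b :: "'a::euclidean_space" and g :: "'a \<Rightarrow> real"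
  assumes "a \<in> Basis" "b \<in> Basis"
  shows "(\<Sum>i\<in>Basis. ((s *\<^sub>R b - t *\<^sub>R a) \<bullet> i) * g i) = s * g b - t * g a"
  using sum_Basis_inner[OF assms(1), of g] sum_Basis_inner[OF assms(2), of g]
  by (simp add: inner_diff_left left_diff_distrib sum_subtractf mult.assoc sum_distrib_left[symmetric])

lemma rot_rot:
  fixes f :: "'a::euclidean_space \<Rightarrow> real"
  assumes f: "Ck 2 f" and ab: "a \<in> Basis" "b \<in> Basis"
  shows "vderiv (rot a b) (vderiv (rot a b) f) x =
     ((x \<bullet> a) * (b \<bullet> a) * partial_deriv b f x - (x \<bullet> b) * partial_deriv b f x
      - (x \<bullet> a) * partial_deriv a f x + (x \<bullet> b) * (b \<bullet> a) * partial_deriv a f x)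
   + ((x \<bullet> a)\<^sup>2 * partial_deriv b (partial_deriv b f) x + (x \<bullet> b)\<^sup>2 * partial_deriv a (partial_deriv a f) x
      - (x \<bullet> a) * (x \<bullet> b) * partial_deriv a (partial_deriv b f) x
      - (x \<bullet> a) * (x \<bullet> b) * partial_deriv b (partial_deriv a f) x)"
proof -
  let ?H = "\<lambda>i j. partial_deriv j (partial_deriv i f) x"
  have 1: "(\<Sum>i\<in>Basis. rot a b (rot a b x) \<bullet> i * partial_deriv i f x)
     = (rot a b x \<bullet> a) * partial_deriv b f x - (rot a b x \<bullet> b) * partial_deriv a f x"
    unfolding rot_def[of a b "rot a b x"] by (rule sum_Basis_diff[OF ab])
  have "(\<Sum>i\<in>Basis. \<Sum>j\<in>Basis. (rot a b x \<bullet> i) * (rot a b x \<bullet> j) * ?H i j)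
     = (\<Sum>i\<in>Basis. (rot a b x \<bullet> i) * (\<Sum>j\<in>Basis. (rot a b x \<bullet> j) * ?H i j))"
    by (simp add: sum_distrib_left mult.assoc)
  also have "\<dots> = (\<Sum>i\<in>Basis. (rot a b x \<bullet> i) * ((x \<bullet> a) * ?H i b - (x \<bullet> b) * ?H i a))"
    unfolding rot_def by (simp only: sum_Basis_diff[OF ab])
  also have "\<dots> = (x \<bullet> a) * ((x \<bullet> a) * ?H b b - (x \<bullet> b) * ?H b a) - (x \<bullet> b) * ((x \<bullet> a) * ?H a b - (x \<bullet> b) * ?H a a)"
    unfolding rot_def by (simp only: sum_Basis_diff[OF ab])
  finally have 2: "(\<Sum>i\<in>Basis. \<Sum>j\<in>Basis. (rot a b x \<bullet> i) * (rot a b x \<bullet> j) * ?H i j) = \<dots>" .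
  have 3: "rot a b x \<bullet> a = (x \<bullet> a) * (b \<bullet> a) - x \<bullet> b" "rot a b x \<bullet> b = x \<bullet> a - (x \<bullet> b) * (b \<bullet> a)"
    using ab by (simp_all add: rot_def inner_diff_left inner_commute[of a b])
  show ?thesis
    unfolding vderiv_vderiv[OF f bounded_linear_rot bounded_linear_rot] 1 2 3
    by (simp add: algebra_simps power2_eq_square)
qed

text \<open>The sum over all ordered pairs of basis vectors counts each rotation twice up to sign;
  the factor 1/2 in \<open>sphere_lap\<close> corrects this. With S the first-order sum and Q the
  Hessian applied to x twice, \<open>sphere_lap f\<close> equals |x|^2 laplacian f - Q - (n - 1) S,
  while two Euler derivatives give S + Q.\<close>

lemma laplacian_polar:
  fixes f :: "'a::euclidean_space \<Rightarrow> real"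
  assumes f: "Ck 2 f"
  shows "(x \<bullet> x) * laplacian f x = euler (euler f) x + (real DIM('a) - 2) * euler f x + sphere_lap f x"
proof -
  let ?g = "\<lambda>i. partial_deriv i f x" and ?H = "\<lambda>i j. partial_deriv j (partial_deriv i f) x"
  let ?n = "real DIM('a)"
  define S where "S = (\<Sum>i\<in>Basis. (x \<bullet> i) * ?g i)"
  define Q where "Q = (\<Sum>i\<in>Basis. \<Sum>j\<in>Basis. (x \<bullet> i) * (x \<bullet> j) * ?H i j)"
  have f1: "f differentiable (at x)" for x using f by (simp add: numeral_2_eq_2)
  have e1: "euler f x = S" unfolding euler_def S_def by (rule vderiv_Basis[OF f1])
  have e2: "euler (euler f) x = S + Q" unfolding euler_def S_def Q_def
    by (rule vderiv_vderiv[OF f bounded_linear_ident bounded_linear_ident])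
  have xx: "x \<bullet> x = (\<Sum>a\<in>Basis. (x \<bullet> a)\<^sup>2)" by (simp add: euclidean_inner[of x x] power2_eq_square)
  have s1: "(\<Sum>a\<in>Basis. \<Sum>b\<in>Basis. (x \<bullet> a) * (b \<bullet> a) * ?g b) = S"
  proof -
    have "(\<Sum>a\<in>Basis. \<Sum>b\<in>Basis. (x \<bullet> a) * (b \<bullet> a) * ?g b) = (\<Sum>a\<in>Basis. (x \<bullet> a) * (\<Sum>b\<in>Basis. (a \<bullet> b) * ?g b))"
      by (simp add: sum_distrib_left mult.assoc inner_commute)
    then show ?thesis by (simp add: sum_Basis_inner S_def)
  qed
  have s2: "(\<Sum>a\<in>Basis. \<Sum>b\<in>Basis. (x \<bullet> b) * (b \<bullet> a) * ?g a) = S"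
    by (subst sum.swap) (use s1 in \<open>simp add: inner_commute\<close>)
  have s3: "(\<Sum>a\<in>(Basis::'a set). \<Sum>b\<in>Basis. (x \<bullet> b) * ?g b) = ?n * S" by (simp add: S_def)
  have s4: "(\<Sum>a\<in>Basis. \<Sum>b\<in>(Basis::'a set). (x \<bullet> a) * ?g a) = ?n * S" by (simp add: S_def sum_distrib_left)
  have s5: "(\<Sum>a\<in>Basis. \<Sum>b\<in>Basis. (x \<bullet> a)\<^sup>2 * ?H b b) = (x \<bullet> x) * laplacian f x"
    unfolding laplacian_def xx by (simp add: sum_product)
  have s6: "(\<Sum>a\<in>Basis. \<Sum>b\<in>Basis. (x \<bullet> b)\<^sup>2 * ?H a a) = (x \<bullet> x) * laplacian f x"
    by (subst sum.swap) (rule s5)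
  have s7: "(\<Sum>a\<in>Basis. \<Sum>b\<in>Basis. (x \<bullet> a) * (x \<bullet> b) * ?H a b) = Q" by (simp add: Q_def)
  have s8: "(\<Sum>a\<in>Basis. \<Sum>b\<in>Basis. (x \<bullet> a) * (x \<bullet> b) * ?H b a) = Q"
    by (subst sum.swap) (simp add: Q_def mult.commute[of "x \<bullet> _" "x \<bullet> _"])
  have "(\<Sum>a\<in>Basis. \<Sum>b\<in>Basis. vderiv (rot a b) (vderiv (rot a b) f) x) = (\<Sum>a\<in>Basis. \<Sum>b\<in>Basis.
     ((x \<bullet> a) * (b \<bullet> a) * ?g b - (x \<bullet> b) * ?g b - (x \<bullet> a) * ?g a + (x \<bullet> b) * (b \<bullet> a) * ?g a)
   + ((x \<bullet> a)\<^sup>2 * ?H b b + (x \<bullet> b)\<^sup>2 * ?H a a - (x \<bullet> a) * (x \<bullet> b) * ?H b a - (x \<bullet> a) * (x \<bullet> b) * ?H a b))"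
    by (intro sum.cong refl rot_rot[OF f])
  also have "\<dots> = 2 * S - 2 * ?n * S + 2 * ((x \<bullet> x) * laplacian f x) - 2 * Q"
    unfolding sum.distrib sum_subtractf s1 s2 s3 s4 s5 s6 s7 s8 by simp
  finally show ?thesis unfolding sphere_lap_def e1 e2 by (simp add: algebra_simps)
qed

lemma vderiv_mult_radial_sq:
  fixes w :: "'a::euclidean_space \<Rightarrow> real"
  assumes w: "smooth_ann R w" and g: "smooth_pos g" and g': "(g has_real_derivative g') (at (x \<bullet> x))" and x: "x \<noteq> 0"
  shows "vderiv A (\<lambda>x. w x * g (x \<bullet> x)) x = vderiv A w x * g (x \<bullet> x) + w x * (2 * g' * (x \<bullet> A x))"
  using vderiv_mult[OF smooth_ann_differentiable[OF w], of "\<lambda>x. g (x \<bullet> x)" x A] has_derivative_radial_sq[OF g']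
    vderiv_radial_sq[OF g', of A] differentiable_def by fastforce

lemma smooth_ann_radial_sq: "smooth_ann R f \<Longrightarrow> smooth_pos g \<Longrightarrow> smooth_ann R (\<lambda>x. f x * g (x \<bullet> x))"
  unfolding smooth_ann_def by (auto intro: Ck_ann_radial_sq)

lemma rot_mult_radial_sq:
  assumes w: "smooth_ann R w" and g: "smooth_pos g"
  shows "vderiv (rot i j) (\<lambda>x. w x * g (x \<bullet> x)) x = vderiv (rot i j) w x * g (x \<bullet> x)"
proof (cases "x = 0")
  case True
  then show ?thesis
    using Ck_ann_zero[OF smooth_annD[OF smooth_ann_rot[OF w]]] Ck_ann_zero[OF smooth_annD[OF smooth_ann_rot[OF smooth_ann_radial_sq[OF w g]]]] by simp
next
  case False
  from g obtain g' where "\<And>t. t > 0 \<Longrightarrow> (g has_real_derivative g' t) (at t)" using smooth_posE by blast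
  from vderiv_mult_radial_sq[OF w g this False, of "rot i j"] False show ?thesis
    by (simp add: inner_commute[of x "rot i j x"] rot_inner)
qed

lemma sphere_lap_mult_radial_sq:
  assumes w: "smooth_ann R w" and g: "smooth_pos g"
  shows "sphere_lap (\<lambda>x. w x * g (x \<bullet> x)) x = sphere_lap w x * g (x \<bullet> x)"
  unfolding sphere_lap_def by (simp add: rot_mult_radial_sq[OF w g, abs_def] rot_mult_radial_sq[OF smooth_ann_rot[OF w] g] sum_distrib_right)

lemma euler_mult_powr:
  assumes w: "smooth_ann R w"
  shows "euler (\<lambda>x. w x * (x \<bullet> x) powr q) = (\<lambda>x. (euler w x + 2 * q * w x) * (x \<bullet> x) powr q)"
proof
  fix x
  show "euler (\<lambda>x. w x * (x \<bullet> x) powr q) x = (euler w x + 2 * q * w x) * (x \<bullet> x) powr q"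
  proof (cases "x = 0")
    case True
    then show ?thesis
      using euler_zero_origin[OF smooth_ann_radial_sq[OF w smooth_pos_powr[of q]]] by simp
  next
    case False
    have "((\<lambda>t. t powr q) has_real_derivative q * (x \<bullet> x) powr (q - 1)) (at (x \<bullet> x))"
      using False by (auto intro!: derivative_eq_intros)
    from vderiv_mult_radial_sq[OF w smooth_pos_powr this False, of "\<lambda>x. x"] False show ?thesis
      by (simp add: euler_def powr_diff field_simps)
  qed
qed

text \<open>Conjugation by |x|^p replaces \<open>euler\<close> by \<open>euler\<close> + p. Hence b
  = 2 p + n - 2 and e = - p (p + n - 2) with p = (2 mu + 4 - n) / 2, the exponent that turns u^2 /
  |x|^(2 mu + 4) dx into w^2 / |x|^n dx. The code has p / 2 because its base is x \<bullet>
  x.\<close>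

lemma laplacian_cyl_op:
  fixes w :: "'a::euclidean_space \<Rightarrow> real"
  assumes w: "smooth_ann R w" and n: "n = real DIM('a)"
  shows "(x \<bullet> x) * laplacian (\<lambda>x. w x * (x \<bullet> x) powr ((2 * mu + 4 - n) / 4)) x =
    cyl_op (2 * mu + 2) ((n + 2 * mu) * (n - 4 - 2 * mu) / 4) w x * (x \<bullet> x) powr ((2 * mu + 4 - n) / 4)"
proof -
  define q where "q = (2 * mu + 4 - n) / 4"
  let ?v = "\<lambda>x. w x * (x \<bullet> x) powr q"
  have v: "smooth_ann R ?v" by (rule smooth_ann_radial_sq[OF w smooth_pos_powr])
  have e1: "euler ?v = (\<lambda>x. (euler w x + 2 * q * w x) * (x \<bullet> x) powr q)" by (rule euler_mult_powr[OF w])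
  have u: "smooth_ann R (\<lambda>x. euler w x + 2 * q * w x)" by (intro smooth_ann_intros w)
  have eu: "euler (\<lambda>x. euler w x + 2 * q * w x) x = euler (euler w) x + 2 * q * euler w x" for x
    by (subst euler_add, (rule smooth_ann_differentiable[where R = R], intro smooth_ann_intros w)+,
        subst euler_cmult, rule smooth_ann_differentiable[OF w], rule refl)
  have e2: "euler (euler ?v) x = (euler (euler w) x + 2 * q * euler w x + 2 * q * (euler w x + 2 * q * w x)) * (x \<bullet> x) powr q" for x
    unfolding e1 euler_mult_powr[OF u] eu by simp
  have "Ck 2 ?v" using smooth_annD[OF v] by (simp add: Ck_ann_def)
  from laplacian_polar[OF this, of x]
  have "(x \<bullet> x) * laplacian ?v x = (euler (euler w) x + 2 * q * euler w x + 2 * q * (euler w x + 2 * q * w x)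
      + (n - 2) * (euler w x + 2 * q * w x) + sphere_lap w x) * (x \<bullet> x) powr q"
    unfolding e2 sphere_lap_mult_radial_sq[OF w smooth_pos_powr] unfolding e1 n by (simp add: algebra_simps)
  also have "euler (euler w) x + 2 * q * euler w x + 2 * q * (euler w x + 2 * q * w x)
      + (n - 2) * (euler w x + 2 * q * w x) + sphere_lap w x = cyl_op (2 * mu + 2) ((n + 2 * mu) * (n - 4 - 2 * mu) / 4) w x"
    unfolding cyl_op_def q_def by (simp add: field_simps)
  finally show ?thesis unfolding q_def .
qed

section \<open>Weighted integrals on the ball as integrals \<open>cyl_int\<close>\<close>

lemma smooth_ann_Cc_inf_ball:
  assumes v: "smooth_ann R v" shows "v \<in> Cc_inf_ball R"
proof -
  from smooth_annD[OF v, of 0] obtain q where q: "q < R" "\<And>x. v x \<noteq> 0 \<Longrightarrow> norm x \<le> q"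
    unfolding Ck_ann_def annular_def by blast
  have "{x. v x \<noteq> 0} \<subseteq> cball 0 q" using q by auto
  then have cl: "closure {x. v x \<noteq> 0} \<subseteq> cball 0 q" by (rule closure_minimal) simp
  then have "compact (closure {x. v x \<noteq> 0})"
    using compact_eq_bounded_closed bounded_subset bounded_cball by blast
  moreover have "closure {x. v x \<noteq> 0} \<subseteq> ball 0 R" using cl q(1) by force
  ultimately show ?thesis using v by (simp add: Cc_inf_ball_def smooth_ann_def Ck_ann_def)
qed

lemma norm_powr_dot: "norm x powr q = (x \<bullet> x) powr (q / 2)"
proof (cases "x = 0")
  case False
  then have "(x \<bullet> x) powr (q / 2) = (norm x powr 2) powr (q / 2)" by (simp add: dot_square_norm)
  also have "\<dots> = norm x powr q" by (subst powr_powr) simp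
  finally show ?thesis by simp
qed simp

lemma powr_square_divide:
  fixes t :: real
  assumes "t > 0" "2 * q - m = r"
  shows "(t powr q)\<^sup>2 / t powr m = t powr r"
  unfolding assms(2)[symmetric] using assms(1) by (simp add: power2_eq_square powr_diff powr_add[symmetric])

lemma nn_integral_cyl_int:
  fixes h :: "'a::euclidean_space \<Rightarrow> real"
  assumes h: "Ck_ann 0 R h" and h0: "\<And>x. h x \<ge> 0"
    and g: "\<And>x. x \<noteq> 0 \<Longrightarrow> norm x < R \<Longrightarrow> g x = h x * (x \<bullet> x) powr (- real DIM('a) / 2)"
  shows "(\<integral>\<^sup>+x\<in>ball 0 R. ennreal (g x) \<partial>lborel) = ennreal (cyl_int h)"
proof -
  have "AE x in lborel. x \<noteq> (0::'a)" by (rule AE_lborel_singleton)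
  then have "AE x in lborel. ennreal (g x) * indicator (ball 0 R) x = ennreal (h x * (x \<bullet> x) powr (- real DIM('a) / 2))"
  proof eventually_elim
    case (elim x)
    then show ?case using g[of x] Ck_ann_outside[OF h, of x] by (cases "norm x < R") (auto simp: indicator_def)
  qed
  then have "(\<integral>\<^sup>+x\<in>ball 0 R. ennreal (g x) \<partial>lborel) = (\<integral>\<^sup>+x. ennreal (h x * (x \<bullet> x) powr (- real DIM('a) / 2)) \<partial>lborel)"
    by (rule nn_integral_cong_AE)
  also have "\<dots> = ennreal (cyl_int h)"
    unfolding cyl_int_def by (rule nn_integral_eq_integral[OF Ck_ann_0_integrable[OF h]]) (use h0 in simp)
  finally show ?thesis .
qed

context
  fixes R mu n :: real and w v :: "'a::euclidean_space \<Rightarrow> real"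
  assumes w: "smooth_ann R w" and n: "n = real DIM('a)"
    and v: "v = (\<lambda>x. w x * (x \<bullet> x) powr ((2 * mu + 4 - n) / 4))"
begin

lemma nn_integral_v: "(\<integral>\<^sup>+x\<in>ball 0 R. ennreal ((v x)\<^sup>2 / norm x powr (2 * mu + 4)) \<partial>lborel) = ennreal (cyl_int (\<lambda>x. (w x)\<^sup>2))"
proof (rule nn_integral_cyl_int)
  show "Ck_ann 0 R (\<lambda>x. (w x)\<^sup>2)" by (intro smooth_annD smooth_ann_intros w)
  fix x :: 'a assume "x \<noteq> 0"
  then have p: "x \<bullet> x > 0" by simp
  have "(v x)\<^sup>2 / norm x powr (2 * mu + 4) = (w x)\<^sup>2 * (((x \<bullet> x) powr ((2 * mu + 4 - n) / 4))\<^sup>2 / (x \<bullet> x) powr (mu + 2))"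
    by (simp add: v norm_powr_dot power_mult_distrib add_divide_distrib)
  also have "((x \<bullet> x) powr ((2 * mu + 4 - n) / 4))\<^sup>2 / (x \<bullet> x) powr (mu + 2) = (x \<bullet> x) powr (- n / 2)"
    using p by (rule powr_square_divide) (simp add: field_simps)
  finally show "(v x)\<^sup>2 / norm x powr (2 * mu + 4) = (w x)\<^sup>2 * (x \<bullet> x) powr (- real DIM('a) / 2)"
    unfolding n .
qed simp

lemma nn_integral_laplacian_v: "(\<integral>\<^sup>+x\<in>ball 0 R. ennreal ((laplacian v x)\<^sup>2 / norm x powr (2 * mu)) \<partial>lborel) =
    ennreal (cyl_int (\<lambda>x. (cyl_op (2 * mu + 2) ((n + 2 * mu) * (n - 4 - 2 * mu) / 4) w x)\<^sup>2))"
proof (rule nn_integral_cyl_int)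
  let ?T = "cyl_op (2 * mu + 2) ((n + 2 * mu) * (n - 4 - 2 * mu) / 4) w"
  show "Ck_ann 0 R (\<lambda>x. (?T x)\<^sup>2)" unfolding cyl_op_def by (intro smooth_annD smooth_ann_intros w)
  fix x :: 'a assume "x \<noteq> 0"
  then have p: "x \<bullet> x > 0" by simp
  have "laplacian v x = ?T x * ((x \<bullet> x) powr ((2 * mu + 4 - n) / 4) / (x \<bullet> x))"
    unfolding v using laplacian_cyl_op[OF w n, of x mu] p by (simp add: field_simps)
  then have "(laplacian v x)\<^sup>2 / norm x powr (2 * mu) = (?T x)\<^sup>2 * (((x \<bullet> x) powr ((2 * mu + 4 - n) / 4) / (x \<bullet> x) powr 1)\<^sup>2 / (x \<bullet> x) powr mu)"
    using p by (simp add: norm_powr_dot power_mult_distrib power_divide)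
  also have "((x \<bullet> x) powr ((2 * mu + 4 - n) / 4) / (x \<bullet> x) powr 1)\<^sup>2 / (x \<bullet> x) powr mu = (x \<bullet> x) powr (- n / 2)"
    unfolding powr_diff[symmetric] using p by (rule powr_square_divide) (simp add: field_simps)
  finally show "(laplacian v x)\<^sup>2 / norm x powr (2 * mu) = (?T x)\<^sup>2 * (x \<bullet> x) powr (- real DIM('a) / 2)"
    unfolding n .
qed simp

lemma nn_integral_W_v:
  assumes W: "continuous_on {0<..<R} W" "\<And>r. 0 < r \<Longrightarrow> r < R \<Longrightarrow> W r \<ge> 0"
  shows "(\<integral>\<^sup>+x\<in>ball 0 R. ennreal (W (norm x) * (v x)\<^sup>2 / norm x powr (2 * mu + 2)) \<partial>lborel) =
    ennreal (cyl_int (\<lambda>x. (w x)\<^sup>2 * ((norm x)\<^sup>2 * W (norm x))))"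
proof (rule nn_integral_cyl_int)
  show "Ck_ann 0 R (\<lambda>x. (w x)\<^sup>2 * ((norm x)\<^sup>2 * W (norm x)))"
    by (intro C0_ann_radial[where G = "\<lambda>r. r\<^sup>2 * W r"] smooth_annD smooth_ann_power w continuous_intros W)
  show "(w x)\<^sup>2 * ((norm x)\<^sup>2 * W (norm x)) \<ge> 0" for x
    using W(2)[of "norm x"] Ck_ann_outside[OF smooth_annD[OF w], of x] by (cases "x \<noteq> 0 \<and> norm x < R") auto
  fix x :: 'a assume "x \<noteq> 0"
  then have p: "x \<bullet> x > 0" by simp
  have "W (norm x) * (v x)\<^sup>2 / norm x powr (2 * mu + 2) =
      (w x)\<^sup>2 * W (norm x) * (((x \<bullet> x) powr ((2 * mu + 4 - n) / 4))\<^sup>2 / (x \<bullet> x) powr (mu + 1))"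
    by (simp add: v norm_powr_dot power_mult_distrib add_divide_distrib)
  also have "((x \<bullet> x) powr ((2 * mu + 4 - n) / 4))\<^sup>2 / (x \<bullet> x) powr (mu + 1) = (x \<bullet> x) powr (- n / 2) * (x \<bullet> x) powr 1"
    unfolding powr_add[symmetric] using p by (rule powr_square_divide) (simp add: field_simps)
  finally show "W (norm x) * (v x)\<^sup>2 / norm x powr (2 * mu + 2) = (w x)\<^sup>2 * ((norm x)\<^sup>2 * W (norm x)) * (x \<bullet> x) powr (- real DIM('a) / 2)"
    unfolding n using p by (simp add: dot_square_norm mult_ac)
qed

text \<open>If w has zero norm, both sides are compared with 0. Otherwise v is an admissible
  competitor in the infimum, with finite numerator and finite positive denominator, so the extended
  quotient is an ordinary real one.\<close>

lemma rellich_test: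
  assumes B: "B \<ge> 0" "ennreal B \<le> rellich_const TYPE('a) R mu"
  shows "B * cyl_int (\<lambda>x. (w x)\<^sup>2) \<le> cyl_int (\<lambda>x. (cyl_op (2 * mu + 2) ((n + 2 * mu) * (n - 4 - 2 * mu) / 4) w x)\<^sup>2)" (is "_ * ?Y \<le> ?X")
proof (cases "?Y = 0")
  case True
  moreover have "?X \<ge> 0" by (rule cyl_int_nonneg) simp
  ultimately show ?thesis by simp
next
  case False
  have Y: "?Y > 0" using False cyl_int_nonneg[of "\<lambda>x. (w x)\<^sup>2"] by fastforce
  have X: "?X \<ge> 0" by (rule cyl_int_nonneg) simp
  have "v \<noteq> (\<lambda>x. 0)"
  proof
    assume v0: "v = (\<lambda>x. 0)"
    have "w x = 0" for x using fun_cong[OF v0, of x] v Ck_ann_zero[OF smooth_annD[OF w]] by (cases "x = 0") auto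
    then show False using False by (simp add: cyl_int_def)
  qed
  moreover have "v \<in> Cc_inf_ball R"
    unfolding v by (rule smooth_ann_Cc_inf_ball) (rule smooth_ann_radial_sq[OF w smooth_pos_powr])
  ultimately have "ennreal B \<le> ennreal ?X / ennreal ?Y"
    unfolding nn_integral_v[symmetric] nn_integral_laplacian_v[symmetric]
    by (intro order_trans[OF B(2)]) (auto simp: rellich_const_def intro!: INF_lower)
  then have "B \<le> ?X / ?Y" using X Y by (simp add: divide_ennreal)
  then show ?thesis using Y by (simp add: field_simps)
qed

end

section \<open>Logarithmic cutoffs\<close>

text \<open>The flat function exp (- 1 / s) extended by 0. The powers of s in the denominator close
  the family under differentiation. No plateau is built in: the cutoffs converge to exp (- 1 / 2),
  the value at s = 2, and this constant cancels in \<open>cut_limit\<close>.\<close>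

definition flat_exp :: "nat \<Rightarrow> real \<Rightarrow> real" where
  "flat_exp i s = (if s > 0 then exp (- 1 / s) / s ^ i else 0)"

lemma power_le_fact_exp:
  assumes "(x::real) \<ge> 0" shows "x ^ n \<le> fact n * exp x"
proof -
  have "(\<Sum>k\<in>{n}. inverse (fact k) * x ^ k) \<le> (\<Sum>k. inverse (fact k) * x ^ k)"
    by (rule sum_le_suminf[OF summable_exp]) (use assms in auto)
  then show ?thesis by (simp add: exp_def field_simps)
qed

lemma flat_exp_nonneg: "flat_exp i s \<ge> 0"
  by (simp add: flat_exp_def)

text \<open>This is x^(i + 1) <= (i + 1)! exp x at x = 1 / s. The linear bound gives the derivative
  at the flat point s = 0, where the difference quotient is the next member of the family, and later
  the numerical bounds on the cutoffs.\<close>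

lemma flat_exp_le: "flat_exp i s \<le> fact (Suc i) * \<bar>s\<bar>"
proof (cases "s > 0")
  case True
  have "(1 / s) ^ Suc i \<le> fact (Suc i) * exp (1 / s)" by (rule power_le_fact_exp) (use True in simp)
  then have "exp (- (1 / s)) * (1 / s) ^ Suc i \<le> exp (- (1 / s)) * (fact (Suc i) * exp (1 / s))"
    by (rule mult_left_mono) simp
  also have "\<dots> = fact (Suc i)" by (simp add: exp_minus field_simps)
  finally have "s * (exp (- (1 / s)) * (1 / s) ^ Suc i) \<le> s * fact (Suc i)"
    using True by (intro mult_left_mono) auto
  also have "s * (exp (- (1 / s)) * (1 / s) ^ Suc i) = exp (- (1 / s)) / s ^ i"
    using True by (simp add: power_divide)
  finally show ?thesis using True by (simp add: flat_exp_def mult.commute)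
next
  case False
  then show ?thesis by (simp add: flat_exp_def mult_nonneg_nonpos del: fact_Suc)
qed

lemma DERIV_inverse_power:
  assumes "(s::real) \<noteq> 0"
  shows "((\<lambda>s. inverse s ^ i) has_real_derivative - real i * inverse s ^ (i + 1)) (at s)"
  by (rule DERIV_cong[OF DERIV_power[OF DERIV_inverse[OF assms]]]) (cases i, simp_all add: algebra_simps)

lemma flat_exp_has_derivative:
  "(flat_exp i has_real_derivative flat_exp (i + 2) s - real i * flat_exp (i + 1) s) (at s)"
proof -
  consider "s > 0" | "s < 0" | "s = 0" by linarith
  then show ?thesis
  proof cases
    case 1
    have "((\<lambda>s. exp (- 1 / s)) has_real_derivative exp (- 1 / s) * (inverse s)\<^sup>2) (at s)"
      using 1 by (auto intro!: derivative_eq_intros simp: field_simps power2_eq_square)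
    from DERIV_mult[OF this DERIV_inverse_power[of s i]]
    have "((\<lambda>s. exp (- 1 / s) * inverse s ^ i) has_real_derivative flat_exp (i + 2) s - real i * flat_exp (i + 1) s) (at s)"
      by (rule DERIV_cong) (use 1 in \<open>simp_all add: flat_exp_def field_simps power2_eq_square\<close>)
    then show ?thesis
      by (rule DERIV_cong_ev[THEN iffD1, rotated 3])
         (use eventually_nhds_in_open[of "{0<..}" s] 1 in \<open>auto elim!: eventually_mono simp: flat_exp_def field_simps\<close>)
  next
    case 2
    have "((\<lambda>s. 0) has_real_derivative flat_exp (i + 2) s - real i * flat_exp (i + 1) s) (at s)"
      using 2 by (simp add: flat_exp_def)
    then show ?thesis
      by (rule DERIV_cong_ev[THEN iffD1, rotated 3])
         (use eventually_nhds_in_open[of "{..<0}" s] 2 in \<open>auto elim!: eventually_mono simp: flat_exp_def\<close>)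
  next
    case 3
    have "(\<lambda>h. flat_exp (Suc i) h) \<midarrow>0\<rightarrow> 0"
    proof (rule tendsto_sandwich[OF _ _ tendsto_const])
      show "(\<lambda>h. fact (Suc (Suc i)) * \<bar>h\<bar>) \<midarrow>0\<rightarrow> (0::real)" by (auto intro!: tendsto_eq_intros)
    qed (simp_all only: flat_exp_nonneg flat_exp_le eventually_True)
    moreover have "(flat_exp i (0 + h) - flat_exp i 0) / h = flat_exp (Suc i) h" for h by (simp add: flat_exp_def)
    ultimately show ?thesis unfolding 3 DERIV_def by (simp add: flat_exp_def)
  qed
qed

lemma flat_exp_0_mono: "s \<le> t \<Longrightarrow> flat_exp 0 s \<le> flat_exp 0 t"
  by (auto simp: flat_exp_def frac_le)

text \<open>At the critical exponent \<open>2 \<mu> + 4 = n\<close> only cutoffs in \<open>ln |x|\<close> have small energy. The factor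
  \<open>t\<^sup>-\<^sup>j\<close> makes the family closed under differentiation.\<close>

definition log_cut :: "real \<Rightarrow> real \<Rightarrow> nat \<Rightarrow> nat \<Rightarrow> real \<Rightarrow> real" where
  "log_cut R \<kappa> i j t = (if t > 0 then flat_exp i (2 + \<kappa> * ln (t / R\<^sup>2)) / t ^ j else 0)"

lemma log_cut_Suc: "t * log_cut R \<kappa> i (Suc j) t = log_cut R \<kappa> i j t"
  by (simp add: log_cut_def)

lemma cut_zero:
  assumes "R > 0" "\<kappa> > 0" "t < R\<^sup>2 * exp (- 2 / \<kappa>)"
  shows "log_cut R \<kappa> i j t = 0"
proof (cases "t > 0")
  case True
  then have "t / R\<^sup>2 < exp (- 2 / \<kappa>)" using assms by (simp add: field_simps)
  then have "ln (t / R\<^sup>2) < - 2 / \<kappa>" using True assms by (subst ln_less_cancel_iff[symmetric, of _ "exp _", unfolded ln_exp, THEN sym]) auto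
  then have "2 + \<kappa> * ln (t / R\<^sup>2) < 0" using assms by (simp add: field_simps)
  then show ?thesis using True by (simp add: log_cut_def flat_exp_def)
qed (simp add: log_cut_def)

lemma cut_has_derivative:
  assumes R: "R > 0" "\<kappa> > 0"
  shows "(log_cut R \<kappa> i j has_real_derivative
     \<kappa> * log_cut R \<kappa> (i + 2) (j + 1) t - real i * \<kappa> * log_cut R \<kappa> (i + 1) (j + 1) t - real j * log_cut R \<kappa> i (j + 1) t) (at t)"
    (is "(_ has_real_derivative ?D t) _")
proof (cases "t > 0")
  case True
  have "((\<lambda>t. 2 + \<kappa> * ln (t / R\<^sup>2)) has_real_derivative \<kappa> / t) (at t)"
    using True R by (auto intro!: derivative_eq_intros simp: field_simps)
  from DERIV_chain2[OF flat_exp_has_derivative this]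
  have b: "((\<lambda>t. flat_exp i (2 + \<kappa> * ln (t / R\<^sup>2))) has_real_derivative
     (flat_exp (i + 2) (2 + \<kappa> * ln (t / R\<^sup>2)) - real i * flat_exp (i + 1) (2 + \<kappa> * ln (t / R\<^sup>2))) * (\<kappa> / t)) (at t)" .
  have t: "t \<noteq> 0" using True by simp
  have eq: "(flat_exp (i + 2) (2 + \<kappa> * ln (t / R\<^sup>2)) - real i * flat_exp (i + 1) (2 + \<kappa> * ln (t / R\<^sup>2))) * (\<kappa> / t) * inverse t ^ j +
      - real j * inverse t ^ (j + 1) * flat_exp i (2 + \<kappa> * ln (t / R\<^sup>2)) = ?D t"
    using True by (simp add: log_cut_def divide_inverse power_inverse algebra_simps)
  have "((\<lambda>t. flat_exp i (2 + \<kappa> * ln (t / R\<^sup>2)) * inverse t ^ j) has_real_derivative ?D t) (at t)"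
    by (rule DERIV_cong[OF DERIV_mult[OF b DERIV_inverse_power[OF t, of j]] eq])
  then show ?thesis
    by (rule DERIV_cong_ev[THEN iffD1, rotated 3])
       (use eventually_nhds_in_open[of "{0<..}" t] True in \<open>auto elim!: eventually_mono simp: log_cut_def field_simps\<close>)
next
  case False
  have "((\<lambda>t. 0) has_real_derivative ?D t) (at t)" using False by (simp add: log_cut_def)
  moreover have "t < R\<^sup>2 * exp (- 2 / \<kappa>)" using False R by (smt (verit) exp_gt_zero mult_pos_pos zero_less_power)
  ultimately show ?thesis
    by (elim has_field_derivative_transform_within_open[where S = "{..<R\<^sup>2 * exp (- 2 / \<kappa>)}"])
       (simp_all add: cut_zero[OF R])
qed

lemma vderiv_cut:
  fixes f :: "'a::euclidean_space \<Rightarrow> real"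
  assumes R: "R > 0" "\<kappa> > 0" and f: "f differentiable (at x)"
  shows "vderiv A (\<lambda>x. f x * log_cut R \<kappa> i j (x \<bullet> x)) x = vderiv A f x * log_cut R \<kappa> i j (x \<bullet> x) + 2 * (x \<bullet> A x) * (f x *
     (\<kappa> * log_cut R \<kappa> (i + 2) (j + 1) (x \<bullet> x) - real i * \<kappa> * log_cut R \<kappa> (i + 1) (j + 1) (x \<bullet> x) - real j * log_cut R \<kappa> i (j + 1) (x \<bullet> x)))"
    and "(\<lambda>x. f x * log_cut R \<kappa> i j (x \<bullet> x)) differentiable (at x)"
proof -
  have c: "(\<lambda>x. log_cut R \<kappa> i j (x \<bullet> x)) differentiable (at x)"
    using has_derivative_radial_sq[OF cut_has_derivative[OF R]] differentiable_def by blast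
  then show "(\<lambda>x. f x * log_cut R \<kappa> i j (x \<bullet> x)) differentiable (at x)" using f by simp
  show "vderiv A (\<lambda>x. f x * log_cut R \<kappa> i j (x \<bullet> x)) x = vderiv A f x * log_cut R \<kappa> i j (x \<bullet> x) + 2 * (x \<bullet> A x) * (f x *
     (\<kappa> * log_cut R \<kappa> (i + 2) (j + 1) (x \<bullet> x) - real i * \<kappa> * log_cut R \<kappa> (i + 1) (j + 1) (x \<bullet> x) - real j * log_cut R \<kappa> i (j + 1) (x \<bullet> x)))"
    unfolding vderiv_mult[OF f c] vderiv_radial_sq[OF cut_has_derivative[OF R]] by (simp add: algebra_simps)
qed

lemma Ck_cut:
  fixes f :: "'a::euclidean_space \<Rightarrow> real"
  assumes R: "R > 0" "\<kappa> > 0" and f: "Ck k f"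
  shows "Ck k (\<lambda>x. f x * log_cut R \<kappa> i j (x \<bullet> x))"
  using f
proof (induction k arbitrary: f i j)
  case 0
  have "isCont (log_cut R \<kappa> i j) t" for t using DERIV_isCont[OF cut_has_derivative[OF R]] .
  then have "continuous_on UNIV (log_cut R \<kappa> i j)" by (simp add: continuous_on_eq_continuous_at)
  then have "continuous_on UNIV (\<lambda>x::'a. log_cut R \<kappa> i j (x \<bullet> x))"
    by (rule continuous_on_compose2) (auto intro!: continuous_intros)
  then show ?case using 0 by (auto intro!: continuous_intros)
next
  case (Suc k)
  have fd: "f differentiable (at x)" for x using Suc.prems by simp
  have f': "Ck k f" using Suc.prems Ck_SucD by blast
  show ?case
  proof (rule Ck_SucI)
    show "(\<lambda>x. f x * log_cut R \<kappa> i j (x \<bullet> x)) differentiable (at x)" for x by (rule vderiv_cut(2)[OF R fd])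
    fix l :: 'a assume l: "l \<in> Basis"
    have eq: "partial_deriv l (\<lambda>x. f x * log_cut R \<kappa> i j (x \<bullet> x)) = (\<lambda>x. partial_deriv l f x * log_cut R \<kappa> i j (x \<bullet> x)
       + (\<kappa> * (((2 * (x \<bullet> l)) * f x) * log_cut R \<kappa> (i + 2) (j + 1) (x \<bullet> x))
       + ((- real i * \<kappa>) * (((2 * (x \<bullet> l)) * f x) * log_cut R \<kappa> (i + 1) (j + 1) (x \<bullet> x)) +
          (- real j) * (((2 * (x \<bullet> l)) * f x) * log_cut R \<kappa> i (j + 1) (x \<bullet> x)))))"
      using vderiv_cut(1)[OF R fd, of "\<lambda>_. l" i j] by (simp add: fun_eq_iff vderiv_def partial_deriv_def algebra_simps)
    have g: "Ck k (\<lambda>x. (2 * (x \<bullet> l)) * f x)"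
      by (intro Ck_mult f' Ck_const Ck_linear[OF bounded_linear_inner_left])
    have f1: "Ck k (partial_deriv l f)" by (rule Ck_partial_deriv[OF Suc.prems l])
    show "Ck k (partial_deriv l (\<lambda>x. f x * log_cut R \<kappa> i j (x \<bullet> x)))"
      unfolding eq by (intro Ck_add Ck_mult[OF Ck_const] Suc.IH[OF g] Suc.IH[OF f1])
  qed
qed

text \<open>The cutoff depends on kappa ln (x \<bullet> x), so each Euler derivative that falls on
  it costs a factor kappa and leaves no power of |x| behind, since \<open>log_cut_Suc\<close>
  absorbs it. Small kappa therefore means small energy even at the critical exponent.\<close>

lemma euler_cut:
  fixes f :: "'a::euclidean_space \<Rightarrow> real"
  assumes R: "R > 0" "\<kappa> > 0" and f: "f differentiable (at x)"
  shows "euler (\<lambda>x. f x * log_cut R \<kappa> i 0 (x \<bullet> x)) x = euler f x * log_cut R \<kappa> i 0 (x \<bullet> x)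
     + 2 * \<kappa> * (f x * log_cut R \<kappa> (i + 2) 0 (x \<bullet> x)) - 2 * real i * \<kappa> * (f x * log_cut R \<kappa> (i + 1) 0 (x \<bullet> x))"
  unfolding euler_def vderiv_cut(1)[OF R f] unfolding log_cut_Suc[where j = 0, symmetric] by (simp add: algebra_simps)

text \<open>Through \<open>laplacian_polar\<close>: the radial cutoff commutes with rotations, so
  only the Euler part produces errors, and all of them carry a factor kappa.\<close>

lemma laplacian_cut:
  fixes f :: "'a::euclidean_space \<Rightarrow> real"
  assumes R: "R > 0" "\<kappa> > 0" and f: "Ck 2 f"
  shows "(x \<bullet> x) * laplacian (\<lambda>x. f x * log_cut R \<kappa> 0 0 (x \<bullet> x)) x = (x \<bullet> x) * laplacian f x * log_cut R \<kappa> 0 0 (x \<bullet> x)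
     + (4 * \<kappa> * euler f x * log_cut R \<kappa> 2 0 (x \<bullet> x) + 4 * \<kappa>\<^sup>2 * f x * log_cut R \<kappa> 4 0 (x \<bullet> x) - 8 * \<kappa>\<^sup>2 * f x * log_cut R \<kappa> 3 0 (x \<bullet> x)
     + (real DIM('a) - 2) * (2 * \<kappa> * f x * log_cut R \<kappa> 2 0 (x \<bullet> x)))"
proof -
  let ?c = "\<lambda>i x. log_cut R \<kappa> i 0 (x \<bullet> x)"
  have f2: "Ck (Suc (Suc 0)) f" and f1: "Ck (Suc 0) f" using f Ck_le[of "Suc 0" 2 f] by (simp_all add: numeral_2_eq_2)
  have fd: "f differentiable (at x)" for x using Ck_Suc_differentiable[OF f1] .
  have ef: "Ck (Suc 0) (euler f)" unfolding euler_def by (rule Ck_vderiv[OF bounded_linear_ident f2])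
  have efd: "euler f differentiable (at x)" for x using Ck_Suc_differentiable[OF ef] .
  have rfd: "vderiv (rot i j) f differentiable (at x)" for i j x
    by (rule Ck_Suc_differentiable[OF Ck_vderiv[OF bounded_linear_rot f2]])
  have e1: "euler (\<lambda>x. f x * ?c 0 x) = (\<lambda>x. euler f x * ?c 0 x + (2 * \<kappa>) * (f x * ?c 2 x))"
    by (rule ext, subst euler_cut[OF R fd]) (simp add: numeral_2_eq_2)
  have d: "(\<lambda>x. euler f x * ?c 0 x) differentiable (at x)" "(\<lambda>x. f x * ?c 2 x) differentiable (at x)"
    "(\<lambda>x. (2 * \<kappa>) * (f x * ?c 2 x)) differentiable (at x)" for x
    using vderiv_cut(2)[OF R efd, of 0 0] vderiv_cut(2)[OF R fd, of 2 0] by auto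
  have "euler (euler (\<lambda>x. f x * ?c 0 x)) x = euler (\<lambda>x. euler f x * ?c 0 x) x + (2 * \<kappa>) * euler (\<lambda>x. f x * ?c 2 x) x"
    unfolding e1 euler_add[OF d(1,3)] euler_cmult[OF d(2)] ..
  also have "\<dots> = euler (euler f) x * ?c 0 x + 2 * \<kappa> * (euler f x * ?c 2 x) + 2 * \<kappa> * (euler f x * ?c 2 x
      + 2 * \<kappa> * (f x * ?c 4 x) - 4 * \<kappa> * (f x * ?c 3 x))"
    using euler_cut[OF R efd, where i = 0 and x = x] euler_cut[OF R fd, where i = 2 and x = x] by (simp add: numeral_eq_Suc)
  finally have e2: "euler (euler (\<lambda>x. f x * ?c 0 x)) x = \<dots>" .
  have r: "vderiv (rot i j) (\<lambda>x. g x * ?c 0 x) x = vderiv (rot i j) g x * ?c 0 x"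
    if "g differentiable (at x)" for g i j and x :: 'a
    unfolding vderiv_cut(1)[OF R that] by (simp add: inner_commute[of x "rot i j x"] rot_inner)
  have L: "sphere_lap (\<lambda>x. f x * ?c 0 x) x = sphere_lap f x * ?c 0 x"
    unfolding sphere_lap_def by (simp add: r[OF fd, abs_def] r[OF rfd] sum_distrib_right)
  show ?thesis
    unfolding laplacian_polar[OF Ck_cut[OF R f]] e2 L laplacian_polar[OF f]
    by (simp add: e1 algebra_simps power2_eq_square)
qed

lemma smooth_ann_cut:
  assumes R: "R > 0" "\<kappa> > 0" and f: "f \<in> Cc_inf_ball R"
  shows "smooth_ann R (\<lambda>x. f x * log_cut R \<kappa> 0 0 (x \<bullet> x))"
proof -
  have fk: "Ck k f" for k using f by (auto simp: Cc_inf_ball_def)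
  have cp: "compact (closure {x. f x \<noteq> 0})" and cl: "closure {x. f x \<noteq> 0} \<subseteq> ball 0 R"
    using f by (auto simp: Cc_inf_ball_def)
  obtain q where q: "q < R" "\<And>x. f x \<noteq> 0 \<Longrightarrow> norm x \<le> q"
  proof (cases "closure {x. f x \<noteq> 0} = {}")
    case True
    then have "f x = 0" for x using closure_subset[of "{x. f x \<noteq> 0}"] by auto
    then show ?thesis using that[of 0] R by auto
  next
    case False
    from continuous_attains_sup[OF cp False continuous_on_norm_id]
    obtain y where y: "y \<in> closure {x. f x \<noteq> 0}" "\<forall>x\<in>closure {x. f x \<noteq> 0}. norm x \<le> norm y" by auto
    show ?thesis
      using that[of "norm y"] y cl closure_subset[of "{x. f x \<noteq> 0}"] by fastforce
  qed
  \<comment> \<open>The radius at which the argument 2 + kappa ln (|x|^2 / R^2) of the cutoff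
    vanishes.\<close>
  define p where "p = sqrt (R\<^sup>2 * exp (- 2 / \<kappa>))"
  have p: "p > 0" using R by (simp add: p_def)
  have "p \<le> norm x" if "f x * log_cut R \<kappa> 0 0 (x \<bullet> x) \<noteq> 0" for x
  proof -
    have "R\<^sup>2 * exp (- 2 / \<kappa>) \<le> x \<bullet> x" using cut_zero[OF R, of "x \<bullet> x" 0 0] that by force
    then show ?thesis unfolding p_def norm_eq_sqrt_inner by simp
  qed
  then have "annular R (\<lambda>x. f x * log_cut R \<kappa> 0 0 (x \<bullet> x))"
    unfolding annular_def using p q by (metis mult_zero_left)
  then show ?thesis unfolding smooth_ann_def Ck_ann_def using Ck_cut[OF R fk] by blast
qed

section \<open>The exponent of a Bessel potential\<close>

lemma DERIV_antimono:
  fixes g :: "real \<Rightarrow> real"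
  assumes "\<And>r. 0 < r \<Longrightarrow> r < R \<Longrightarrow> (g has_real_derivative g' r) (at r)"
    and "\<And>r. 0 < r \<Longrightarrow> r < R \<Longrightarrow> g' r \<le> 0" and "0 < a" "a \<le> b" "b < R"
  shows "g b \<le> g a"
proof (rule DERIV_nonpos_imp_nonincreasing[OF \<open>a \<le> b\<close>])
  fix x assume "a \<le> x" "x \<le> b"
  then show "\<exists>y. DERIV g x :> y \<and> y \<le> 0" using assms(1,2)[of x] assms(3,5) by auto
qed

text \<open>If \<open>lam > 2\<close>, then \<open>r\<^sup>2 W\<close> is bounded below near \<open>0\<close>, and in the variable \<open>ln r\<close> a positive solution
  would be concave on a half line with a second derivative bounded away from \<open>0\<close>.\<close>

lemma bessel_exponent_le_2:
  fixes W W' f :: "real \<Rightarrow> real"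
  assumes R: "R > 0" and sol: "bessel_positive_solution W R c" "c > 0"
    and W: "\<And>r. 0 < r \<Longrightarrow> r < R \<Longrightarrow> (W has_real_derivative W' r) (at r)"
    and pos: "\<And>r. 0 < r \<Longrightarrow> r < R \<Longrightarrow> W r > 0"
    and W': "\<And>r. 0 < r \<Longrightarrow> r < R \<Longrightarrow> W' r = W r * (- (lam / r) + f r)"
    and f: "((\<lambda>r. r * f r) \<longlongrightarrow> 0) (at_right 0)"
  shows "lam \<le> 2"
proof (rule ccontr)
  assume "\<not> lam \<le> 2"
  then have lam: "lam - 2 > 0" by simp
  from sol obtain y y' y'' where all: "\<forall>r\<in>{0<..<R}. y r > 0 \<and> (y has_real_derivative y' r) (at r) \<and>
        (y' has_real_derivative y'' r) (at r) \<and> y'' r + 1 / r * y' r + c * W r * y r = 0"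
    unfolding bessel_positive_solution_def by (elim exE)
  then have y: "y r > 0" and y': "(y has_real_derivative y' r) (at r)"
    and y'': "(y' has_real_derivative y'' r) (at r)" and eq: "y'' r + 1 / r * y' r + c * W r * y r = 0"
    if "0 < r" "r < R" for r
    using that by simp_all
  have "\<forall>\<^sub>F r in at_right 0. r * f r < lam - 2" using f lam by (rule order_tendstoD(2))
  then obtain r0 where r0: "r0 > 0" "\<And>r. 0 < r \<Longrightarrow> r < r0 \<Longrightarrow> r * f r < lam - 2"
    unfolding eventually_at_right_field by blast
  define S where "S = min R r0"
  have S: "0 < S" "S \<le> R" using R r0 by (auto simp: S_def)
  define \<rho> where "\<rho> = S / 2"
  have \<rho>: "0 < \<rho>" "\<rho> < S" "\<rho> < R" using S by (auto simp: \<rho>_def)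
  define P where "P = (\<lambda>r. r\<^sup>2 * W r)"
  have Pd: "(P has_real_derivative r * W r * (2 - lam + r * f r)) (at r)" if "0 < r" "r < S" for r
  proof -
    have r: "0 < r" "r < R" using that S by auto
    have "(P has_real_derivative 2 * r * W r + r\<^sup>2 * W' r) (at r)"
      unfolding P_def using W[OF r] by (auto intro!: derivative_eq_intros)
    then show ?thesis
      by (rule DERIV_cong) (use r in \<open>simp add: W'[OF r] field_simps power2_eq_square\<close>)
  qed
  define k where "k = P \<rho>"
  have k: "k > 0" using pos[of \<rho>] \<rho> by (simp add: k_def P_def)
  have Pk: "P r \<ge> k" if "0 < r" "r \<le> \<rho>" for r
    unfolding k_def
  proof (rule DERIV_antimono[where R = S, OF Pd])
    fix r assume "0 < r" "r < S"
    then show "r * W r * (2 - lam + r * f r) \<le> 0"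
      using r0(2)[of r] pos[of r] S by (intro mult_nonneg_nonpos) (auto simp: S_def)
  qed (use that \<rho> in auto)
  define h where "h = (\<lambda>r. r * y' r)"
  have hd: "(h has_real_derivative - (c * r * W r * y r)) (at r)" if "0 < r" "r < R" for r
  proof -
    have "(h has_real_derivative y' r + r * y'' r) (at r)"
      unfolding h_def using y''[OF that] by (auto intro!: derivative_eq_intros)
    moreover have "y'' r = - (1 / r * y' r) - c * W r * y r" using eq[OF that] by simp
    then have "y' r + r * y'' r = - (c * r * W r * y r)" using that by (simp add: field_simps)
    ultimately show ?thesis by simp
  qed
  have hanti: "h b \<le> h a" if "0 < a" "a \<le> b" "b < R" for a b
    by (rule DERIV_antimono[where R = R, OF hd]) (use that sol(2) pos y in \<open>auto simp: less_imp_le\<close>)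
  have h0: "h s \<le> 0" if s: "0 < s" "s < R" for s
  proof (rule ccontr)
    assume "\<not> h s \<le> 0"
    then have h: "h s > 0" by simp
    \<comment> \<open>If h s > 0, then y' x >= h s / x for x below s, so y r <= y s + h s (ln r - ln
      s). This r makes the bound 0, against y > 0.\<close>
    define r where "r = s * exp (- y s / h s)"
    have r: "0 < r" "r \<le> s" using s h y[OF s] by (simp_all add: r_def)
    let ?z = "\<lambda>r. h s * ln r - y r"
    have "?z s \<le> ?z r"
    proof (rule DERIV_nonpos_imp_nonincreasing[OF r(2)])
      fix x assume x: "r \<le> x" "x \<le> s"
      have "(?z has_real_derivative h s * (1 / x) - y' x) (at x)"
        using x r s y'[of x] by (auto intro!: derivative_eq_intros)
      moreover have "h s \<le> x * y' x" using hanti[of x s] x r s by (simp add: h_def)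
      then have "h s * (1 / x) - y' x \<le> 0" using x r by (simp add: field_simps)
      ultimately show "\<exists>y. DERIV ?z x :> y \<and> y \<le> 0" by blast
    qed
    then have "y r \<le> y s + h s * (ln r - ln s)" by (simp add: algebra_simps)
    also have "ln r - ln s = - y s / h s" using s by (simp add: r_def ln_mult)
    finally show False using h y[of r] r s by simp
  qed
  have y'0: "y' r \<le> 0" if "0 < r" "r < R" for r
    using h0[OF that] that by (simp add: h_def mult_le_0_iff)
  define Y where "Y = y \<rho>"
  have Y: "Y > 0" using y \<rho> by (simp add: Y_def)
  have yY: "y r \<ge> Y" if "0 < r" "r \<le> \<rho>" for r
    unfolding Y_def by (rule DERIV_antimono[where R = R, OF y' y'0]) (use that \<rho> in auto)
  define d where "d = c * k * Y"
  have d: "d > 0" using sol(2) k Y by (simp add: d_def)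
  \<comment> \<open>Chosen such that d (ln \<rho> - ln r) = 1 + |h \<rho>|, which forces h r >= 1
    and contradicts \<open>h0\<close>.\<close>
  define r where "r = \<rho> * exp (- ((1 + \<bar>h \<rho>\<bar>) / d))"
  have r: "0 < r" "r \<le> \<rho>" using d \<rho> by (simp_all add: r_def)
  let ?q = "\<lambda>r. h r + d * ln r"
  have "?q \<rho> \<le> ?q r"
  proof (rule DERIV_nonpos_imp_nonincreasing[OF r(2)])
    fix x assume x: "r \<le> x" "x \<le> \<rho>"
    then have x': "0 < x" "x < R" "x \<le> \<rho>" using r \<rho> by auto
    have "(?q has_real_derivative - (c * x * W x * y x) + d * (1 / x)) (at x)"
      using x' hd[of x] by (auto intro!: derivative_eq_intros)
    moreover have "k * Y \<le> P x * y x" using Pk[of x] yY[of x] x' k Y by (intro mult_mono) auto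
    then have "d \<le> c * (x\<^sup>2 * W x * y x)" using sol(2) by (simp add: d_def P_def mult.assoc)
    then have "- (c * x * W x * y x) + d * (1 / x) \<le> 0" using x' by (simp add: field_simps power2_eq_square)
    ultimately show "\<exists>y. DERIV ?q x :> y \<and> y \<le> 0" by blast
  qed
  then have "h r \<ge> h \<rho> + d * (ln \<rho> - ln r)" by (simp add: algebra_simps)
  also have "ln \<rho> - ln r = (1 + \<bar>h \<rho>\<bar>) / d" using \<rho> by (simp add: r_def ln_mult)
  finally have "h r > 0" using d by simp
  then show False using h0[of r] r \<rho> by auto
qed

section \<open>Estimates for the cutoff error\<close>

lemma nn_integral_shell:
  assumes "\<rho> > 0"
  shows "(\<integral>\<^sup>+x. ennreal (norm (x::'a::euclidean_space) powr - real DIM('a)) * indicator {x. \<rho> < norm x \<and> norm x \<le> 2 * \<rho>} x \<partial>lborel)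
    \<le> ennreal (2 ^ DIM('a) * unit_ball_vol (real DIM('a)))"
proof -
  have "(\<integral>\<^sup>+x. ennreal (norm (x::'a) powr - real DIM('a)) * indicator {x. \<rho> < norm x \<and> norm x \<le> 2 * \<rho>} x \<partial>lborel)
    \<le> (\<integral>\<^sup>+x. ennreal (\<rho> powr - real DIM('a)) * indicator (cball (0::'a) (2 * \<rho>)) x \<partial>lborel)"
    using assms by (intro nn_integral_mono) (auto simp: indicator_def intro!: powr_mono2')
  also have "\<dots> = ennreal (\<rho> powr - real DIM('a)) * ennreal (unit_ball_vol (real DIM('a)) * (2 * \<rho>) ^ DIM('a))"
    using assms by (subst nn_integral_cmult_indicator) (auto simp: emeasure_cball)
  also have "\<dots> = ennreal (2 ^ DIM('a) * unit_ball_vol (real DIM('a)))"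
    using assms by (simp add: ennreal_mult[symmetric] powr_minus powr_realpow power_mult_distrib field_simps)
  finally show ?thesis .
qed

text \<open>The measure |x|^(-n) dx is invariant under dilations, so each dyadic shell costs the
  same constant. The resulting linear growth in N is what kappa^2, of order 1 / N^2, has to
  beat.\<close>

lemma nn_integral_shells:
  assumes R: "R > 0"
  shows "(\<integral>\<^sup>+x. ennreal (norm (x::'a::euclidean_space) powr - real DIM('a)) * indicator {x. R / 2 ^ N < norm x \<and> norm x \<le> R} x \<partial>lborel)
    \<le> ennreal (real N * (2 ^ DIM('a) * unit_ball_vol (real DIM('a))))"
proof (induction N)
  case 0
  have "indicator {x::'a. R / 2 ^ 0 < norm x \<and> norm x \<le> R} = (\<lambda>x. 0 :: ennreal)"
    by (auto simp: indicator_def fun_eq_iff)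
  then show ?case by simp
next
  case (Suc N)
  let ?g = "\<lambda>x::'a. ennreal (norm x powr - real DIM('a))"
  let ?A = "\<lambda>N. {x::'a. R / 2 ^ N < norm x \<and> norm x \<le> R}"
  let ?B = "{x::'a. R / 2 ^ Suc N < norm x \<and> norm x \<le> 2 * (R / 2 ^ Suc N)}"
  have "(\<integral>\<^sup>+x. ?g x * indicator (?A (Suc N)) x \<partial>lborel) \<le> (\<integral>\<^sup>+x. ?g x * indicator (?A N) x + ?g x * indicator ?B x \<partial>lborel)"
    by (intro nn_integral_mono) (auto simp: indicator_def)
  also have "\<dots> = (\<integral>\<^sup>+x. ?g x * indicator (?A N) x \<partial>lborel) + (\<integral>\<^sup>+x. ?g x * indicator ?B x \<partial>lborel)"
    by (rule nn_integral_add) measurable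
  also have "\<dots> \<le> ennreal (real N * (2 ^ DIM('a) * unit_ball_vol (real DIM('a)))) + ennreal (2 ^ DIM('a) * unit_ball_vol (real DIM('a)))"
    using R by (intro add_mono Suc.IH nn_integral_shell) simp
  also have "\<dots> = ennreal (real (Suc N) * (2 ^ DIM('a) * unit_ball_vol (real DIM('a))))"
    by (subst ennreal_plus[symmetric]) (auto simp: algebra_simps)
  finally show ?case .
qed

lemma continuous_on_punctured_measurable:
  fixes f :: "'a::euclidean_space \<Rightarrow> real"
  assumes "continuous_on S f" "S \<in> sets borel"
  shows "(\<lambda>x. ennreal (f x) * indicator S x) \<in> borel_measurable lborel"
proof -
  have "(\<lambda>x. indicator S x *\<^sub>R f x) \<in> borel_measurable borel"
    using borel_measurable_continuous_on_indicator[OF assms(2,1)] .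
  then have "(\<lambda>x. ennreal (indicator S x *\<^sub>R f x)) \<in> borel_measurable lborel" by measurable
  moreover have "(\<lambda>x. ennreal (indicator S x *\<^sub>R f x)) = (\<lambda>x. ennreal (f x) * indicator S x)"
    by (auto simp: indicator_def fun_eq_iff)
  ultimately show ?thesis by simp
qed

lemma nn_integral_punctured_ball:
  "(\<integral>\<^sup>+x\<in>ball (0::'a::euclidean_space) R. g x \<partial>lborel) = (\<integral>\<^sup>+x\<in>ball 0 R - {0}. g x \<partial>lborel)"
proof (rule nn_integral_cong_AE)
  have "AE x in lborel. x \<noteq> (0::'a)" by (rule AE_lborel_singleton)
  then show "AE x in lborel. g x * indicator (ball (0::'a) R) x = g x * indicator (ball 0 R - {0}) x"
    by eventually_elim (auto simp: indicator_def)
qed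

lemma log_cut_bound:
  assumes R: "R > 0" "\<kappa> > 0" and x: "x \<noteq> 0" "norm x < R"
  shows "log_cut R \<kappa> i 0 (x \<bullet> x) \<le> fact (Suc i) * 2" "log_cut R \<kappa> i 0 (x \<bullet> x) \<ge> 0"
    "log_cut R \<kappa> 0 0 (x \<bullet> x) \<le> exp (- 1 / 2)"
proof -
  let ?L = "2 + \<kappa> * ln ((x \<bullet> x) / R\<^sup>2)"
  have "x \<bullet> x < R\<^sup>2" using x R by (simp add: dot_square_norm power_strict_mono)
  then have "ln ((x \<bullet> x) / R\<^sup>2) \<le> 0" using x R by simp
  then have L: "?L \<le> 2" using R by (simp add: mult_nonneg_nonpos)
  have c: "log_cut R \<kappa> i 0 (x \<bullet> x) = flat_exp i ?L" for i using x by (simp add: log_cut_def)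
  show "log_cut R \<kappa> i 0 (x \<bullet> x) \<ge> 0" by (simp add: c flat_exp_nonneg)
  show "log_cut R \<kappa> i 0 (x \<bullet> x) \<le> fact (Suc i) * 2"
  proof (cases "?L > 0")
    case True
    have "flat_exp i ?L \<le> fact (Suc i) * \<bar>?L\<bar>" by (rule flat_exp_le)
    also have "\<dots> \<le> fact (Suc i) * 2" using L True by (intro mult_left_mono) auto
    finally show ?thesis by (simp add: c)
  next
    case False
    then show ?thesis unfolding c by (simp add: flat_exp_def)
  qed
  show "log_cut R \<kappa> 0 0 (x \<bullet> x) \<le> exp (- 1 / 2)"
    using flat_exp_0_mono[OF L] unfolding c by (simp add: flat_exp_def)
qed

text \<open>\<open>log_cut_bound\<close> for i = 2, 3, 4 gives 12, 48 and 240, and kappa <= 2 turns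
  kappa^2 into 2 kappa. Then 2736 = 4 * 12 + 8 * 240 + 16 * 48, and 24 = 2 * 12 stems from the
  first-order term with n - 2.\<close>

lemma cut_error:
  fixes f :: "'a::euclidean_space \<Rightarrow> real"
  assumes R: "R > 0" "\<kappa> > 0" "\<kappa> \<le> 2" and f: "Ck 2 f" and V: "\<bar>f x\<bar> \<le> V" "\<bar>euler f x\<bar> \<le> V"
    and x: "x \<noteq> 0" "norm x < R"
  shows "\<bar>(x \<bullet> x) * (laplacian (\<lambda>x. f x * log_cut R \<kappa> 0 0 (x \<bullet> x)) x - laplacian f x * log_cut R \<kappa> 0 0 (x \<bullet> x))\<bar> \<le>
    \<kappa> * (V * (2736 + 24 * \<bar>real DIM('a) - 2\<bar>))"
proof -
  let ?b = "\<lambda>i. log_cut R \<kappa> i 0 (x \<bullet> x)"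
  have V0: "V \<ge> 0" using V by simp
  have b: "0 \<le> ?b 2" "?b 2 \<le> 12" "0 \<le> ?b 3" "?b 3 \<le> 48" "0 \<le> ?b 4" "?b 4 \<le> 240"
    using log_cut_bound(1,2)[OF R(1,2) x, of 2] log_cut_bound(1,2)[OF R(1,2) x, of 3] log_cut_bound(1,2)[OF R(1,2) x, of 4]
    by (simp_all add: fact_numeral)
  have k2: "\<kappa>\<^sup>2 \<le> 2 * \<kappa>" using R by (simp add: power2_eq_square)
  have fb: "\<bar>f x * ?b i\<bar> \<le> V * t" if "0 \<le> ?b i" "?b i \<le> t" for i t
    unfolding abs_mult using V V0 that by (intro mult_mono) auto
  have eb: "\<bar>euler f x * ?b i\<bar> \<le> V * t" if "0 \<le> ?b i" "?b i \<le> t" for i t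
    unfolding abs_mult using V V0 that by (intro mult_mono) auto
  have t1: "\<bar>4 * \<kappa> * euler f x * ?b 2\<bar> \<le> 4 * \<kappa> * (V * 12)"
    using mult_left_mono[OF eb[OF b(1,2)], of "4 * \<kappa>"] R by (simp add: abs_mult mult.assoc)
  have t2: "\<bar>4 * \<kappa>\<^sup>2 * f x * ?b 4\<bar> \<le> 8 * \<kappa> * (V * 240)"
  proof -
    have "\<bar>4 * \<kappa>\<^sup>2 * f x * ?b 4\<bar> = 4 * \<kappa>\<^sup>2 * \<bar>f x * ?b 4\<bar>" by (simp add: abs_mult)
    also have "\<dots> \<le> 8 * \<kappa> * (V * 240)" using k2 fb[OF b(5,6)] V0 R by (intro mult_mono[of "4 * \<kappa>\<^sup>2"]) auto
    finally show ?thesis .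
  qed
  have t3: "\<bar>8 * \<kappa>\<^sup>2 * f x * ?b 3\<bar> \<le> 16 * \<kappa> * (V * 48)"
  proof -
    have "\<bar>8 * \<kappa>\<^sup>2 * f x * ?b 3\<bar> = 8 * \<kappa>\<^sup>2 * \<bar>f x * ?b 3\<bar>" by (simp add: abs_mult)
    also have "\<dots> \<le> 16 * \<kappa> * (V * 48)" using k2 fb[OF b(3,4)] V0 R by (intro mult_mono[of "8 * \<kappa>\<^sup>2"]) auto
    finally show ?thesis .
  qed
  have t4: "\<bar>(real DIM('a) - 2) * (2 * \<kappa> * f x * ?b 2)\<bar> \<le> \<bar>real DIM('a) - 2\<bar> * (2 * \<kappa> * (V * 12))"
    unfolding abs_mult[of "real DIM('a) - 2"]
    using mult_left_mono[OF fb[OF b(1,2)], of "2 * \<kappa>"] R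
    by (intro mult_left_mono) (auto simp: abs_mult mult.assoc)
  have "(x \<bullet> x) * (laplacian (\<lambda>x. f x * log_cut R \<kappa> 0 0 (x \<bullet> x)) x - laplacian f x * log_cut R \<kappa> 0 0 (x \<bullet> x))
    = 4 * \<kappa> * euler f x * ?b 2 + 4 * \<kappa>\<^sup>2 * f x * ?b 4 - 8 * \<kappa>\<^sup>2 * f x * ?b 3 + (real DIM('a) - 2) * (2 * \<kappa> * f x * ?b 2)"
    using laplacian_cut[OF R(1,2) f, of x] by (simp add: algebra_simps)
  then have "\<bar>(x \<bullet> x) * (laplacian (\<lambda>x. f x * log_cut R \<kappa> 0 0 (x \<bullet> x)) x - laplacian f x * log_cut R \<kappa> 0 0 (x \<bullet> x))\<bar>
    \<le> 4 * \<kappa> * (V * 12) + 8 * \<kappa> * (V * 240) + 16 * \<kappa> * (V * 48) + \<bar>real DIM('a) - 2\<bar> * (2 * \<kappa> * (V * 12))"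
    using t1 t2 t3 t4 by linarith
  also have "\<dots> = \<kappa> * (V * (2736 + 24 * \<bar>real DIM('a) - 2\<bar>))" by (simp add: algebra_simps)
  finally show ?thesis .
qed

lemma young_square:
  fixes a b d :: real
  assumes "d > 0" shows "(a + b)\<^sup>2 \<le> (1 + 1 / d) * a\<^sup>2 + (1 + d) * b\<^sup>2"
proof -
  have "0 \<le> (a - d * b)\<^sup>2 / d" using assms by simp
  also have "\<dots> = a\<^sup>2 / d - 2 * a * b + d * b\<^sup>2" using assms by (simp add: power2_eq_square field_simps)
  finally show ?thesis by (simp add: power2_eq_square algebra_simps)
qed

lemma Ck_laplacian:
  assumes "Ck (Suc (Suc k)) f" shows "Ck k (laplacian f)"
proof -
  have "laplacian f = (\<lambda>x. \<Sum>i\<in>Basis. partial_deriv i (partial_deriv i f) x)"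
    by (rule ext) (simp add: laplacian_def)
  moreover have "Ck k \<dots>" by (intro Ck_sum Ck_partial_deriv assms)
  ultimately show ?thesis by simp
qed

text \<open>The two integrals on the left of the inequality are merged into one integrand,
  continuous off the origin, so that a single passage to the limit treats both.\<close>

lemma nn_integral_combination:
  fixes u :: "'a::euclidean_space \<Rightarrow> real" and B D p q :: real
  assumes R: "R > 0" and u: "continuous_on UNIV u" and W: "continuous_on {0<..<R} W"
    and pos: "\<And>r. 0 < r \<Longrightarrow> r < R \<Longrightarrow> W r \<ge> 0" and B: "B \<ge> 0" "D \<ge> 0"
  defines "g \<equiv> \<lambda>x. B * ((u x)\<^sup>2 / norm x powr p) + D * (W (norm x) * (u x)\<^sup>2 / norm x powr q)"
  shows "continuous_on (ball 0 R - {0}) g"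
    and "(\<integral>\<^sup>+x\<in>ball 0 R - {0}. ennreal (g x) \<partial>lborel) =
      ennreal B * (\<integral>\<^sup>+x\<in>ball 0 R. ennreal ((u x)\<^sup>2 / norm x powr p) \<partial>lborel) +
      ennreal D * (\<integral>\<^sup>+x\<in>ball 0 R. ennreal (W (norm x) * (u x)\<^sup>2 / norm x powr q) \<partial>lborel)"
proof -
  let ?S = "ball 0 R - {0::'a}"
  let ?g1 = "\<lambda>x. (u x)\<^sup>2 / norm x powr p" and ?g2 = "\<lambda>x. W (norm x) * (u x)\<^sup>2 / norm x powr q"
  have uc: "continuous_on S u" for S using u continuous_on_subset by blast
  have g1: "continuous_on ?S ?g1"
    by (intro continuous_intros uc) auto
  have g2: "continuous_on ?S ?g2"
    by (intro continuous_intros uc continuous_on_compose2[OF W]) auto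
  show "continuous_on ?S g" unfolding g_def by (intro continuous_intros g1 g2)
  have Sm: "?S \<in> sets borel" by simp
  note m = continuous_on_punctured_measurable[OF g1 Sm] continuous_on_punctured_measurable[OF g2 Sm]
  have p2: "?g2 x \<ge> 0" if "x \<in> ?S" for x using that pos[of "norm x"] by auto
  have "(\<integral>\<^sup>+x\<in>?S. ennreal (g x) \<partial>lborel) =
    (\<integral>\<^sup>+x. ennreal B * (ennreal (?g1 x) * indicator ?S x) + ennreal D * (ennreal (?g2 x) * indicator ?S x) \<partial>lborel)"
  proof (rule nn_integral_cong)
    fix x :: 'a
    show "ennreal (g x) * indicator ?S x = ennreal B * (ennreal (?g1 x) * indicator ?S x) + ennreal D * (ennreal (?g2 x) * indicator ?S x)"
    proof (cases "x \<in> ?S")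
      case True
      have "ennreal (g x) = ennreal (B * ?g1 x) + ennreal (D * ?g2 x)"
        unfolding g_def by (rule ennreal_plus) (intro mult_nonneg_nonneg B p2[OF True]; simp)+
      also have "ennreal (B * ?g1 x) = ennreal B * ennreal (?g1 x)" by (rule ennreal_mult) (simp_all add: B)
      also have "ennreal (D * ?g2 x) = ennreal D * ennreal (?g2 x)" by (rule ennreal_mult[OF B(2) p2[OF True]])
      finally show ?thesis using True by simp
    qed simp
  qed
  also have "\<dots> = ennreal B * (\<integral>\<^sup>+x\<in>?S. ennreal (?g1 x) \<partial>lborel) + ennreal D * (\<integral>\<^sup>+x\<in>?S. ennreal (?g2 x) \<partial>lborel)"
    using m by (simp add: nn_integral_add nn_integral_cmult)
  finally show "(\<integral>\<^sup>+x\<in>?S. ennreal (g x) \<partial>lborel) =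
      ennreal B * (\<integral>\<^sup>+x\<in>ball 0 R. ennreal (?g1 x) \<partial>lborel) + ennreal D * (\<integral>\<^sup>+x\<in>ball 0 R. ennreal (?g2 x) \<partial>lborel)"
    unfolding nn_integral_punctured_ball .
qed

text \<open>With \<open>\<kappa> = 1 / (N ln 2)\<close> the argument \<open>2 + \<kappa> ln (|x|\<^sup>2 / R\<^sup>2)\<close> of the cutoff vanishes at
  \<open>|x| = R / 2\<^sup>N\<close>.\<close>

lemma log_cut_log_zero:
  fixes x :: "'a::euclidean_space"
  assumes R: "R > 0" and N: "N > 0" and x: "norm x \<le> R / 2 ^ Suc N"
  shows "log_cut R (1 / (real N * ln 2)) i j (x \<bullet> x) = 0"
proof (rule cut_zero)
  have "exp (- 2 / (1 / (real N * ln 2))) = inverse (exp (of_nat (2 * N) * ln 2))"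
    by (simp add: exp_minus[symmetric])
  also have "\<dots> = 1 / (2 ^ N)\<^sup>2" by (subst exp_of_nat_mult) (simp add: power_mult[symmetric] mult.commute divide_inverse)
  finally have e: "exp (- 2 / (1 / (real N * ln 2))) = 1 / (2 ^ N)\<^sup>2" .
  \<comment> \<open>\<open>cut_zero\<close> asks for a strict inequality, hence the exponent N + 1
    in the hypothesis.\<close>
  have "norm x < R / 2 ^ N"
  proof -
    have "R / 2 ^ Suc N < R / 2 ^ N" using R by (simp add: field_simps)
    with x show ?thesis by simp
  qed
  then have "(norm x)\<^sup>2 < (R / 2 ^ N)\<^sup>2" by (intro power_strict_mono) auto
  then show "x \<bullet> x < R\<^sup>2 * exp (- 2 / (1 / (real N * ln 2)))"
    unfolding e by (simp add: dot_square_norm power_divide)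
qed (use R N in auto)

text \<open>Young's inequality with parameter d separates the cut-off Laplacian of f from the
  commutator error. The error vanishes near the origin and is at most a multiple of kappa / |x|^2.
  Its weighted square is thus bounded by kappa^2 |x|^(-n) times |x|^(n - 4 - 2 mu), and 2 mu + 4 <=
  n bounds the last power by the one of R.\<close>

lemma cut_laplacian_pointwise:
  fixes f :: "'a::euclidean_space \<Rightarrow> real"
  assumes R: "R > 0" and N: "N > 0" and d: "d > 0" and f: "Ck 2 f"
    and V: "\<bar>f x\<bar> \<le> V" "\<bar>euler f x\<bar> \<le> V" and x: "x \<noteq> 0" "norm x < R"
    and mu: "2 * mu + 4 \<le> real DIM('a)"
  defines "\<kappa> \<equiv> 1 / (real N * ln 2)"
  defines "C \<equiv> (V * (2736 + 24 * \<bar>real DIM('a) - 2\<bar>))\<^sup>2 * R powr (real DIM('a) - 4 - 2 * mu)"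
  shows "(laplacian (\<lambda>x. f x * log_cut R \<kappa> 0 0 (x \<bullet> x)) x)\<^sup>2 / norm x powr (2 * mu) \<le>
    (1 + 1 / d) * (exp (- 1 / 2))\<^sup>2 * ((laplacian f x)\<^sup>2 / norm x powr (2 * mu)) +
    (1 + d) * (4 / (real N)\<^sup>2 * C) * (norm x powr - real DIM('a) * indicator {x. R / 2 ^ Suc N < norm x \<and> norm x \<le> R} x)"
proof -
  have l2: "ln 2 \<ge> (2/3 :: real)" by (rule ln2_ge_two_thirds)
  have \<kappa>: "\<kappa> > 0" using N by (simp add: \<kappa>_def)
  have Nl: "real N * ln 2 \<ge> 1 / 2"
  proof -
    have "1 * (1 / 2) \<le> real N * ln 2" using N l2 by (intro mult_mono) auto
    then show ?thesis by simp
  qed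
  have \<kappa>2: "\<kappa> \<le> 2" unfolding \<kappa>_def using Nl by (simp add: field_simps)
  have \<kappa>4: "\<kappa>\<^sup>2 \<le> 4 / (real N)\<^sup>2"
  proof -
    have "\<kappa> \<le> 2 / real N" using N l2 by (simp add: \<kappa>_def field_simps)
    then have "\<kappa>\<^sup>2 \<le> (2 / real N)\<^sup>2" using \<kappa> by (intro power_mono) auto
    then show ?thesis by (simp add: power_divide)
  qed
  let ?n = "real DIM('a)"
  let ?M = "V * (2736 + 24 * \<bar>?n - 2\<bar>)"
  let ?L = "laplacian (\<lambda>x. f x * log_cut R \<kappa> 0 0 (x \<bullet> x)) x"
  let ?a = "laplacian f x * log_cut R \<kappa> 0 0 (x \<bullet> x)"
  let ?ind = "indicator {x. R / 2 ^ Suc N < norm x \<and> norm x \<le> R} x :: real"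
  define b where "b = ?L - ?a"
  have nx: "norm x > 0" using x by simp
  have "?L\<^sup>2 \<le> (1 + 1 / d) * ?a\<^sup>2 + (1 + d) * b\<^sup>2"
    using young_square[OF d, of ?a b] by (simp add: b_def)
  then have 1: "?L\<^sup>2 / norm x powr (2 * mu) \<le> (1 + 1 / d) * (?a\<^sup>2 / norm x powr (2 * mu)) + (1 + d) * (b\<^sup>2 / norm x powr (2 * mu))"
    using nx by (simp add: divide_right_mono add_divide_distrib[symmetric])
  have lc: "0 \<le> log_cut R \<kappa> 0 0 (x \<bullet> x)" "log_cut R \<kappa> 0 0 (x \<bullet> x) \<le> exp (- 1 / 2)"
    using log_cut_bound(2,3)[OF R \<kappa> x] by auto
  have "?a\<^sup>2 \<le> (exp (- 1 / 2))\<^sup>2 * (laplacian f x)\<^sup>2"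
    unfolding power_mult_distrib mult.commute[of "(laplacian f x)\<^sup>2"]
    by (intro mult_right_mono power_mono lc) auto
  then have "?a\<^sup>2 / norm x powr (2 * mu) \<le> (exp (- 1 / 2))\<^sup>2 * (laplacian f x)\<^sup>2 / norm x powr (2 * mu)"
    using nx by (intro divide_right_mono) auto
  then have 2: "(1 + 1 / d) * (?a\<^sup>2 / norm x powr (2 * mu)) \<le> (1 + 1 / d) * (exp (- 1 / 2))\<^sup>2 * ((laplacian f x)\<^sup>2 / norm x powr (2 * mu))"
    unfolding mult.assoc using d by (intro mult_left_mono) auto
  have "b\<^sup>2 / norm x powr (2 * mu) \<le> 4 / (real N)\<^sup>2 * C * (norm x powr - ?n * ?ind)"
  proof (cases "norm x \<le> R / 2 ^ Suc N")
    case True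
    have z: "log_cut R \<kappa> i j (x \<bullet> x) = 0" for i j
      unfolding \<kappa>_def by (rule log_cut_log_zero[OF R N True])
    have "(x \<bullet> x) * ?L = 0" using laplacian_cut[OF R \<kappa> f, of x] by (simp add: z)
    then have "b = 0" using x by (simp add: b_def z)
    then show ?thesis using True by simp
  next
    case False
    then have ind: "?ind = 1" using x by (simp add: indicator_def)
    have "\<bar>(x \<bullet> x) * b\<bar> \<le> \<kappa> * ?M"
      unfolding b_def by (rule cut_error[OF R \<kappa> \<kappa>2 f V x])
    then have "\<bar>(x \<bullet> x) * b\<bar>\<^sup>2 \<le> (\<kappa> * ?M)\<^sup>2" by (intro power_mono) auto
    then have E: "((norm x)\<^sup>2 * b)\<^sup>2 \<le> \<kappa>\<^sup>2 * ?M\<^sup>2" by (simp add: dot_square_norm power_mult_distrib)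
    have e: "b\<^sup>2 / norm x powr (2 * mu) = ((norm x)\<^sup>2 * b)\<^sup>2 * norm x powr (?n - 4 - 2 * mu) * norm x powr - ?n"
    proof -
      have "norm x powr (?n - 4 - 2 * mu) * norm x powr - ?n = norm x powr (- 4 - 2 * mu)"
        by (simp add: powr_add[symmetric])
      also have "\<dots> = 1 / (norm x ^ 4 * norm x powr (2 * mu))"
        using nx powr_add[of "norm x" 4 "2 * mu"] powr_minus[of "norm x" "4 + 2 * mu"]
        by (simp add: divide_inverse)
      finally show ?thesis using nx by (simp add: power_mult_distrib mult.assoc)
    qed
    have "norm x powr (?n - 4 - 2 * mu) \<le> R powr (?n - 4 - 2 * mu)"
      using x mu by (intro powr_mono2) auto
    then have "((norm x)\<^sup>2 * b)\<^sup>2 * norm x powr (?n - 4 - 2 * mu) \<le> (\<kappa>\<^sup>2 * ?M\<^sup>2) * R powr (?n - 4 - 2 * mu)"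
      using E by (intro mult_mono) auto
    also have "\<dots> = \<kappa>\<^sup>2 * C" by (simp add: C_def)
    also have "\<dots> \<le> 4 / (real N)\<^sup>2 * C" using \<kappa>4 by (intro mult_right_mono) (auto simp: C_def)
    finally show ?thesis unfolding e ind mult_1_right by (rule mult_right_mono) simp
  qed
  then have 3: "(1 + d) * (b\<^sup>2 / norm x powr (2 * mu)) \<le> (1 + d) * (4 / (real N)\<^sup>2 * C) * (norm x powr - ?n * ?ind)"
    unfolding mult.assoc using d by (intro mult_left_mono) (auto simp: mult.assoc)
  show ?thesis using 1 2 3 by linarith
qed

text \<open>The parameters are N = m^2 and d = m. Young's factor 1 + 1 / m tends to 1, while the
  error (1 + m) (4 C / N^2) (N + 1) K is at most 16 C K / m.\<close>

lemma cut_laplacian_integral: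
  fixes f :: "'a::euclidean_space \<Rightarrow> real"
  assumes R: "R > 0" and f: "Ck 2 f" and mu: "2 * mu + 4 \<le> real DIM('a)"
  shows "\<exists>Q\<ge>0. \<forall>m>0. (\<integral>\<^sup>+x\<in>ball 0 R - {0}. ennreal ((laplacian (\<lambda>x. f x * log_cut R (1 / (real (m\<^sup>2) * ln 2)) 0 0 (x \<bullet> x)) x)\<^sup>2 / norm x powr (2 * mu)) \<partial>lborel)
    \<le> ennreal ((1 + 1 / real m) * (exp (- 1 / 2))\<^sup>2) * (\<integral>\<^sup>+x\<in>ball 0 R - {0}. ennreal ((laplacian f x)\<^sup>2 / norm x powr (2 * mu)) \<partial>lborel)
       + ennreal (Q / real m)"
proof -
  let ?S = "ball 0 R - {0::'a}"
  let ?n = "real DIM('a)"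
  have f2: "Ck (Suc (Suc 0)) f" using f by (simp add: numeral_2_eq_2)
  have ef: "Ck (Suc 0) (euler f)" unfolding euler_def by (rule Ck_vderiv[OF bounded_linear_ident f2])
  have "compact ((\<lambda>x. max \<bar>f x\<bar> \<bar>euler f x\<bar>) ` cball 0 R)"
    by (intro compact_continuous_image continuous_intros Ck_continuous_on[OF f] Ck_continuous_on[OF ef] compact_cball)
  then have "bounded ((\<lambda>x. max \<bar>f x\<bar> \<bar>euler f x\<bar>) ` cball 0 R)" by (rule compact_imp_bounded)
  then obtain V where V': "\<forall>y\<in>(\<lambda>x. max \<bar>f x\<bar> \<bar>euler f x\<bar>) ` cball 0 R. norm y \<le> V"
    unfolding bounded_iff by blast
  have V: "\<bar>f x\<bar> \<le> V" "\<bar>euler f x\<bar> \<le> V" if "norm x < R" for x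
  proof -
    have "norm (max \<bar>f x\<bar> \<bar>euler f x\<bar>) \<le> V" using that by (intro bspec[OF V'] imageI) auto
    then show "\<bar>f x\<bar> \<le> V" "\<bar>euler f x\<bar> \<le> V" by auto
  qed
  define C where "C = (V * (2736 + 24 * \<bar>?n - 2\<bar>))\<^sup>2 * R powr (?n - 4 - 2 * mu)"
  define K where "K = 2 ^ DIM('a) * unit_ball_vol ?n"
  have C: "C \<ge> 0" by (simp add: C_def)
  have K: "K \<ge> 0" by (simp add: K_def)
  let ?F = "\<lambda>x. (laplacian f x)\<^sup>2 / norm x powr (2 * mu)"
  have "continuous_on ?S ?F"
    by (intro continuous_intros Ck_continuous_on[OF Ck_laplacian[OF f2]]) auto
  then have Fm: "(\<lambda>x. ennreal (?F x) * indicator ?S x) \<in> borel_measurable lborel"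
    by (rule continuous_on_punctured_measurable) simp
  show ?thesis
  proof (intro exI[of _ "16 * C * K"] conjI allI impI)
    show "0 \<le> 16 * C * K" using C K by simp
    fix m :: nat assume m: "m > 0"
    define N where "N = m\<^sup>2"
    have N: "N > 0" using m by (simp add: N_def)
    let ?A = "{x::'a. R / 2 ^ Suc N < norm x \<and> norm x \<le> R}"
    let ?L = "\<lambda>x. (laplacian (\<lambda>x. f x * log_cut R (1 / (real N * ln 2)) 0 0 (x \<bullet> x)) x)\<^sup>2 / norm x powr (2 * mu)"
    define a where "a = (1 + 1 / real m) * (exp (- 1 / 2))\<^sup>2"
    define b where "b = (1 + real m) * (4 / (real N)\<^sup>2 * C)"
    have ab: "a \<ge> 0" "b \<ge> 0" using C by (simp_all add: a_def b_def)
    have "(\<integral>\<^sup>+x\<in>?S. ennreal (?L x) \<partial>lborel) \<le>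
        (\<integral>\<^sup>+x. ennreal a * (ennreal (?F x) * indicator ?S x) + ennreal b * (ennreal (norm x powr - ?n) * indicator ?A x) \<partial>lborel)"
    proof (rule nn_integral_mono)
      fix x :: 'a
      show "ennreal (?L x) * indicator ?S x \<le> ennreal a * (ennreal (?F x) * indicator ?S x) + ennreal b * (ennreal (norm x powr - ?n) * indicator ?A x)"
      proof (cases "x \<in> ?S")
        case True
        then have x: "x \<noteq> 0" "norm x < R" by auto
        have "?L x \<le> a * ?F x + b * (norm x powr - ?n * indicator ?A x)"
          unfolding a_def b_def C_def
          using cut_laplacian_pointwise[OF R N _ f V[OF x(2)] x mu, of "real m"] m V by simp
        then have "ennreal (?L x) \<le> ennreal (a * ?F x + b * (norm x powr - ?n * indicator ?A x))" by (rule ennreal_leI)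
        also have "\<dots> = ennreal a * ennreal (?F x) + ennreal b * ennreal (norm x powr - ?n * indicator ?A x)"
          using ab ennreal_mult[of a "?F x"] ennreal_mult[of b "norm x powr - ?n * indicator ?A x"] by (subst ennreal_plus) simp_all
        finally show ?thesis using True by (cases "x \<in> ?A") auto
      qed simp
    qed
    also have "\<dots> = ennreal a * (\<integral>\<^sup>+x\<in>?S. ennreal (?F x) \<partial>lborel) + ennreal b * (\<integral>\<^sup>+x. ennreal (norm x powr - ?n) * indicator ?A x \<partial>lborel)"
      using Fm by (subst nn_integral_add) (auto simp: nn_integral_cmult)
    also have "\<dots> \<le> ennreal a * (\<integral>\<^sup>+x\<in>?S. ennreal (?F x) \<partial>lborel) + ennreal b * ennreal (real (Suc N) * K)"
      unfolding K_def by (intro add_left_mono mult_left_mono nn_integral_shells R) auto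
    also have "ennreal b * ennreal (real (Suc N) * K) \<le> ennreal (16 * C * K / real m)"
    proof -
      have "b * (real (Suc N) * K) \<le> ((2 * real m) * (4 / (real N)\<^sup>2 * C)) * ((2 * real N) * K)"
        unfolding b_def using m N C K by (intro mult_mono) auto
      also have "\<dots> = 16 * C * K / real m"
        using m unfolding N_def by (simp add: field_simps power2_eq_square)
      finally show ?thesis using ab K by (simp add: ennreal_mult[symmetric] ennreal_leI)
    qed
    finally show "(\<integral>\<^sup>+x\<in>?S. ennreal ((laplacian (\<lambda>x. f x * log_cut R (1 / (real (m\<^sup>2) * ln 2)) 0 0 (x \<bullet> x)) x)\<^sup>2 / norm x powr (2 * mu)) \<partial>lborel)
      \<le> ennreal ((1 + 1 / real m) * (exp (- 1 / 2))\<^sup>2) * (\<integral>\<^sup>+x\<in>?S. ennreal (?F x) \<partial>lborel) + ennreal (16 * C * K / real m)"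
      by (simp add: N_def a_def add_left_mono)
  qed
qed

section \<open>The improved Hardy-Rellich inequality\<close>

lemma log_cut_limit:
  fixes x :: "'a::euclidean_space"
  assumes R: "R > 0" and x: "x \<noteq> 0" "norm x < R"
  shows "(\<lambda>m. log_cut R (1 / (real ((Suc m)\<^sup>2) * ln 2)) 0 0 (x \<bullet> x)) \<longlonglongrightarrow> exp (- 1 / 2)"
proof -
  have k: "(\<lambda>m. 1 / (real ((Suc m)\<^sup>2) * ln 2)) \<longlonglongrightarrow> 0"
  proof -
    have "(\<lambda>m. (inverse (real (Suc m)))\<^sup>2 * (1 / ln 2)) \<longlonglongrightarrow> 0\<^sup>2 * (1 / ln 2)"
      by (intro tendsto_intros LIMSEQ_inverse_real_of_nat)
    then show ?thesis by (simp add: power_inverse field_simps)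
  qed
  have "(\<lambda>m. flat_exp 0 (2 + 1 / (real ((Suc m)\<^sup>2) * ln 2) * ln ((x \<bullet> x) / R\<^sup>2))) \<longlonglongrightarrow> flat_exp 0 (2 + 0 * ln ((x \<bullet> x) / R\<^sup>2))"
    by (intro isCont_tendsto_compose[OF DERIV_isCont[OF flat_exp_has_derivative]] tendsto_intros k)
  then show ?thesis using x by (simp add: log_cut_def flat_exp_def)
qed

text \<open>Fatou's lemma on the left meets the explicit bound of
  \<open>cut_laplacian_integral\<close> on the right. Both limits carry the factor exp (- 1 / 2)^2,
  which cancels. An infinite right-hand side is settled beforehand, so the bounds are real numbers
  when the limit is taken.\<close>

lemma cut_limit:
  fixes f g :: "'a::euclidean_space \<Rightarrow> real"
  assumes R: "R > 0" and f: "Ck 2 f" and mu: "2 * mu + 4 \<le> real DIM('a)"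
    and g: "continuous_on (ball 0 R - {0}) g" "\<And>x. x \<noteq> 0 \<Longrightarrow> norm x < R \<Longrightarrow> g x \<ge> 0"
    and ineq: "\<And>\<kappa>. \<kappa> > 0 \<Longrightarrow> (\<integral>\<^sup>+x\<in>ball 0 R - {0}. ennreal ((log_cut R \<kappa> 0 0 (x \<bullet> x))\<^sup>2 * g x) \<partial>lborel) \<le>
      (\<integral>\<^sup>+x\<in>ball 0 R - {0}. ennreal ((laplacian (\<lambda>x. f x * log_cut R \<kappa> 0 0 (x \<bullet> x)) x)\<^sup>2 / norm x powr (2 * mu)) \<partial>lborel)"
  shows "(\<integral>\<^sup>+x\<in>ball 0 R - {0}. ennreal (g x) \<partial>lborel) \<le>
      (\<integral>\<^sup>+x\<in>ball 0 R - {0}. ennreal ((laplacian f x)\<^sup>2 / norm x powr (2 * mu)) \<partial>lborel)"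
proof -
  let ?S = "ball 0 R - {0::'a}"
  let ?A = "\<integral>\<^sup>+x\<in>?S. ennreal ((laplacian f x)\<^sup>2 / norm x powr (2 * mu)) \<partial>lborel"
  define \<theta> :: real where "\<theta> = (exp (- 1 / 2))\<^sup>2"
  have \<theta>: "\<theta> > 0" by (simp add: \<theta>_def)
  define k where "k = (\<lambda>m. 1 / (real ((Suc m)\<^sup>2) * ln 2))"
  have k: "k m > 0" for m by (simp add: k_def)
  define c where "c = (\<lambda>m x. (log_cut R (k m) 0 0 (x \<bullet> x))\<^sup>2 * g x)"
  obtain Q where Q: "Q \<ge> 0" "\<And>m. m > 0 \<Longrightarrow> (\<integral>\<^sup>+x\<in>?S. ennreal ((laplacian (\<lambda>x. f x * log_cut R (1 / (real (m\<^sup>2) * ln 2)) 0 0 (x \<bullet> x)) x)\<^sup>2 / norm x powr (2 * mu)) \<partial>lborel)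
    \<le> ennreal ((1 + 1 / real m) * \<theta>) * ?A + ennreal (Q / real m)"
    using cut_laplacian_integral[OF R f mu] unfolding \<theta>_def by blast
  have bound: "(\<integral>\<^sup>+x\<in>?S. ennreal (c m x) \<partial>lborel) \<le> ennreal ((1 + inverse (real (Suc m))) * \<theta>) * ?A + ennreal (Q * inverse (real (Suc m)))" for m
    using order_trans[OF ineq[OF k[of m], unfolded k_def] Q(2)[OF zero_less_Suc, of m]]
    unfolding c_def k_def by (simp add: divide_inverse)
  have "ennreal \<theta> * (\<integral>\<^sup>+x\<in>?S. ennreal (g x) \<partial>lborel) \<le> ennreal \<theta> * ?A"
  proof (cases "?A = top")
    case True
    then show ?thesis using \<theta> by (simp add: ennreal_mult_top)
  next
    case False
    then obtain a where a: "?A = ennreal a" "a \<ge> 0" by (cases ?A) auto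
    have lc: "continuous_on ?S (\<lambda>x. log_cut R \<kappa> 0 0 (x \<bullet> x))" if "\<kappa> > 0" for \<kappa>
      using Ck_continuous_on[OF Ck_cut[OF R that Ck_const[of 0 1]]] by simp
    have cc: "continuous_on ?S (c m)" for m
      unfolding c_def by (intro continuous_intros lc k g)
    have cm: "(\<lambda>x. ennreal (c m x) * indicator ?S x) \<in> borel_measurable lborel" for m
      by (rule continuous_on_punctured_measurable[OF cc]) simp
    have gm: "(\<lambda>x. ennreal (g x) * indicator ?S x) \<in> borel_measurable lborel"
      by (rule continuous_on_punctured_measurable[OF g(1)]) simp
    have lim: "(\<lambda>m. ennreal (c m x) * indicator ?S x) \<longlonglongrightarrow> ennreal (\<theta> * g x) * indicator ?S x" for x
    proof (cases "x \<in> ?S")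
      case True
      then have "(\<lambda>m. c m x) \<longlonglongrightarrow> \<theta> * g x"
        unfolding c_def \<theta>_def k_def by (intro tendsto_intros log_cut_limit R) auto
      then show ?thesis using True by (auto intro: tendsto_ennrealI)
    qed simp
    have "ennreal \<theta> * (\<integral>\<^sup>+x\<in>?S. ennreal (g x) \<partial>lborel) = (\<integral>\<^sup>+x. ennreal (\<theta> * g x) * indicator ?S x \<partial>lborel)"
      unfolding nn_integral_cmult[OF gm, symmetric]
      by (rule nn_integral_cong) (use g(2) \<theta> in \<open>auto simp: indicator_def ennreal_mult\<close>)
    also have "\<dots> = (\<integral>\<^sup>+x. liminf (\<lambda>m. ennreal (c m x) * indicator ?S x) \<partial>lborel)"
      by (intro nn_integral_cong) (rule lim_imp_Liminf[OF _ lim, symmetric], simp)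
    also have "\<dots> \<le> liminf (\<lambda>m. \<integral>\<^sup>+x. ennreal (c m x) * indicator ?S x \<partial>lborel)"
      by (rule nn_integral_liminf) (rule cm)
    also have "\<dots> \<le> liminf (\<lambda>m. ennreal ((1 + inverse (real (Suc m))) * \<theta> * a + Q * inverse (real (Suc m))))"
    proof (intro Liminf_mono always_eventually allI)
      fix m
      show "(\<integral>\<^sup>+x. ennreal (c m x) * indicator ?S x \<partial>lborel) \<le> ennreal ((1 + inverse (real (Suc m))) * \<theta> * a + Q * inverse (real (Suc m)))"
        using bound[of m] a(2) Q(1) \<theta> unfolding a(1) by (simp add: ennreal_mult[symmetric] ennreal_plus[symmetric] del: ennreal_plus)
    qed
    also have "\<dots> = ennreal ((1 + 0) * \<theta> * a + Q * 0)"
      by (intro lim_imp_Liminf tendsto_ennrealI tendsto_intros LIMSEQ_inverse_real_of_nat) simp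
    also have "\<dots> = ennreal \<theta> * ?A" using \<theta> a by (simp add: ennreal_mult)
    finally show ?thesis .
  qed
  then show ?thesis using \<theta> ennreal_mult_le_mult_iff[of "ennreal \<theta>"] by simp
qed

text \<open>The cut-off function u is annular, so it can be written as a power of |x| times an
  annular w, and the inequality for w translates back to u. \<open>cut_limit\<close> then removes
  the cutoff.\<close>

lemma hardy_rellich_real:
  fixes v :: "'a::euclidean_space \<Rightarrow> real" and W W' f :: "real \<Rightarrow> real"
  assumes R: "R > 0" and v: "v \<in> Cc_inf_ball R" and sol: "bessel_positive_solution W R c" "c > 0"
    and W: "\<And>r. 0 < r \<Longrightarrow> r < R \<Longrightarrow> (W has_real_derivative W' r) (at r)"
    and W': "continuous_on {0<..<R} W'"
    and pos: "\<And>r. 0 < r \<Longrightarrow> r < R \<Longrightarrow> W r > 0"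
    and W'_eq: "\<And>r. 0 < r \<Longrightarrow> r < R \<Longrightarrow> W' r = W r * (- (lam / r) + f r)"
    and f0: "\<And>r. 0 < r \<Longrightarrow> r < R \<Longrightarrow> f r \<ge> 0"
    and f: "((\<lambda>r. r * f r) \<longlongrightarrow> 0) (at_right 0)"
    and n: "n = real DIM('a)" and mu: "2 * mu + 4 \<le> n"
    and B: "B \<ge> 0" "ennreal B \<le> rellich_const TYPE('a) R mu"
  shows "ennreal B * (\<integral>\<^sup>+x\<in>ball 0 R. ennreal ((v x)\<^sup>2 / norm x powr (2 * mu + 4)) \<partial>lborel)
    + ennreal (c * ((n + 2 * mu)\<^sup>2 / 4 + (n - 2 * mu - lam - 2)\<^sup>2 / 4)) *
        (\<integral>\<^sup>+x\<in>ball 0 R. ennreal (W (norm x) * (v x)\<^sup>2 / norm x powr (2 * mu + 2)) \<partial>lborel)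
    \<le> (\<integral>\<^sup>+x\<in>ball 0 R. ennreal ((laplacian v x)\<^sup>2 / norm x powr (2 * mu)) \<partial>lborel)"
proof -
  define D where "D = c * ((n + 2 * mu)\<^sup>2 / 4 + (n - 2 * mu - lam - 2)\<^sup>2 / 4)"
  have D: "D \<ge> 0" using sol(2) by (simp add: D_def)
  have lam: "lam \<le> 2" by (rule bessel_exponent_le_2[OF R sol W pos W'_eq f])
  have Wc: "continuous_on {0<..<R} W" by (rule DERIV_Ioo_continuous_on[OF W])
  have pos': "W r \<ge> 0" if "0 < r" "r < R" for r using pos[OF that] by simp
  have gr: "r * W' r \<ge> - lam * W r" if "0 < r" "r < R" for r
  proof -
    have "r * W' r = - lam * W r + r * W r * f r" using that by (simp add: W'_eq[OF that] field_simps)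
    moreover have "r * W r * f r \<ge> 0" using that pos' f0 by simp
    ultimately show ?thesis by simp
  qed
  have vk: "Ck k v" for k using v by (simp add: Cc_inf_ball_def)
  define q where "q = (2 * mu + 4 - n) / 4"
  let ?e = "(n + 2 * mu) * (n - 4 - 2 * mu) / 4"
  let ?S = "ball 0 R - {0::'a}"
  let ?g = "\<lambda>x. B * ((v x)\<^sup>2 / norm x powr (2 * mu + 4)) + D * (W (norm x) * (v x)\<^sup>2 / norm x powr (2 * mu + 2))"
  have "(\<integral>\<^sup>+x\<in>?S. ennreal (?g x) \<partial>lborel) \<le> (\<integral>\<^sup>+x\<in>?S. ennreal ((laplacian v x)\<^sup>2 / norm x powr (2 * mu)) \<partial>lborel)"
  proof (rule cut_limit[OF R vk])
    show "2 * mu + 4 \<le> real DIM('a)" using mu n by simp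
    show "continuous_on ?S ?g"
      by (rule nn_integral_combination(1)[OF R Ck_continuous_on[OF vk] Wc pos' B(1) D])
    show "?g x \<ge> 0" if "x \<noteq> 0" "norm x < R" for x
      using B(1) D pos'[of "norm x"] that by (intro add_nonneg_nonneg mult_nonneg_nonneg divide_nonneg_nonneg) auto
    fix \<kappa> :: real assume \<kappa>: "\<kappa> > 0"
    define u where "u = (\<lambda>x. v x * log_cut R \<kappa> 0 0 (x \<bullet> x))"
    have u: "smooth_ann R u" unfolding u_def by (rule smooth_ann_cut[OF R \<kappa> v])
    define w where "w = (\<lambda>x. u x * (x \<bullet> x) powr (- q))"
    have w: "smooth_ann R w" unfolding w_def by (rule smooth_ann_radial_sq[OF u smooth_pos_powr])
    have uw: "u x = w x * (x \<bullet> x) powr ((2 * mu + 4 - n) / 4)" for x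
      using Ck_ann_zero[OF smooth_annD[OF u]] by (cases "x = 0") (simp_all add: w_def q_def powr_minus field_simps)
    then have uw: "u = (\<lambda>x. w x * (x \<bullet> x) powr ((2 * mu + 4 - n) / 4))" by blast
    \<comment> \<open>The stretching argument needs the Rellich bound for all annular functions, not
      just for this w; \<open>rellich_test\<close> supplies it with its own v for each.\<close>
    have ang: "B * cyl_int (\<lambda>x. (w x)\<^sup>2) \<le> cyl_int (\<lambda>x. (sphere_lap w x - ?e * w x)\<^sup>2)"
      by (rule cyl_int_angular[OF R rellich_test[OF _ n refl B] w])
    have VJ: "cyl_int (\<lambda>x. (w x)\<^sup>2) \<ge> 0" "cyl_int (\<lambda>x. (w x)\<^sup>2 * ((norm x)\<^sup>2 * W (norm x))) \<ge> 0"
    proof -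
      show "cyl_int (\<lambda>x. (w x)\<^sup>2) \<ge> 0" by (rule cyl_int_nonneg) simp
      show "cyl_int (\<lambda>x. (w x)\<^sup>2 * ((norm x)\<^sup>2 * W (norm x))) \<ge> 0"
      proof (rule cyl_int_nonneg)
        fix x show "0 \<le> (w x)\<^sup>2 * ((norm x)\<^sup>2 * W (norm x))"
          using pos'[of "norm x"] Ck_ann_outside[OF smooth_annD[OF w], of x] by (cases "x \<noteq> 0 \<and> norm x < R") auto
      qed
    qed
    have "(\<integral>\<^sup>+x\<in>?S. ennreal ((log_cut R \<kappa> 0 0 (x \<bullet> x))\<^sup>2 * ?g x) \<partial>lborel) =
       (\<integral>\<^sup>+x\<in>?S. ennreal (B * ((u x)\<^sup>2 / norm x powr (2 * mu + 4)) + D * (W (norm x) * (u x)\<^sup>2 / norm x powr (2 * mu + 2))) \<partial>lborel)"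
      by (simp add: u_def algebra_simps power_mult_distrib)
    also have "\<dots> = ennreal B * (\<integral>\<^sup>+x\<in>ball 0 R. ennreal ((u x)\<^sup>2 / norm x powr (2 * mu + 4)) \<partial>lborel)
      + ennreal D * (\<integral>\<^sup>+x\<in>ball 0 R. ennreal (W (norm x) * (u x)\<^sup>2 / norm x powr (2 * mu + 2)) \<partial>lborel)"
      using smooth_annD[OF u, of 0] by (intro nn_integral_combination(2) R Wc pos' B(1) D) (auto simp: Ck_ann_def)
    also have "\<dots> = ennreal B * ennreal (cyl_int (\<lambda>x. (w x)\<^sup>2)) + ennreal D * ennreal (cyl_int (\<lambda>x. (w x)\<^sup>2 * ((norm x)\<^sup>2 * W (norm x))))"
      using nn_integral_v[OF w n uw] nn_integral_W_v[OF w n uw Wc pos'] by simp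
    also have "\<dots> = ennreal (B * cyl_int (\<lambda>x. (w x)\<^sup>2) + D * cyl_int (\<lambda>x. (w x)\<^sup>2 * ((norm x)\<^sup>2 * W (norm x))))"
      using B(1) D VJ by (simp add: ennreal_mult)
    also have "\<dots> \<le> ennreal (cyl_int (\<lambda>x. (cyl_op (2 * mu + 2) ?e w x)\<^sup>2))"
      unfolding D_def using sol(2)
      by (intro ennreal_leI cyl_int_cyl_op_main[OF w sol(1) _ W W' pos' gr lam mu ang]) auto
    also have "\<dots> = (\<integral>\<^sup>+x\<in>?S. ennreal ((laplacian u x)\<^sup>2 / norm x powr (2 * mu)) \<partial>lborel)"
      using nn_integral_laplacian_v[OF w n uw] unfolding nn_integral_punctured_ball by simp
    finally show "(\<integral>\<^sup>+x\<in>?S. ennreal ((log_cut R \<kappa> 0 0 (x \<bullet> x))\<^sup>2 * ?g x) \<partial>lborel) \<le>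
      (\<integral>\<^sup>+x\<in>?S. ennreal ((laplacian (\<lambda>x. v x * log_cut R \<kappa> 0 0 (x \<bullet> x)) x)\<^sup>2 / norm x powr (2 * mu)) \<partial>lborel)"
      unfolding u_def .
  qed
  moreover have "(\<integral>\<^sup>+x\<in>?S. ennreal (?g x) \<partial>lborel) =
      ennreal B * (\<integral>\<^sup>+x\<in>ball 0 R. ennreal ((v x)\<^sup>2 / norm x powr (2 * mu + 4)) \<partial>lborel) +
      ennreal D * (\<integral>\<^sup>+x\<in>ball 0 R. ennreal (W (norm x) * (v x)\<^sup>2 / norm x powr (2 * mu + 2)) \<partial>lborel)"
    by (rule nn_integral_combination(2)[OF R Ck_continuous_on[OF vk] Wc pos' B(1) D])
  ultimately show ?thesis
    unfolding nn_integral_punctured_ball[where g = "\<lambda>x. ennreal ((laplacian v x)\<^sup>2 / norm x powr (2 * mu))"] D_def by simp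
qed

text \<open>If b is infinite it is the supremum of the naturals, which passes through the product
  and the sum. This spares a proof that \<open>rellich_const\<close> is finite.\<close>

lemma ennreal_mult_le_limit:
  fixes b X Y Z :: ennreal
  assumes "\<And>B. B \<ge> 0 \<Longrightarrow> ennreal B \<le> b \<Longrightarrow> ennreal B * X + Y \<le> Z"
  shows "b * X + Y \<le> Z"
proof (cases b)
  case (real B)
  then show ?thesis using assms[of B] by simp
next
  case top
  have "b * X + Y = Y + (SUP n. of_nat n) * X" unfolding top ennreal_SUP_of_nat_eq_top by (simp add: add.commute)
  also have "\<dots> = (SUP n. Y + of_nat n * X)"
    by (simp add: SUP_mult_right_ennreal ennreal_SUP_add_right)
  also have "\<dots> \<le> Z"
  proof (rule SUP_least)
    fix n :: nat
    show "Y + of_nat n * X \<le> Z" using assms[of "real n"] top by (simp add: add.commute ennreal_of_nat_eq_real_of_nat)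
  qed
  finally show ?thesis .
qed

lemma hardy_rellich:
  fixes v :: "'a::euclidean_space \<Rightarrow> real" and W f :: "real \<Rightarrow> real"
  assumes R: "R > 0" and bp: "bessel_potential W R"
    and Wf: "\<forall>r\<in>{0<..<R}. W r \<noteq> 0 \<and> deriv W r / W r = - (lam / r) + f r"
    and f0: "\<forall>r\<in>{0<..<R}. f r \<ge> 0"
    and f: "((\<lambda>r. r * f r) \<longlongrightarrow> 0) (at_right 0)"
    and mu: "2 * mu + 4 \<le> real DIM('a)" and v: "v \<in> Cc_inf_ball R"
  shows "rellich_const TYPE('a) R mu * (\<integral>\<^sup>+x\<in>ball 0 R. ennreal ((v x)\<^sup>2 / norm x powr (2 * mu + 4)) \<partial>lborel)
    + sigma_const TYPE('a) W R lam mu * (\<integral>\<^sup>+x\<in>ball 0 R. ennreal (W (norm x) * (v x)\<^sup>2 / norm x powr (2 * mu + 2)) \<partial>lborel)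
    \<le> (\<integral>\<^sup>+x\<in>ball 0 R. ennreal ((laplacian v x)\<^sup>2 / norm x powr (2 * mu)) \<partial>lborel)" (is "_ * ?X + _ * ?Y \<le> ?Z")
proof (rule ennreal_mult_le_limit)
  fix B :: real assume B: "B \<ge> 0" "ennreal B \<le> rellich_const TYPE('a) R mu"
  let ?n = "real DIM('a)"
  define K where "K = (?n + 2 * mu)\<^sup>2 / 4 + (?n - 2 * mu - lam - 2)\<^sup>2 / 4"
  have K: "K \<ge> 0" by (simp add: K_def)
  from bp obtain W' where W'c: "continuous_on {0<..<R} W'"
    and WV: "\<And>r. r \<in> {0<..<R} \<Longrightarrow> (W has_vector_derivative W' r) (at r)"
    unfolding bessel_potential_def C1_differentiable_on_def by blast
  have W: "(W has_real_derivative W' r) (at r)" if "0 < r" "r < R" for r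
    using WV[of r] that by (simp add: has_real_derivative_iff_has_vector_derivative)
  have pos: "W r > 0" if "0 < r" "r < R" for r
    using bp Wf that unfolding bessel_potential_def by (metis greaterThanLessThan_iff less_eq_real_def)
  have W'_eq: "W' r = W r * (- (lam / r) + f r)" if "0 < r" "r < R" for r
  proof -
    have "W' r / W r = - (lam / r) + f r" using bspec[OF Wf, of r] that DERIV_imp_deriv[OF W[OF that]] by auto
    then show ?thesis using pos[OF that] by (simp add: nonzero_divide_eq_eq mult.commute)
  qed
  have f0': "f r \<ge> 0" if "0 < r" "r < R" for r using f0 that by auto
  let ?C = "{c. c > 0 \<and> bessel_positive_solution W R c}"
  \<comment> \<open>A constant summand may be moved into a supremum only over a nonempty
    set.\<close>
  have ne: "?C \<noteq> {}" using bp unfolding bessel_potential_def by blast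
  have "sigma_const TYPE('a) W R lam mu * ?Y = (SUP c\<in>?C. ennreal c * (ennreal K * ?Y))"
    unfolding sigma_const_def bessel_weight_def K_def mult.assoc by (rule SUP_mult_right_ennreal)
  then have "ennreal B * ?X + sigma_const TYPE('a) W R lam mu * ?Y = (SUP c\<in>?C. ennreal B * ?X + ennreal c * (ennreal K * ?Y))"
    using ennreal_SUP_add_right[OF ne] by simp
  also have "\<dots> \<le> ?Z"
  proof (rule SUP_least)
    fix c assume c: "c \<in> ?C"
    then have "ennreal c * (ennreal K * ?Y) = ennreal (c * K) * ?Y"
      using K by (simp add: ennreal_mult mult.assoc)
    then show "ennreal B * ?X + ennreal c * (ennreal K * ?Y) \<le> ?Z"
      using hardy_rellich_real[OF R v _ _ W W'c pos W'_eq f0' f refl mu B, of c] c by (simp add: K_def)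
  qed
  finally show "ennreal B * ?X + sigma_const TYPE('a) W R lam mu * ?Y \<le> ?Z" .
qed

section \<open>Iteration along the powers of the Laplacian\<close>

lemma Cc_inf_ball_laplacian:
  assumes f: "f \<in> Cc_inf_ball R" shows "laplacian f \<in> Cc_inf_ball R"
proof -
  let ?K = "closure {x. f x \<noteq> 0}"
  have fk: "Ck k f" for k using f by (simp add: Cc_inf_ball_def)
  have K: "compact ?K" "?K \<subseteq> ball 0 R" using f by (auto simp: Cc_inf_ball_def)
  have "laplacian f x = 0" if "x \<notin> ?K" for x
  proof -
    have z: "partial_deriv i h y = 0" if "y \<notin> ?K" "\<And>y. y \<notin> ?K \<Longrightarrow> h y = 0" for i y and h :: "'a \<Rightarrow> real"
      by (rule partial_deriv_eq[OF annular_has_derivative_0[of "- ?K"]]) (use that in \<open>auto simp: open_Compl\<close>)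
    have "f y = 0" if "y \<notin> ?K" for y using that closure_subset[of "{x. f x \<noteq> 0}"] by auto
    then show ?thesis unfolding laplacian_def using that z by (intro sum.neutral) blast
  qed
  then have "{x. laplacian f x \<noteq> 0} \<subseteq> ?K" by auto
  then have cl: "closure {x. laplacian f x \<noteq> 0} \<subseteq> ?K" by (rule closure_minimal) simp
  moreover have "compact (closure {x. laplacian f x \<noteq> 0})"
    using closed_Int_compact[OF closed_closure K(1), of "{x. laplacian f x \<noteq> 0}"] cl by (simp add: Int_absorb2)
  ultimately show ?thesis using K(2) Ck_laplacian[OF fk] by (auto simp: Cc_inf_ball_def)
qed

text \<open>Since k + 2 j - 2 = k + 2 (j - 1), the product attached to the i-th remainder is the
  product of the constants used in the i preceding steps.\<close>

lemma prod_shift_index: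
  fixes b :: "real \<Rightarrow> 'c::comm_monoid_mult"
  shows "(\<Prod>j = 1..i. b (k + 2 * real j - 2)) = (\<Prod>j = 0..<i. b (k + 2 * real j))"
  by (induction i) (auto simp: algebra_simps)

theorem theorem4p1:
  fixes R lam k :: real and W f :: "real \<Rightarrow> real" and m l :: nat
    and u :: "'a::euclidean_space \<Rightarrow> real"
  assumes "R > 0"
    and "bessel_potential W R"
    and "\<forall>r\<in>{0<..<R}. W r \<noteq> 0 \<and> deriv W r / W r = - (lam / r) + f r"
    and "\<forall>r\<in>{0<..<R}. f r \<ge> 0"
    and "((\<lambda>r. r * f r) \<longlongrightarrow> 0) (at_right 0)"
    and "1 \<le> l" and "l \<le> m"
    and "2 * k + 4 * real m \<le> real DIM('a)"
    and "u \<in> Cc_inf_ball R"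
  shows "(\<integral>\<^sup>+x\<in>ball 0 R. ennreal (((laplacian ^^ m) u x)\<^sup>2 / norm x powr (2 * k)) \<partial>lborel)
    \<ge> (\<Prod>i = 0..<l. rellich_const TYPE('a) R (k + 2 * real i)) *
        (\<integral>\<^sup>+x\<in>ball 0 R. ennreal (((laplacian ^^ (m - l)) u x)\<^sup>2
            / norm x powr (2 * k + 4 * real l)) \<partial>lborel)
      + (\<Sum>i = 0..<l. sigma_const TYPE('a) W R lam (k + 2 * real i) *
          (\<Prod>j = 1..i. rellich_const TYPE('a) R (k + 2 * real j - 2)) *
          (\<integral>\<^sup>+x\<in>ball 0 R. ennreal (W (norm x) * ((laplacian ^^ (m - i - 1)) u x)\<^sup>2
              / norm x powr (2 * k + 4 * real i + 2)) \<partial>lborel))"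
proof -
  define \<beta> where "\<beta> = rellich_const TYPE('a) R"
  define \<sigma> where "\<sigma> = sigma_const TYPE('a) W R lam"
  define F where "F = (\<lambda>j. \<integral>\<^sup>+x\<in>ball 0 R. ennreal (((laplacian ^^ (m - j)) u x)\<^sup>2 / norm x powr (2 * k + 4 * real j)) \<partial>lborel)"
  define G where "G = (\<lambda>i. \<integral>\<^sup>+x\<in>ball 0 R. ennreal (W (norm x) * ((laplacian ^^ (m - i - 1)) u x)\<^sup>2
              / norm x powr (2 * k + 4 * real i + 2)) \<partial>lborel)"
  have lapu: "(laplacian ^^ j) u \<in> Cc_inf_ball R" for j
    by (induction j) (auto intro: assms(9) Cc_inf_ball_laplacian)
  \<comment> \<open>\<open>hardy_rellich\<close> for the Laplacian power m - j - 1 with mu = k + 2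
    j. The bound j <= m - 1 gives 2 mu + 4 <= 2 k + 4 m <= n, so exactly m steps are
    available.\<close>
  have step: "\<beta> (k + 2 * real j) * F (Suc j) + \<sigma> (k + 2 * real j) * G j \<le> F j" if j: "j < m" for j
  proof -
    let ?v = "(laplacian ^^ (m - j - 1)) u"
    have "Suc (m - j - 1) = m - j" using j by simp
    then have lv: "laplacian ?v = (laplacian ^^ (m - j)) u" by (metis comp_apply funpow.simps(2))
    have mu: "2 * (k + 2 * real j) + 4 \<le> real DIM('a)" using assms(8) j by simp
    have e: "2 * (k + 2 * real j) + 4 = 2 * k + 4 * real (Suc j)" "2 * (k + 2 * real j) + 2 = 2 * k + 4 * real j + 2"
      "2 * (k + 2 * real j) = 2 * k + 4 * real j" "m - Suc j = m - j - 1" by simp_all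
    show ?thesis
      using hardy_rellich[OF assms(1-5) mu lapu[of "m - j - 1"]]
      unfolding lv \<beta>_def \<sigma>_def F_def G_def e(1,2,4) unfolding e(3) .
  qed
  \<comment> \<open>Each step expands only the leading term F j. The new remainder inherits the
    product of all constants collected so far, which is why its upper limit is i.\<close>
  have "(\<Prod>i = 0..<j. \<beta> (k + 2 * real i)) * F j +
      (\<Sum>i = 0..<j. \<sigma> (k + 2 * real i) * (\<Prod>t = 1..i. \<beta> (k + 2 * real t - 2)) * G i) \<le> F 0" if "j \<le> m" for j
    using that
  proof (induction j)
    case (Suc j)
    let ?p = "\<Prod>i = 0..<j. \<beta> (k + 2 * real i)"
    let ?s = "\<Sum>i = 0..<j. \<sigma> (k + 2 * real i) * (\<Prod>t = 1..i. \<beta> (k + 2 * real t - 2)) * G i"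
    have "(\<Prod>i = 0..<Suc j. \<beta> (k + 2 * real i)) * F (Suc j) +
      (\<Sum>i = 0..<Suc j. \<sigma> (k + 2 * real i) * (\<Prod>t = 1..i. \<beta> (k + 2 * real t - 2)) * G i)
      = ?p * (\<beta> (k + 2 * real j) * F (Suc j) + \<sigma> (k + 2 * real j) * G j) + ?s"
      unfolding sum.atLeast0_lessThan_Suc prod.atLeast0_lessThan_Suc prod_shift_index
      by (simp add: distrib_left mult_ac add_ac)
    also have "\<dots> \<le> ?p * F j + ?s"
      using Suc.prems by (intro add_right_mono mult_left_mono step) auto
    also have "\<dots> \<le> F 0" using Suc by simp
    finally show ?case .
  qed (simp add: F_def)
  from this[OF assms(7)] show ?thesis unfolding \<beta>_def \<sigma>_def F_def G_def by simp
qed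

end
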